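(* Let $\{X_{1}(t)\mid 0\leq t\leq1\}$ and $\{X_{2}(t)\mid 0\leq t\leq1\}$ be independent continuous centered Gaussian processes, both starting at zero, with equivalent covariance functions $R_1$ and $R_2$ respectively, and suppose that the generalised Lévy area $I_2(f^{\mathcal L}):=I_2(\hat f^{\mathcal L})$ exists. Let $F:H\to H$ be the Hilbert–Schmidt operator corresponding to $\hat f^{\mathcal L}$. Then the nonzero eigenvalues of $F$ have even multiplicity and are symmetric with respect to zero. As a consequence, the characteristic function $\varphi(t)=\mathbb E[e^{itI_2(f^{\mathcal L})}]$, $t\in\mathbb R$, of the generalised Lévy area is of the form $$\varphi(t)=\prod_{n\ge1}\frac{1}{(1+4\alpha_n^2t^2)^{m_n}},$$ where $(\alpha_n)_{n\ge 1}$ are the distinct positive eigenvalues of $F$ and the $m_n\ge1$ are integers.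
   Context: **Hilbert spaces.** Let $\mathcal E$ be the set of step functions $\phi=\sum_{k=1}^n a_k\mathbf 1_{(t_k,t_{k+1}]}$ on $[0,1]$, $a_k\in\mathbb R$. For $i=1,2$, $H_i$ is the completion of $\mathcal E$ (after identifying elements at zero distance) under $\langle\phi_1,\phi_2\rangle_{H_i}=\iint_{[0,1]^2}\phi_1(s)\phi_2(t)\,dR_i(s,t)$, where $dR_i$ assigns to a rectangle $[a,b]\times[c,d]$ the increment $R_i(b,d)-R_i(b,c)-R_i(a,d)+R_i(a,c)$. $H$ is the completion of the set $\mathcal E_2$ of functions $f$ on $[0,1]\times\{1,2\}$ with $f(\cdot,1),f(\cdot,2)\in\mathcal E$, under $\langle f,g\rangle=\langle f(\cdot,1),g(\cdot,1)\rangle_{H_1}+\langle f(\cdot,2),g(\cdot,2)\rangle_{H_2}$; thus $H\cong H_1\oplus H_2$. $H^{\otimes2}$ denotes the Hilbert tensor square and $H^{\odot2}$ the symmetric tensor square. Via $H^{\otimes 2}\cong\bigoplus_{i,j=1}^2H_i\otimes H_j$, elements of $H^{\otimes2}$ are $2\times2$ matrices $f=(f_{ij})$, $f_{ij}\in H_i\otimes H_j$, with $\langle f,g\rangle_{H^{\otimes2}}=\sum_{i,j}\langle f_{ij},g_{ij}\rangle_{H_i\otimes H_j}$. For a function $f$ on $([0,1]\times\{1,2\})^2$, $f_{ij}(s,t)=f((s,i),(t,j))$. **Equivalent covariances.** $R_1$ and $R_2$ are called equivalent if the associated Hilbert spaces $H_1$ and $H_2$ are the same (as Hilbert spaces, i.e.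 with the same inner product). **Isonormal process and $I_2$.** The isonormal Gaussian process $X=\{X(f)\mid f\in H\}$ (centered Gaussian, $\mathbb E[X(f)X(g)]=\langle f,g\rangle_H$) is the isometric extension to $H$ of $X(f)=X_1(f(\cdot,1))+X_2(f(\cdot,2))$, $f\in\mathcal E_2$, where $X_i(\mathbf 1_{(a,b]})=X_i(b)-X_i(a)$ extended linearly. $I_2$ is the double Wiener–Itô integral with respect to $X$: the continuous linear map from $H^{\odot2}$ to $L^2(\Omega)$ with $I_2(h\otimes h)=X(h)^2-1$ for $\|h\|_H=1$. **Lévy kernel and generalised Lévy area.** Let $T_1=\{(s,t)\in[0,1]^2\mid s<t\}$, $T_2=\{(s,t)\in[0,1]^2\mid s>t\}$, and let $f^{\mathcal L}_{11}=f^{\mathcal L}_{22}=0$, $f^{\mathcal L}_{12}=\frac12(\mathbf 1_{T_1}-\mathbf 1_{T_2})$, $f^{\mathcal L}_{21}=\frac12(\mathbf 1_{T_2}-\mathbf 1_{T_1})$. The generalised Lévy area exists if there is $\hat f^{\mathcal L}\in H^{\odot2}$ such that $$\langle\hat f^{\mathcal L},g\rangle_{H^{\otimes2}}=\sum_{i,j=1}^2\iiiint_{[0,1]^4}f^{\mathcal L}_{ij}(s,u)\,g_{ij}(t,v)\,dR_i(s,t)\,dR_j(u,v)$$ for all step functions $g\in\mathcal E_2^{\otimes2}$ (the integrals being iterated Riemann–Stieltjes integrals, first in $(s,t)$, then in $(u,v)$, assumed to exist); then $I_2(f^{\mathcal L}):=I_2(\hat f^{\mathcal L})$. **Associated operator.**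 For $f\in H^{\otimes2}$, the Hilbert–Schmidt operator $F:H\to H$ corresponding to $f$ is defined by $\langle F(g),h\rangle_H=\langle f,g\otimes h\rangle_{H^{\otimes2}}$ for all $g,h\in H$. *)

theory Defs
  imports "HOL-Probability.Probability"
begin

definition grid :: "nat \<Rightarrow> (nat \<Rightarrow> real) \<Rightarrow> bool" where
  "grid n t \<longleftrightarrow> (\<forall>k\<le>n. t k \<in> {0..1}) \<and> (\<forall>k<n. t k < t (Suc k))"

definition step_fun :: "nat \<Rightarrow> (nat \<Rightarrow> real) \<Rightarrow> (nat \<Rightarrow> real) \<Rightarrow> real \<Rightarrow> real" where
  "step_fun n a t = (\<lambda>x. \<Sum>k<n. a k * indicator {t k<..t (Suc k)} x)"

text \<open>Functions on \<open>[0,1]\<close> are represented by functions on the real line; step functions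
  vanish outside \<open>(0,1]\<close>.\<close>

definition steps :: "(real \<Rightarrow> real) set" where
  "steps = {step_fun n a t | n a t. grid n t}"

text \<open>The two-element index set \<open>{1,2}\<close> is the numeral type \<^typ>\<open>2\<close>.\<close>

definition steps2 :: "(real \<times> 2 \<Rightarrow> real) set" where
  "steps2 = {f. \<forall>i. (\<lambda>s. f (s, i)) \<in> steps}"

text \<open>The linear extension to step functions of \<open>indicator {a<..b} \<mapsto> Q b - Q a\<close>.\<close>

definition step_int :: "(real \<Rightarrow> real) \<Rightarrow> (real \<Rightarrow> real) \<Rightarrow> real" where
  "step_int Q \<phi> = (THE c. \<exists>n a t. grid n t \<and> \<phi> = step_fun n a t \<and>
      c = (\<Sum>k<n. a k * (Q (t (Suc k)) - Q (t k))))"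

text \<open>The mass that \<open>dR\<close> gives to the rectangle \<open>[a,b] \<times> [c,d]\<close>.\<close>

definition incr :: "(real \<Rightarrow> real \<Rightarrow> real) \<Rightarrow> real \<Rightarrow> real \<Rightarrow> real \<Rightarrow> real \<Rightarrow> real" where
  "incr R a b c d = R b d - R b c - R a d + R a c"

text \<open>\<open>\<integral>\<integral> \<phi>(s) \<psi>(t) dR(s,t)\<close> for step functions. That the value does not depend on the
  representations is lemma \<open>step_form_step_fun\<close> below.\<close>

definition step_form :: "(real \<Rightarrow> real \<Rightarrow> real) \<Rightarrow> (real \<Rightarrow> real) \<Rightarrow> (real \<Rightarrow> real) \<Rightarrow> real" where
  "step_form R \<phi> \<psi> = (THE c. \<exists>n a t m b u. grid n t \<and> \<phi> = step_fun n a t \<and>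
      grid m u \<and> \<psi> = step_fun m b u \<and>
      c = (\<Sum>k<n. \<Sum>l<m. a k * b l * incr R (t k) (t (Suc k)) (u l) (u (Suc l))))"

definition step_form2 ::
  "(2 \<Rightarrow> real \<Rightarrow> real \<Rightarrow> real) \<Rightarrow> (real \<times> 2 \<Rightarrow> real) \<Rightarrow> (real \<times> 2 \<Rightarrow> real) \<Rightarrow> real" where
  "step_form2 R f g = (\<Sum>i\<in>UNIV. step_form (R i) (\<lambda>s. f (s, i)) (\<lambda>s. g (s, i)))"

lemma step_fun_jump:
  assumes "grid n t"
  shows "(step_fun n a t \<longlongrightarrow>
    step_fun n a t x - (\<Sum>k<n. a k * (of_bool (t (Suc k) = x) - of_bool (t k = x)))) (at_right x)"
proof -
  have "((\<lambda>y. indicator {c<..d} y :: real) \<longlongrightarrow>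
      indicator {c<..d} x - (of_bool (d = x) - of_bool (c = x))) (at_right x)"
    if "c < d" for c d :: real
  proof (rule tendsto_eventually)
    consider "x < c" | "c \<le> x" "x < d" | "d \<le> x" by linarith
    then show "\<forall>\<^sub>F y in at_right x.
        indicator {c<..d} y = (indicator {c<..d} x - (of_bool (d = x) - of_bool (c = x)) :: real)"
    proof cases
      case 1
      then have "\<forall>\<^sub>F y in at_right x. x < y \<and> y < c"
        by (auto simp: eventually_at_right)
      then show ?thesis
        by eventually_elim (use 1 that in auto)
    next
      case 2
      then have "\<forall>\<^sub>F y in at_right x. x < y \<and> y < d"
        by (auto simp: eventually_at_right)
      then show ?thesis
        by eventually_elim (use 2 in auto)
    next
      case 3
      have "\<forall>\<^sub>F y in at_right x. x < y"
        by (simp add: eventually_at_filter)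
      then show ?thesis
        by eventually_elim (use 3 that in auto)
    qed
  qed
  then have "((\<lambda>y. \<Sum>k<n. a k * indicator {t k<..t (Suc k)} y) \<longlongrightarrow>
      (\<Sum>k<n. a k * (indicator {t k<..t (Suc k)} x - (of_bool (t (Suc k) = x) - of_bool (t k = x)))))
      (at_right x)"
    using assms by (intro tendsto_sum tendsto_mult tendsto_const) (auto simp: grid_def)
  then show ?thesis
    by (simp add: step_fun_def right_diff_distrib sum_subtractf)
qed

lemma step_int_unique:
  assumes "grid n t" "grid m u" "step_fun n a t = step_fun m b u"
  shows "(\<Sum>k<n. a k * (Q (t (Suc k)) - Q (t k))) = (\<Sum>k<m. b k * (Q (u (Suc k)) - Q (u k)))"
proof -
  define P where "P = t ` {..n} \<union> u ` {..m}"
  have fin: "finite P" by (simp add: P_def)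
  have ev: "(\<Sum>k<N. c k * (Q (v (Suc k)) - Q (v k))) =
      (\<Sum>x\<in>P. (\<Sum>k<N. c k * (of_bool (v (Suc k) = x) - of_bool (v k = x))) * Q x)"
    if "v ` {..N} \<subseteq> P" for N c v
  proof -
    have *: "Q (v j) = (\<Sum>x\<in>P. of_bool (v j = x) * Q x)" if "j \<le> N" for j
      using \<open>v ` {..N} \<subseteq> P\<close> that fin by (simp add: of_bool_def if_distrib if_distribR cong: if_cong) blast
    have "(\<Sum>k<N. c k * (Q (v (Suc k)) - Q (v k))) =
        (\<Sum>k<N. \<Sum>x\<in>P. c k * (of_bool (v (Suc k) = x) - of_bool (v k = x)) * Q x)"
    proof (rule sum.cong)
      fix k assume "k \<in> {..<N}"
      then show "c k * (Q (v (Suc k)) - Q (v k)) =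
          (\<Sum>x\<in>P. c k * (of_bool (v (Suc k) = x) - of_bool (v k = x)) * Q x)"
        using *[of k] *[of "Suc k"]
        by (simp add: sum_subtractf sum_distrib_left algebra_simps)
    qed simp
    then show ?thesis
      by (simp add: sum.swap[of _ P] sum_distrib_right)
  qed
  have "(\<Sum>k<n. a k * (of_bool (t (Suc k) = x) - of_bool (t k = x))) =
      (\<Sum>k<m. b k * (of_bool (u (Suc k) = x) - of_bool (u k = x)) :: real)" for x
    using tendsto_unique[OF _ step_fun_jump[OF assms(1), of a x]
        step_fun_jump[OF assms(2), of b x, folded assms(3)]] by simp
  then show ?thesis
    by (subst (1 2) ev) (auto simp: P_def)
qed

lemma step_int_step_fun:
  assumes "grid n t"
  shows "step_int Q (step_fun n a t) = (\<Sum>k<n. a k * (Q (t (Suc k)) - Q (t k)))"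
  unfolding step_int_def using assms by (intro the_equality) (auto intro: step_int_unique)

lemma step_form_step_fun:
  assumes "grid n t" "grid m u"
  shows "step_form R (step_fun n a t) (step_fun m b u) =
    (\<Sum>k<n. \<Sum>l<m. a k * b l * incr R (t k) (t (Suc k)) (u l) (u (Suc l)))"
proof -
  have iter: "(\<Sum>k<n. \<Sum>l<m. a k * b l * incr R (t k) (t (Suc k)) (u l) (u (Suc l))) =
      step_int (\<lambda>s. step_int (R s) (step_fun m b u)) (step_fun n a t)"
    if "grid n t" "grid m u" for n m a b t u
    using that
    by (simp add: step_int_step_fun incr_def sum_distrib_left sum_subtractf algebra_simps sum.distrib)
  show ?thesis
    unfolding step_form_def
  proof (rule the_equality)
    fix c
    assume "\<exists>n' a' t' m' b' u'. grid n' t' \<and> step_fun n a t = step_fun n' a' t' \<and>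
      grid m' u' \<and> step_fun m b u = step_fun m' b' u' \<and>
      c = (\<Sum>k<n'. \<Sum>l<m'. a' k * b' l * incr R (t' k) (t' (Suc k)) (u' l) (u' (Suc l)))"
    then obtain n' a' t' m' b' u' where
      c: "grid n' t'" "step_fun n a t = step_fun n' a' t'" "grid m' u'" "step_fun m b u = step_fun m' b' u'"
         "c = (\<Sum>k<n'. \<Sum>l<m'. a' k * b' l * incr R (t' k) (t' (Suc k)) (u' l) (u' (Suc l)))"
      by blast
    show "c = (\<Sum>k<n. \<Sum>l<m. a k * b l * incr R (t k) (t (Suc k)) (u l) (u (Suc l)))"
      unfolding c(5) iter[OF c(1,3)] iter[OF assms] c(2,4) ..
  qed (use assms in blast)
qed

text \<open>\<open>\<iota>\<close> exhibits the Hilbert space \<open>'h\<close> as the completion of the function space \<open>V\<close> with respect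
  to the positive semidefinite form \<open>B\<close>. Functions at zero distance have the same image. The
  completion is unique up to a unique isometry commuting with \<open>\<iota>\<close>.\<close>

definition is_completion ::
  "('p \<Rightarrow> real) set \<Rightarrow> (('p \<Rightarrow> real) \<Rightarrow> ('p \<Rightarrow> real) \<Rightarrow> real) \<Rightarrow>
    (('p \<Rightarrow> real) \<Rightarrow> 'h::{real_inner, complete_space}) \<Rightarrow> bool" where
  "is_completion V B \<iota> \<longleftrightarrow>
    (\<forall>f\<in>V. \<forall>g\<in>V. \<forall>a b. \<iota> (\<lambda>p. a * f p + b * g p) = a *\<^sub>R \<iota> f + b *\<^sub>R \<iota> g) \<and>
    (\<forall>f\<in>V. \<forall>g\<in>V. \<iota> f \<bullet> \<iota> g = B f g) \<and>
    closure (\<iota> ` V) = UNIV"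

text \<open>Two completions of the space of step functions are the same Hilbert space: the identity of
  the step functions extends to an isometric isomorphism. (An abstract isometry would not do: it
  exists between any two infinite-dimensional separable Hilbert spaces.)\<close>

definition same_completion ::
  "((real \<Rightarrow> real) \<Rightarrow> 'h1::{real_inner, complete_space}) \<Rightarrow>
    ((real \<Rightarrow> real) \<Rightarrow> 'h2::{real_inner, complete_space}) \<Rightarrow> bool" where
  "same_completion \<iota>\<^sub>1 \<iota>\<^sub>2 \<longleftrightarrow>
    (\<exists>U. linear U \<and> bij U \<and> (\<forall>x y. U x \<bullet> U y = x \<bullet> y) \<and> (\<forall>\<phi>\<in>steps. U (\<iota>\<^sub>1 \<phi>) = \<iota>\<^sub>2 \<phi>))"

text \<open>As with completions, the Hilbert tensor product is characterised up to a unique isometry.\<close>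

definition is_hilbert_tensor ::
  "('a::{real_inner, complete_space} \<Rightarrow> 'b::{real_inner, complete_space} \<Rightarrow>
    't::{real_inner, complete_space}) \<Rightarrow> bool" where
  "is_hilbert_tensor T \<longleftrightarrow> bounded_bilinear T \<and>
    (\<forall>a b c d. T a b \<bullet> T c d = (a \<bullet> c) * (b \<bullet> d)) \<and>
    closure (span {T a b | a b. True}) = UNIV"

definition sym_square ::
  "('h::{real_inner, complete_space} \<Rightarrow> 'h \<Rightarrow> 't::{real_inner, complete_space}) \<Rightarrow> 't set" where
  "sym_square T = closure (span {(1/2) *\<^sub>R (T a b + T b a) | a b. True})"

definition hs_operator ::
  "('h::{real_inner, complete_space} \<Rightarrow> 'h \<Rightarrow> 't::{real_inner, complete_space}) \<Rightarrow> 't \<Rightarrow>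
    ('h \<Rightarrow> 'h) \<Rightarrow> bool" where
  "hs_operator T f F \<longleftrightarrow> (\<forall>g h. F g \<bullet> h = f \<bullet> T g h)"

definition eigenspace :: "('h::real_vector \<Rightarrow> 'h) \<Rightarrow> real \<Rightarrow> 'h set" where
  "eigenspace F l = {x. F x = l *\<^sub>R x}"

definition eigenval :: "('h::real_vector \<Rightarrow> 'h) \<Rightarrow> real \<Rightarrow> bool" where
  "eigenval F l \<longleftrightarrow> (\<exists>x. x \<noteq> 0 \<and> F x = l *\<^sub>R x)"

text \<open>Degenerate (almost surely zero) variables count as Gaussian.\<close>

definition centered_gaussian_var :: "'w measure \<Rightarrow> ('w \<Rightarrow> real) \<Rightarrow> bool" where
  "centered_gaussian_var M Y \<longleftrightarrow> Y \<in> borel_measurable M \<and>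
    ((AE \<omega> in M. Y \<omega> = 0) \<or> (\<exists>\<sigma>>0. distributed M lborel Y (normal_density 0 \<sigma>)))"

definition centered_gaussian_process ::
  "'w measure \<Rightarrow> 'i set \<Rightarrow> ('i \<Rightarrow> 'w \<Rightarrow> real) \<Rightarrow> bool" where
  "centered_gaussian_process M I Y \<longleftrightarrow>
    (\<forall>J c. finite J \<longrightarrow> J \<subseteq> I \<longrightarrow> centered_gaussian_var M (\<lambda>\<omega>. \<Sum>i\<in>J. c i * Y i \<omega>))"

text \<open>The isonormal process \<open>W\<close> on \<open>'h\<close>, the completion of \<^const>\<open>steps2\<close> via \<open>\<iota>\<close>, determined by
  the pair of processes \<open>X\<close>.\<close>

definition isonormal ::
  "'w measure \<Rightarrow> (2 \<Rightarrow> real \<Rightarrow> 'w \<Rightarrow> real) \<Rightarrow>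
    ((real \<times> 2 \<Rightarrow> real) \<Rightarrow> 'h::{real_inner, complete_space}) \<Rightarrow> ('h \<Rightarrow> 'w \<Rightarrow> real) \<Rightarrow> bool" where
  "isonormal M X \<iota> W \<longleftrightarrow>
    centered_gaussian_process M UNIV W \<and>
    (\<forall>f g. (\<integral>\<omega>. W f \<omega> * W g \<omega> \<partial>M) = f \<bullet> g) \<and>
    (\<forall>f\<in>steps2. AE \<omega> in M. W (\<iota> f) \<omega> = (\<Sum>i\<in>UNIV. step_int (\<lambda>t. X i t \<omega>) (\<lambda>s. f (s, i))))"

text \<open>The double Wiener-Ito integral: a bounded linear map from the symmetric square to
  \<open>L\<^sup>2(M)\<close>, its values being given by representatives.\<close>

definition double_wiener_int ::
  "'w measure \<Rightarrow> ('h::{real_inner, complete_space} \<Rightarrow> 'w \<Rightarrow> real) \<Rightarrow>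
    ('h \<Rightarrow> 'h \<Rightarrow> 't::{real_inner, complete_space}) \<Rightarrow> ('t \<Rightarrow> 'w \<Rightarrow> real) \<Rightarrow> bool" where
  "double_wiener_int M W T I\<^sub>2 \<longleftrightarrow>
    (\<forall>f\<in>sym_square T. I\<^sub>2 f \<in> borel_measurable M \<and> integrable M (\<lambda>\<omega>. (I\<^sub>2 f \<omega>)\<^sup>2)) \<and>
    (\<forall>f\<in>sym_square T. \<forall>g\<in>sym_square T. \<forall>a b.
      AE \<omega> in M. I\<^sub>2 (a *\<^sub>R f + b *\<^sub>R g) \<omega> = a * I\<^sub>2 f \<omega> + b * I\<^sub>2 g \<omega>) \<and>
    (\<exists>C. \<forall>f\<in>sym_square T. (\<integral>\<omega>. (I\<^sub>2 f \<omega>)\<^sup>2 \<partial>M) \<le> C * (norm f)\<^sup>2) \<and>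
    (\<forall>h. norm h = 1 \<longrightarrow> (AE \<omega> in M. I\<^sub>2 (T h h) \<omega> = (W h \<omega>)\<^sup>2 - 1))"

definition tagged_partition :: "real \<Rightarrow> nat \<Rightarrow> (nat \<Rightarrow> real) \<Rightarrow> (nat \<Rightarrow> real) \<Rightarrow> bool" where
  "tagged_partition \<delta> n t \<xi> \<longleftrightarrow> t 0 = 0 \<and> t n = 1 \<and>
    (\<forall>k<n. t k < t (Suc k) \<and> t (Suc k) - t k < \<delta> \<and> \<xi> k \<in> {t k..t (Suc k)})"

text \<open>The two-dimensional Riemann-Stieltjes integral \<open>\<integral>\<integral> h(s,t) dR(s,t)\<close> over \<open>[0,1]\<^sup>2\<close> exists and
  equals \<open>I\<close>: limit, as the mesh tends to zero, of the sums over product partitions with product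
  tags. (With a free tag in each cell, indicators of rectangles need not be integrable unless \<open>R\<close>
  has bounded variation.)\<close>

definition has_rs_integral :: "(real \<Rightarrow> real \<Rightarrow> real) \<Rightarrow> (real \<Rightarrow> real \<Rightarrow> real) \<Rightarrow> real \<Rightarrow> bool" where
  "has_rs_integral R h I \<longleftrightarrow> (\<forall>\<epsilon>>0. \<exists>\<delta>>0. \<forall>m s \<xi> n t \<eta>.
    tagged_partition \<delta> m s \<xi> \<longrightarrow> tagged_partition \<delta> n t \<eta> \<longrightarrow>
    \<bar>(\<Sum>k<m. \<Sum>l<n. h (\<xi> k) (\<eta> l) * incr R (s k) (s (Suc k)) (t l) (t (Suc l))) - I\<bar> < \<epsilon>)"

text \<open>\<open>\<integral>\<integral>\<integral>\<integral> f(s,u) g(t,v) dR(s,t) dS(u,v)\<close> exists as an iterated integral and equals \<open>J\<close>.\<close>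

definition has_iterated_rs_integral ::
  "(real \<Rightarrow> real \<Rightarrow> real) \<Rightarrow> (real \<Rightarrow> real \<Rightarrow> real) \<Rightarrow>
    (real \<Rightarrow> real \<Rightarrow> real) \<Rightarrow> (real \<Rightarrow> real \<Rightarrow> real) \<Rightarrow> real \<Rightarrow> bool" where
  "has_iterated_rs_integral R S f g J \<longleftrightarrow>
    (\<exists>G. (\<forall>u\<in>{0..1}. \<forall>v\<in>{0..1}. has_rs_integral R (\<lambda>s t. f s u * g t v) (G u v)) \<and>
      has_rs_integral S G J)"

definition T\<^sub>1 :: "(real \<times> real) set" where
  "T\<^sub>1 = {(s, t). s \<in> {0..1} \<and> t \<in> {0..1} \<and> s < t}"

definition T\<^sub>2 :: "(real \<times> real) set" where
  "T\<^sub>2 = {(s, t). s \<in> {0..1} \<and> t \<in> {0..1} \<and> s > t}"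

definition levy_kernel :: "2 \<Rightarrow> 2 \<Rightarrow> real \<Rightarrow> real \<Rightarrow> real" where
  "levy_kernel i j s t =
    (if i = j then 0
     else if i = 1 then (1/2) * (indicator T\<^sub>1 (s, t) - indicator T\<^sub>2 (s, t))
     else (1/2) * (indicator T\<^sub>2 (s, t) - indicator T\<^sub>1 (s, t)))"

text \<open>The test functions \<open>g\<close> range over the algebraic tensor square of \<^const>\<open>steps2\<close>:
  \<open>g(x,y) = (\<Sum>k<n. \<phi> k x * \<psi> k y)\<close>.\<close>

definition represents_levy_kernel ::
  "(2 \<Rightarrow> real \<Rightarrow> real \<Rightarrow> real) \<Rightarrow> ((real \<times> 2 \<Rightarrow> real) \<Rightarrow> 'h::{real_inner, complete_space}) \<Rightarrow>
    ('h \<Rightarrow> 'h \<Rightarrow> 't::{real_inner, complete_space}) \<Rightarrow> 't \<Rightarrow> bool" where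
  "represents_levy_kernel R \<iota> T f \<longleftrightarrow> f \<in> sym_square T \<and>
    (\<forall>(n::nat) \<phi> \<psi>. (\<forall>k<n. \<phi> k \<in> steps2 \<and> \<psi> k \<in> steps2) \<longrightarrow>
      (\<exists>J. (\<forall>i j. has_iterated_rs_integral (R i) (R j) (levy_kernel i j)
              (\<lambda>t v. \<Sum>k<n. \<phi> k (t, i) * \<psi> k (v, j)) (J i j)) \<and>
           f \<bullet> (\<Sum>k<n. T (\<iota> (\<phi> k)) (\<iota> (\<psi> k))) = (\<Sum>i\<in>UNIV. \<Sum>j\<in>UNIV. J i j)))"

end

theory Submission
  imports Defs
begin

text \<open>
  Equivalence of the covariances means that \<open>H\<close> is two copies of one Hilbert space \<open>H\<^sub>1\<close>, and the
  Levy kernel is an off-diagonal matrix with entries \<open>k\<close> and \<open>-k\<close>. Such a matrix has two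
  symmetries: it is unchanged under the rotation \<open>J(g\<^sub>1,g\<^sub>2) = (-g\<^sub>2,g\<^sub>1)\<close> and changes sign under
  the reflection \<open>S(g\<^sub>1,g\<^sub>2) = (g\<^sub>1,-g\<^sub>2)\<close>. Both are isometries of \<open>H\<close>, so the operator \<open>F\<close> of
  the kernel satisfies \<open>F J = J F\<close> and \<open>F S = -S F\<close> (\<open>levy_kernel_symmetries\<close>). As \<open>J\<^sup>2 = -1\<close>,
  \<open>J\<close> turns every eigenspace into a complex vector space, whose real dimension is even
  (\<open>complex_structure_orthonormal_basis\<close>); and \<open>S\<close> maps the eigenspace of \<open>l\<close> onto that of \<open>-l\<close>.
  This is the first claim.

  For the second, \<open>F\<close> is compact and symmetric. The spectral theorem, in the form
  \<open>tensor_eq_if_eigenvectors_agree\<close>, expands the kernel as the sum of the terms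
  \<open>a (e \<otimes> e - S e \<otimes> S e)\<close>, where \<open>a\<close> runs through the positive eigenvalues and \<open>e\<close> through an
  orthonormal basis of the eigenspace of \<open>a\<close> (\<open>block_series\<close>). The double integral of such a
  term is \<open>a (W(e)\<^sup>2 - W(S e)\<^sup>2) = 2 a W(u) W(v)\<close> with
  \<open>u = (e + S e)/sqrt 2\<close> and \<open>v = (e - S e)/sqrt 2\<close>, twice \<open>a\<close> times a product of two independent
  standard normal variables. Its characteristic function is \<open>1 / sqrt (1 + 4 a\<^sup>2 t\<^sup>2)\<close>, because
  conditioning on one factor leaves the Gaussian integral of \<open>exp (- 2 a\<^sup>2 t\<^sup>2 x\<^sup>2)\<close>
  (\<open>char_square_difference\<close>). Different terms are independent, so the characteristic functions
  multiply (\<open>char_sum_square_differences\<close>), and the eigenspace of \<open>a\<close>, of dimension \<open>2 m\<close>,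
  contributes \<open>1 / (1 + 4 a\<^sup>2 t\<^sup>2) ^ m\<close>. The double integral is continuous into \<open>L\<^sup>2\<close>, which gives
  the limit of the partial products; the limit is a convergent infinite product since the
  squares of the eigenvalues, counted with multiplicity, are summable.

  Independence of the variables \<open>W(e)\<close> for orthonormal \<open>e\<close> is deduced from the joint
  characteristic function of the family (\<open>indep_vars_if_char_factorizes\<close>).
\<close>

section \<open>Maps preserving the inner product\<close>

text \<open>Additivity and homogeneity hold because the square of the norm of
  \<open>U (x + y) - U x - U y\<close> is expressed through inner products that \<open>U\<close> does not change.\<close>

lemma inner_preserving_imp_linear:
  fixes U :: "'a::real_inner \<Rightarrow> 'b::real_inner"
  assumes "\<And>x y. U x \<bullet> U y = x \<bullet> y"
  shows "linear U"
proof
  fix x y :: 'a and c :: real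
  have "(U (x + y) - U x - U y) \<bullet> (U (x + y) - U x - U y) = 0"
    by (simp add: inner_diff_left inner_diff_right inner_add_left inner_add_right assms)
  then show "U (x + y) = U x + U y"
    by (simp only: inner_eq_zero_iff) (simp add: algebra_simps)
  have "(U (c *\<^sub>R x) - c *\<^sub>R U x) \<bullet> (U (c *\<^sub>R x) - c *\<^sub>R U x) = 0"
    by (simp add: inner_diff_left inner_diff_right assms)
  then show "U (c *\<^sub>R x) = c *\<^sub>R U x"
    by simp
qed

lemma dense_range_induct2:
  fixes p q :: "'h::real_normed_vector \<Rightarrow> 'h \<Rightarrow> 'k::t2_space"
  assumes dense: "closure (\<iota> ` V) = UNIV"
    and cont: "continuous_on UNIV (\<lambda>z. p (fst z) (snd z))" "continuous_on UNIV (\<lambda>z. q (fst z) (snd z))"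
    and eq: "\<And>f g. f \<in> V \<Longrightarrow> g \<in> V \<Longrightarrow> p (\<iota> f) (\<iota> g) = q (\<iota> f) (\<iota> g)"
  shows "p x y = q x y"
proof -
  have "closed {z. p (fst z) (snd z) = q (fst z) (snd z)}"
    by (intro closed_Collect_eq cont)
  moreover have "\<iota> ` V \<times> \<iota> ` V \<subseteq> {z. p (fst z) (snd z) = q (fst z) (snd z)}"
    by (auto simp: eq)
  ultimately have "closure (\<iota> ` V \<times> \<iota> ` V) \<subseteq> {z. p (fst z) (snd z) = q (fst z) (snd z)}"
    by (rule closure_minimal[rotated])
  then show ?thesis by (simp add: closure_Times dense subset_eq)
qed

text \<open>The value at \<open>\<iota> f\<close> does not depend on the choice of \<open>f\<close>, since \<open>\<kappa>\<close> preserves distances; for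
  the same reason the map on the dense range of \<open>\<iota>\<close> is uniformly continuous and extends.\<close>

lemma inner_preserving_extension:
  fixes \<iota> :: "'p \<Rightarrow> 'h::real_inner" and \<kappa> :: "'p \<Rightarrow> 'k::{real_inner, complete_space}"
  assumes dense: "closure (\<iota> ` V) = UNIV"
    and iso: "\<And>f g. f \<in> V \<Longrightarrow> g \<in> V \<Longrightarrow> \<kappa> f \<bullet> \<kappa> g = \<iota> f \<bullet> \<iota> g"
  obtains U where "\<And>f. f \<in> V \<Longrightarrow> U (\<iota> f) = \<kappa> f" "\<And>x y. U x \<bullet> U y = x \<bullet> y"
proof -
  define u where "u x = \<kappa> (inv_into V \<iota> x)" for x
  have dist_\<kappa>: "dist (\<kappa> f) (\<kappa> g) = dist (\<iota> f) (\<iota> g)" if "f \<in> V" "g \<in> V" for f g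
    using that by (simp add: dist_norm norm_eq_sqrt_inner inner_diff_left inner_diff_right iso)
  have u_iota: "u (\<iota> f) = \<kappa> f" if "f \<in> V" for f
  proof -
    have "dist (u (\<iota> f)) (\<kappa> f) = dist (\<iota> (inv_into V \<iota> (\<iota> f))) (\<iota> f)"
      unfolding u_def using that by (intro dist_\<kappa> inv_into_into) auto
    also have "\<dots> = 0" using that by (simp add: f_inv_into_f)
    finally show ?thesis by simp
  qed
  have "uniformly_continuous_on (\<iota> ` V) u"
    unfolding uniformly_continuous_on_def using dist_\<kappa> u_iota by auto
  then obtain U where U: "uniformly_continuous_on (closure (\<iota> ` V)) U"
      "\<And>x. x \<in> \<iota> ` V \<Longrightarrow> u x = U x"
    by (rule uniformly_continuous_on_extension_on_closure) blast
  then have cont: "continuous_on UNIV U"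
    by (simp add: dense uniformly_continuous_imp_continuous)
  have U_iota: "U (\<iota> f) = \<kappa> f" if "f \<in> V" for f
    using U(2)[of "\<iota> f"] u_iota that by simp
  have "U x \<bullet> U y = x \<bullet> y" for x y
    by (rule dense_range_induct2[OF dense])
      (auto intro!: continuous_intros continuous_on_compose2[OF cont] simp: U_iota iso)
  then show thesis using that U_iota by blast
qed

section \<open>Uniqueness of Riemann-Stieltjes integrals\<close>

lemma tagged_partition_exists:
  assumes "\<delta> > 0"
  obtains n t \<xi> where "tagged_partition \<delta> n t \<xi>"
proof -
  obtain m where m: "inverse (real (Suc m)) < \<delta>"
    using reals_Archimedean[OF assms] by blast
  have "tagged_partition \<delta> (Suc m) (\<lambda>k. real k / real (Suc m)) (\<lambda>k. real k / real (Suc m))"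
    unfolding tagged_partition_def using m
    by (auto simp: field_simps)
  then show thesis by (rule that)
qed

lemma tagged_partition_in_unit:
  assumes "tagged_partition \<delta> n t \<xi>"
  shows "k \<le> n \<Longrightarrow> t k \<in> {0..1}" "k < n \<Longrightarrow> \<xi> k \<in> {0..1}"
proof -
  have mono: "t i \<le> t j" if "i \<le> j" "j \<le> n" for i j
    using that
  proof (induction j rule: dec_induct)
    case (step j)
    then have "t i \<le> t j" "t j < t (Suc j)" using assms by (auto simp: tagged_partition_def)
    then show ?case by simp
  qed simp
  show *: "t k \<in> {0..1}" if "k \<le> n" for k
    using mono[of 0 k] mono[of k n] that assms by (auto simp: tagged_partition_def)
  show "\<xi> k \<in> {0..1}" if "k < n"
    using *[of k] *[of "Suc k"] that assms by (fastforce simp: tagged_partition_def)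
qed

text \<open>Riemann-Stieltjes sums over \<open>[0,1]\<^sup>2\<close> see a covariance only through its increments over
  nondegenerate rectangles, and the completion of the step functions determines exactly these.\<close>

definition same_incr :: "(real \<Rightarrow> real \<Rightarrow> real) \<Rightarrow> (real \<Rightarrow> real \<Rightarrow> real) \<Rightarrow> bool" where
  "same_incr R S \<longleftrightarrow> (\<forall>a\<in>{0..1}. \<forall>b\<in>{0..1}. \<forall>c\<in>{0..1}. \<forall>d\<in>{0..1}.
     a < b \<longrightarrow> c < d \<longrightarrow> incr R a b c d = incr S a b c d)"

lemma has_rs_integral_scale:
  assumes "has_rs_integral R h I" "same_incr R S"
    and "\<And>s t. s \<in> {0..1} \<Longrightarrow> t \<in> {0..1} \<Longrightarrow> h' s t = c * h s t"
  shows "has_rs_integral S h' (c * I)"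
  unfolding has_rs_integral_def
proof (intro allI impI)
  fix \<epsilon> :: real assume "\<epsilon> > 0"
  define \<epsilon>' where "\<epsilon>' = \<epsilon> / (1 + \<bar>c\<bar>)"
  have "\<epsilon>' > 0" using \<open>\<epsilon> > 0\<close> by (simp add: \<epsilon>'_def add_pos_nonneg)
  then obtain \<delta> where \<delta>: "\<delta> > 0" "\<And>m s \<xi> n t \<eta>.
    tagged_partition \<delta> m s \<xi> \<Longrightarrow> tagged_partition \<delta> n t \<eta> \<Longrightarrow>
    \<bar>(\<Sum>k<m. \<Sum>l<n. h (\<xi> k) (\<eta> l) * incr R (s k) (s (Suc k)) (t l) (t (Suc l))) - I\<bar> < \<epsilon>'"
    using assms(1) unfolding has_rs_integral_def by blast
  have "\<bar>(\<Sum>k<m. \<Sum>l<n. h' (\<xi> k) (\<eta> l) * incr S (s k) (s (Suc k)) (t l) (t (Suc l))) - c * I\<bar> < \<epsilon>"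
    if s: "tagged_partition \<delta> m s \<xi>" and t: "tagged_partition \<delta> n t \<eta>" for m s \<xi> n t \<eta>
  proof -
    let ?S = "\<Sum>k<m. \<Sum>l<n. h (\<xi> k) (\<eta> l) * incr R (s k) (s (Suc k)) (t l) (t (Suc l))"
    have "h' (\<xi> k) (\<eta> l) * incr S (s k) (s (Suc k)) (t l) (t (Suc l)) =
        c * (h (\<xi> k) (\<eta> l) * incr R (s k) (s (Suc k)) (t l) (t (Suc l)))" if "k < m" "l < n" for k l
    proof -
      have "incr R (s k) (s (Suc k)) (t l) (t (Suc l)) = incr S (s k) (s (Suc k)) (t l) (t (Suc l))"
        using assms(2) that s t unfolding same_incr_def tagged_partition_def
        by (simp add: tagged_partition_in_unit[OF s] tagged_partition_in_unit[OF t] del: atLeastAtMost_iff)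
      then show ?thesis
        using that by (simp add: assms(3) tagged_partition_in_unit[OF s] tagged_partition_in_unit[OF t]
          del: atLeastAtMost_iff)
    qed
    then have "(\<Sum>k<m. \<Sum>l<n. h' (\<xi> k) (\<eta> l) * incr S (s k) (s (Suc k)) (t l) (t (Suc l))) = c * ?S"
      by (simp add: sum_distrib_left)
    then have "\<bar>(\<Sum>k<m. \<Sum>l<n. h' (\<xi> k) (\<eta> l) * incr S (s k) (s (Suc k)) (t l) (t (Suc l))) - c * I\<bar>
        = \<bar>c\<bar> * \<bar>?S - I\<bar>"
      by (simp add: abs_mult[symmetric] algebra_simps)
    also have "\<dots> \<le> \<bar>c\<bar> * \<epsilon>'"
      using \<delta>(2)[OF s t] by (intro mult_left_mono) auto
    also have "\<dots> < \<epsilon>"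
      using \<open>\<epsilon> > 0\<close> by (simp add: \<epsilon>'_def field_simps add_pos_nonneg)
    finally show ?thesis .
  qed
  then show "\<exists>\<delta>>0. \<forall>m s \<xi> n t \<eta>. tagged_partition \<delta> m s \<xi> \<longrightarrow> tagged_partition \<delta> n t \<eta> \<longrightarrow>
    \<bar>(\<Sum>k<m. \<Sum>l<n. h' (\<xi> k) (\<eta> l) * incr S (s k) (s (Suc k)) (t l) (t (Suc l))) - c * I\<bar> < \<epsilon>"
    using \<delta>(1) by blast
qed

lemma tagged_partition_mono:
  "tagged_partition \<delta> n t \<xi> \<Longrightarrow> \<delta> \<le> \<delta>' \<Longrightarrow> tagged_partition \<delta>' n t \<xi>"
  unfolding tagged_partition_def by force

lemma has_rs_integral_unique:
  assumes "has_rs_integral R h I" "has_rs_integral R h I'"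
  shows "I = I'"
proof (rule ccontr)
  assume "I \<noteq> I'"
  then have pos: "\<bar>I - I'\<bar> / 2 > 0" by simp
  let ?S = "\<lambda>m s \<xi> n t \<eta>. \<Sum>k<m. \<Sum>l<n. h (\<xi> k) (\<eta> l) * incr R (s k) (s (Suc k)) (t l) (t (Suc l))"
  obtain \<delta> where \<delta>: "\<delta> > 0" "\<And>m s \<xi> n t \<eta>. tagged_partition \<delta> m s \<xi> \<Longrightarrow>
      tagged_partition \<delta> n t \<eta> \<Longrightarrow> \<bar>?S m s \<xi> n t \<eta> - I\<bar> < \<bar>I - I'\<bar> / 2"
    using assms(1)[unfolded has_rs_integral_def, rule_format, OF pos] by blast
  obtain \<delta>' where \<delta>': "\<delta>' > 0" "\<And>m s \<xi> n t \<eta>. tagged_partition \<delta>' m s \<xi> \<Longrightarrow>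
      tagged_partition \<delta>' n t \<eta> \<Longrightarrow> \<bar>?S m s \<xi> n t \<eta> - I'\<bar> < \<bar>I - I'\<bar> / 2"
    using assms(2)[unfolded has_rs_integral_def, rule_format, OF pos] by blast
  obtain n t \<xi> where "tagged_partition (min \<delta> \<delta>') n t \<xi>"
    using tagged_partition_exists[of "min \<delta> \<delta>'"] \<delta>(1) \<delta>'(1) by auto
  then have "tagged_partition \<delta> n t \<xi>" "tagged_partition \<delta>' n t \<xi>"
    by (auto elim: tagged_partition_mono)
  then obtain S where "\<bar>S - I\<bar> < \<bar>I - I'\<bar> / 2" "\<bar>S - I'\<bar> < \<bar>I - I'\<bar> / 2"
    using \<delta>(2) \<delta>'(2) by blast
  moreover have "\<bar>I - I'\<bar> \<le> \<bar>S - I\<bar> + \<bar>S - I'\<bar>" by linarith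
  ultimately show False by simp
qed

text \<open>All coincidences between entries of the kernel matrix reduce to this: proportional integrands
  have proportional integrals, also when the two covariances are exchanged. The factors \<open>c = 1\<close>,
  \<open>c = -1\<close> and \<open>c = 0\<close> occur below.\<close>

lemma has_iterated_rs_integral_scale_unique:
  assumes "has_iterated_rs_integral R S f g J" "has_iterated_rs_integral R' S' f' g' J'"
    and R: "same_incr R R'" and S: "same_incr S S'"
    and fg: "\<And>s t u v. f' s u * g' t v = c * (f s u * g t v)"
  shows "J' = c * J"
proof -
  obtain G where G: "\<forall>u\<in>{0..1}. \<forall>v\<in>{0..1}. has_rs_integral R (\<lambda>s t. f s u * g t v) (G u v)"
      "has_rs_integral S G J"
    using assms(1) unfolding has_iterated_rs_integral_def by blast
  obtain G' where G': "\<forall>u\<in>{0..1}. \<forall>v\<in>{0..1}. has_rs_integral R' (\<lambda>s t. f' s u * g' t v) (G' u v)"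
      "has_rs_integral S' G' J'"
    using assms(2) unfolding has_iterated_rs_integral_def by blast
  have "G' u v = c * G u v" if "u \<in> {0..1}" "v \<in> {0..1}" for u v
    using G'(1) has_rs_integral_scale[OF G(1)[rule_format, OF that] R fg] that
    by (blast intro: has_rs_integral_unique)
  from has_rs_integral_scale[OF G(2) S this] G'(2) show ?thesis
    using has_rs_integral_unique by blast
qed

section \<open>The rotation and the reflection of the Levy kernel\<close>

lemma steps_minus: "\<phi> \<in> steps \<Longrightarrow> (\<lambda>s. - \<phi> s) \<in> steps"
proof -
  assume "\<phi> \<in> steps"
  then obtain n a t where "grid n t" "\<phi> = step_fun n a t" by (auto simp: steps_def)
  then have "(\<lambda>s. - \<phi> s) = step_fun n (\<lambda>k. - a k) t"
    by (simp add: step_fun_def sum_negf)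
  then show ?thesis using \<open>grid n t\<close> unfolding steps_def by blast
qed

lemma step_form_minus_minus:
  assumes "\<phi> \<in> steps" "\<psi> \<in> steps"
  shows "step_form R (\<lambda>s. - \<phi> s) (\<lambda>s. - \<psi> s) = step_form R \<phi> \<psi>"
proof -
  obtain n a t where 1: "grid n t" "\<phi> = step_fun n a t" using assms(1) by (auto simp: steps_def)
  obtain m b u where 2: "grid m u" "\<psi> = step_fun m b u" using assms(2) by (auto simp: steps_def)
  have "(\<lambda>s. - \<phi> s) = step_fun n (\<lambda>k. - a k) t" "(\<lambda>s. - \<psi> s) = step_fun m (\<lambda>k. - b k) u"
    by (simp_all add: 1 2 step_fun_def sum_negf)
  then show ?thesis by (simp add: 1 2 step_form_step_fun)
qed

lemma same_completion_imp_step_form_eq: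
  assumes "is_completion steps (step_form R) \<iota>\<^sub>1" "is_completion steps (step_form S) \<iota>\<^sub>2"
    and "same_completion \<iota>\<^sub>1 \<iota>\<^sub>2" and "\<phi> \<in> steps" "\<psi> \<in> steps"
  shows "step_form R \<phi> \<psi> = step_form S \<phi> \<psi>"
proof -
  obtain U where U: "\<And>x y. U x \<bullet> U y = x \<bullet> y" "\<And>\<phi>. \<phi> \<in> steps \<Longrightarrow> U (\<iota>\<^sub>1 \<phi>) = \<iota>\<^sub>2 \<phi>"
    using assms(3) unfolding same_completion_def by blast
  have "step_form R \<phi> \<psi> = U (\<iota>\<^sub>1 \<phi>) \<bullet> U (\<iota>\<^sub>1 \<psi>)"
    using assms by (simp add: is_completion_def U(1))
  also have "\<dots> = step_form S \<phi> \<psi>"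
    using assms by (simp add: is_completion_def U(2))
  finally show ?thesis .
qed

text \<open>The increment over a rectangle is the form evaluated at the indicators of its two sides.\<close>

lemma step_form_eq_imp_same_incr:
  assumes "\<And>\<phi> \<psi>. \<phi> \<in> steps \<Longrightarrow> \<psi> \<in> steps \<Longrightarrow> step_form R \<phi> \<psi> = step_form S \<phi> \<psi>"
  shows "same_incr R S"
  unfolding same_incr_def
proof (intro ballI impI)
  fix a b c d :: real
  assume *: "a \<in> {0..1}" "b \<in> {0..1}" "c \<in> {0..1}" "d \<in> {0..1}" "a < b" "c < d"
  define t u where "t = (\<lambda>k::nat. if k = 0 then a else b)" and "u = (\<lambda>k::nat. if k = 0 then c else d)"
  have g: "grid 1 t" "grid 1 u" using * by (auto simp: grid_def t_def u_def)
  then have "step_form R (step_fun 1 (\<lambda>_. 1) t) (step_fun 1 (\<lambda>_. 1) u) =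
      step_form S (step_fun 1 (\<lambda>_. 1) t) (step_fun 1 (\<lambda>_. 1) u)"
    by (intro assms) (auto simp: steps_def)
  then show "incr R a b c d = incr S a b c d"
    unfolding step_form_step_fun[OF g] by (simp add: t_def u_def)
qed

lemma same_incr_sym: "same_incr R S \<Longrightarrow> same_incr S R"
  and same_incr_refl: "same_incr R R"
  unfolding same_incr_def by auto

text \<open>The isometries \<open>(g\<^sub>1,g\<^sub>2) \<mapsto> (-g\<^sub>2,g\<^sub>1)\<close> and \<open>(g\<^sub>1,g\<^sub>2) \<mapsto> (g\<^sub>1,-g\<^sub>2)\<close> of the direct sum of two
  copies of \<open>H\<^sub>1\<close>, written for step functions on \<open>[0,1] \<times> {1,2}\<close>.\<close>

definition rotation :: "(real \<times> 2 \<Rightarrow> real) \<Rightarrow> real \<times> 2 \<Rightarrow> real" where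
  "rotation \<phi> = (\<lambda>p. if snd p = 1 then - \<phi> (fst p, 2) else \<phi> (fst p, 1))"

definition reflection :: "(real \<times> 2 \<Rightarrow> real) \<Rightarrow> real \<times> 2 \<Rightarrow> real" where
  "reflection \<phi> = (\<lambda>p. if snd p = 1 then \<phi> (fst p, 1) else - \<phi> (fst p, 2))"

lemma signed_swap_simps [simp]:
  "rotation \<phi> (s, 1) = - \<phi> (s, 2)" "rotation \<phi> (s, 2) = \<phi> (s, 1)"
  "reflection \<phi> (s, 1) = \<phi> (s, 1)" "reflection \<phi> (s, 2) = - \<phi> (s, 2)"
  by (auto simp: rotation_def reflection_def)

lemma mem_steps2_iff:
  "\<phi> \<in> steps2 \<longleftrightarrow> (\<lambda>s. \<phi> (s, 1)) \<in> steps \<and> (\<lambda>s. \<phi> (s, 2)) \<in> steps"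
  by (simp add: steps2_def forall_2)

lemma signed_swap_steps2:
  assumes "\<phi> \<in> steps2"
  shows "rotation \<phi> \<in> steps2" "reflection \<phi> \<in> steps2"
  using assms by (auto simp: mem_steps2_iff intro: steps_minus)

lemma signed_swap_twice:
  "rotation (rotation \<phi>) = (\<lambda>p. - \<phi> p)" "reflection (reflection \<phi>) = \<phi>"
proof -
  have "rotation (rotation \<phi>) (s, i) = - \<phi> (s, i)" "reflection (reflection \<phi>) (s, i) = \<phi> (s, i)" for s i
    using exhaust_2[of i] by auto
  then show "rotation (rotation \<phi>) = (\<lambda>p. - \<phi> p)" "reflection (reflection \<phi>) = \<phi>" by auto
qed

lemma step_form2_signed_swap:
  assumes "\<phi> \<in> steps2" "\<psi> \<in> steps2"
    and eq: "\<And>\<phi> \<psi>. \<phi> \<in> steps \<Longrightarrow> \<psi> \<in> steps \<Longrightarrow> step_form (R 1) \<phi> \<psi> = step_form (R 2) \<phi> \<psi>"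
  shows "step_form2 R (rotation \<phi>) (rotation \<psi>) = step_form2 R \<phi> \<psi>"
    and "step_form2 R (reflection \<phi>) (reflection \<psi>) = step_form2 R \<phi> \<psi>"
  using assms(1,2) by (simp_all add: step_form2_def sum_2 step_form_minus_minus eq mem_steps2_iff)

text \<open>The rotation exchanges the two off-diagonal integrals: for the test function
  \<open>rotation \<phi> \<otimes> rotation \<psi>\<close>, position \<open>(1,2)\<close> carries the kernel \<open>k\<close> against
  \<open>- \<phi>(\<cdot>,2) \<psi>(\<cdot>,1)\<close>, which is the integrand of \<open>\<phi> \<otimes> \<psi>\<close> at position \<open>(2,1)\<close>. The reflection
  changes the sign of both. The diagonal integrals vanish with the kernel.\<close>

lemma levy_kernel_pairing:
  assumes fL: "represents_levy_kernel R \<iota> T fL"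
    and incr: "same_incr (R 1) (R 2)"
    and \<phi>: "\<phi> \<in> steps2" and \<psi>: "\<psi> \<in> steps2"
  shows "fL \<bullet> T (\<iota> (rotation \<phi>)) (\<iota> (rotation \<psi>)) = fL \<bullet> T (\<iota> \<phi>) (\<iota> \<psi>)"
    and "fL \<bullet> T (\<iota> (reflection \<phi>)) (\<iota> (reflection \<psi>)) = - (fL \<bullet> T (\<iota> \<phi>) (\<iota> \<psi>))"
proof -
  have *: "\<exists>J. (\<forall>i j. has_iterated_rs_integral (R i) (R j) (levy_kernel i j)
              (\<lambda>t v. \<phi> (t, i) * \<psi> (v, j)) (J i j)) \<and>
           fL \<bullet> T (\<iota> \<phi>) (\<iota> \<psi>) = J 1 1 + J 1 2 + J 2 1 + J 2 2"
    if "\<phi> \<in> steps2" "\<psi> \<in> steps2" for \<phi> \<psi>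
    using fL[unfolded represents_levy_kernel_def, THEN conjunct2, rule_format, of 1 "\<lambda>_. \<phi>" "\<lambda>_. \<psi>"] that
    by (simp add: sum_2 add.assoc)
  have same: "same_incr (R i) (R j)" for i j
    using incr exhaust_2[of i] exhaust_2[of j] same_incr_sym same_incr_refl by metis
  note unique = has_iterated_rs_integral_scale_unique[OF _ _ same same]
  \<comment> \<open>the zero integrand is 0 times itself, so its integral is 0 times itself\<close>
  have diag: "J i i = 0" if "has_iterated_rs_integral (R i) (R i) (levy_kernel i i) g (J i i)"
    for J :: "2 \<Rightarrow> 2 \<Rightarrow> real" and i g
    using unique[OF that that, of 0] by (simp add: levy_kernel_def)
  have kernel: "levy_kernel 2 1 s u = - levy_kernel 1 2 s u" for s u
    by (simp add: levy_kernel_def algebra_simps)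
  obtain J where J: "\<And>i j. has_iterated_rs_integral (R i) (R j) (levy_kernel i j)
        (\<lambda>t v. \<phi> (t, i) * \<psi> (v, j)) (J i j)"
      "fL \<bullet> T (\<iota> \<phi>) (\<iota> \<psi>) = J 1 1 + J 1 2 + J 2 1 + J 2 2"
    using *[OF \<phi> \<psi>] by blast
  obtain J' where J': "\<And>i j. has_iterated_rs_integral (R i) (R j) (levy_kernel i j)
        (\<lambda>t v. rotation \<phi> (t, i) * rotation \<psi> (v, j)) (J' i j)"
      "fL \<bullet> T (\<iota> (rotation \<phi>)) (\<iota> (rotation \<psi>)) = J' 1 1 + J' 1 2 + J' 2 1 + J' 2 2"
    using *[OF signed_swap_steps2(1)[OF \<phi>] signed_swap_steps2(1)[OF \<psi>]] by blast
  have "J' 1 2 = 1 * J 2 1"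
    using J(1)[of 2 1] J'(1)[of 1 2] by (rule unique) (simp add: kernel)
  moreover have "J' 2 1 = 1 * J 1 2"
    using J(1)[of 1 2] J'(1)[of 2 1] by (rule unique) (simp add: kernel)
  ultimately show "fL \<bullet> T (\<iota> (rotation \<phi>)) (\<iota> (rotation \<psi>)) = fL \<bullet> T (\<iota> \<phi>) (\<iota> \<psi>)"
    using diag[where J=J, OF J(1)] diag[where J=J', OF J'(1)] by (simp add: J(2) J'(2))
  obtain J'' where J'': "\<And>i j. has_iterated_rs_integral (R i) (R j) (levy_kernel i j)
        (\<lambda>t v. reflection \<phi> (t, i) * reflection \<psi> (v, j)) (J'' i j)"
      "fL \<bullet> T (\<iota> (reflection \<phi>)) (\<iota> (reflection \<psi>)) = J'' 1 1 + J'' 1 2 + J'' 2 1 + J'' 2 2"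
    using *[OF signed_swap_steps2(2)[OF \<phi>] signed_swap_steps2(2)[OF \<psi>]] by blast
  have "J'' 1 2 = -1 * J 1 2"
    using J(1)[of 1 2] J''(1)[of 1 2] by (rule unique) simp
  moreover have "J'' 2 1 = -1 * J 2 1"
    using J(1)[of 2 1] J''(1)[of 2 1] by (rule unique) simp
  ultimately show "fL \<bullet> T (\<iota> (reflection \<phi>)) (\<iota> (reflection \<psi>)) = - (fL \<bullet> T (\<iota> \<phi>) (\<iota> \<psi>))"
    using diag[where J=J, OF J(1)] diag[where J=J'', OF J''(1)] by (simp add: J(2) J''(2))
qed

lemma inner_preserving_continuous:
  fixes U :: "'a::real_inner \<Rightarrow> 'b::real_inner"
  assumes "\<And>x y. U x \<bullet> U y = x \<bullet> y"
  shows "continuous_on A U"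
proof -
  have "dist (U x) (U y) = dist x y" for x y
    by (simp add: dist_norm norm_eq_sqrt_inner inner_diff_left inner_diff_right assms)
  then show ?thesis unfolding continuous_on_iff by auto
qed

text \<open>The step-function identities extend to \<open>H\<close> by density. \<open>J\<close> is a complex structure on \<open>H\<close>, and
  \<open>S\<close> an orthogonal involution.\<close>

lemma levy_kernel_symmetries:
  fixes \<iota> :: "(real \<times> 2 \<Rightarrow> real) \<Rightarrow> 'h::{real_inner, complete_space}"
    and T :: "'h \<Rightarrow> 'h \<Rightarrow> 't::{real_inner, complete_space}"
  assumes compl: "is_completion steps2 (step_form2 R) \<iota>"
    and eq: "\<And>\<phi> \<psi>. \<phi> \<in> steps \<Longrightarrow> \<psi> \<in> steps \<Longrightarrow> step_form (R 1) \<phi> \<psi> = step_form (R 2) \<phi> \<psi>"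
    and fL: "represents_levy_kernel R \<iota> T fL" and T: "bounded_bilinear T"
  obtains J S :: "'h \<Rightarrow> 'h"
  where "\<And>x y. J x \<bullet> J y = x \<bullet> y" "\<And>x. J (J x) = - x" "\<And>x y. fL \<bullet> T (J x) (J y) = fL \<bullet> T x y"
    and "\<And>x y. S x \<bullet> S y = x \<bullet> y" "\<And>x. S (S x) = x" "\<And>x y. fL \<bullet> T (S x) (S y) = - (fL \<bullet> T x y)"
proof -
  have dense: "closure (\<iota> ` steps2) = UNIV"
    and form: "\<And>f g. f \<in> steps2 \<Longrightarrow> g \<in> steps2 \<Longrightarrow> \<iota> f \<bullet> \<iota> g = step_form2 R f g"
    and lin: "\<And>f g a b. f \<in> steps2 \<Longrightarrow> g \<in> steps2 \<Longrightarrow> \<iota> (\<lambda>p. a * f p + b * g p) = a *\<^sub>R \<iota> f + b *\<^sub>R \<iota> g"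
    using compl unfolding is_completion_def by blast+
  have neg: "\<iota> (\<lambda>p. - f p) = - \<iota> f" if "f \<in> steps2" for f
    using lin[OF that that, of "-1" 0] by simp
  obtain J where J: "\<And>f. f \<in> steps2 \<Longrightarrow> J (\<iota> f) = \<iota> (rotation f)" "\<And>x y. J x \<bullet> J y = x \<bullet> y"
    using inner_preserving_extension[OF dense, where \<kappa> = "\<lambda>f. \<iota> (rotation f)"]
    by (metis form signed_swap_steps2(1) step_form2_signed_swap(1) eq)
  obtain S where S: "\<And>f. f \<in> steps2 \<Longrightarrow> S (\<iota> f) = \<iota> (reflection f)" "\<And>x y. S x \<bullet> S y = x \<bullet> y"
    using inner_preserving_extension[OF dense, where \<kappa> = "\<lambda>f. \<iota> (reflection f)"]
    by (metis form signed_swap_steps2(2) step_form2_signed_swap(2) eq)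
  note cont = continuous_on_compose2[OF inner_preserving_continuous[of J UNIV, OF J(2)]]
    continuous_on_compose2[OF inner_preserving_continuous[of S UNIV, OF S(2)]]
    bounded_bilinear.continuous_on[OF T]
  note incr = step_form_eq_imp_same_incr[OF eq]
  show thesis
  proof (rule that[of J S])
    show "J (J x) = - x" for x
      by (rule dense_range_induct2[OF dense, where p = "\<lambda>x y. J (J x)" and q = "\<lambda>x y. - x"])
        (auto intro!: cont continuous_intros simp: J(1) signed_swap_steps2 signed_swap_twice neg)
    show "S (S x) = x" for x
      by (rule dense_range_induct2[OF dense, where p = "\<lambda>x y. S (S x)" and q = "\<lambda>x y. x"])
        (auto intro!: cont continuous_intros simp: S(1) signed_swap_steps2 signed_swap_twice)
    show "fL \<bullet> T (J x) (J y) = fL \<bullet> T x y" for x y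
      by (rule dense_range_induct2[OF dense])
        (auto intro!: cont continuous_intros simp: J(1) levy_kernel_pairing(1)[OF fL incr])
    show "fL \<bullet> T (S x) (S y) = - (fL \<bullet> T x y)" for x y
      by (rule dense_range_induct2[OF dense])
        (auto intro!: cont continuous_intros simp: S(1) levy_kernel_pairing(2)[OF fL incr])
  qed (rule J(2) S(2))+
qed

section \<open>Orthonormal sets and orthogonal series\<close>

lemma inner_eqI:
  fixes x y :: "'a::real_inner"
  assumes "\<And>z. x \<bullet> z = y \<bullet> z"
  shows "x = y"
  by (rule iffD1[OF vector_eq_rdot]) (simp add: assms)

definition orthonormal :: "'a::real_inner set \<Rightarrow> bool" where
  "orthonormal B \<longleftrightarrow> (\<forall>x\<in>B. \<forall>y\<in>B. x \<bullet> y = of_bool (x = y))"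

lemma orthonormalD:
  assumes "orthonormal B" "x \<in> B"
  shows "x \<bullet> x = 1" "y \<in> B \<Longrightarrow> x \<noteq> y \<Longrightarrow> x \<bullet> y = 0"
  using assms by (auto simp: orthonormal_def)

lemma orthonormal_insert:
  assumes "orthonormal B" "x \<bullet> x = 1" "\<And>b. b \<in> B \<Longrightarrow> b \<bullet> x = 0"
  shows "orthonormal (insert x B)"
proof -
  have "x \<notin> B" using assms(2,3) by force
  moreover have "x \<bullet> b = 0" if "b \<in> B" for b
    using assms(3)[OF that] by (simp add: inner_commute)
  ultimately show ?thesis
    using assms by (auto simp: orthonormal_def)
qed

lemma orthonormal_independent:
  assumes "orthonormal B" shows "independent B"
proof (rule pairwise_orthogonal_independent)
  show "pairwise orthogonal B" "0 \<notin> B"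
    using assms by (auto simp: orthonormal_def pairwise_def orthogonal_def dest!: bspec[of B _ 0])
qed

lemma orthonormal_inner_sum:
  assumes "orthonormal B" "finite B" "e \<in> B"
  shows "e \<bullet> (\<Sum>b\<in>B. c b *\<^sub>R b) = c e"
proof -
  have "e \<bullet> (\<Sum>b\<in>B. c b *\<^sub>R b) = (\<Sum>b\<in>B. if b = e then c b else 0)"
    unfolding inner_sum_right using assms by (intro sum.cong) (auto simp: orthonormal_def)
  then show ?thesis using assms by simp
qed

lemma orthonormal_expansion:
  assumes "orthonormal B" "finite B" "x \<in> span B"
  shows "x = (\<Sum>b\<in>B. (b \<bullet> x) *\<^sub>R b)"
proof -
  obtain c where "x = (\<Sum>b\<in>B. c b *\<^sub>R b)"
    using assms(2,3) by (auto simp: span_finite)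
  then show ?thesis
    by (simp add: orthonormal_inner_sum[OF assms(1,2)] cong: sum.cong)
qed

lemma sum_inner_square:
  fixes u :: "'i \<Rightarrow> 'a::real_inner"
  assumes "finite A" "\<And>i j. i \<in> A \<Longrightarrow> j \<in> A \<Longrightarrow> i \<noteq> j \<Longrightarrow> u i \<bullet> u j = 0"
  shows "(\<Sum>i\<in>A. u i) \<bullet> (\<Sum>i\<in>A. u i) = (\<Sum>i\<in>A. u i \<bullet> u i)"
proof -
  have "(\<Sum>j\<in>A. u i \<bullet> u j) = u i \<bullet> u i" if "i \<in> A" for i
  proof -
    have "(\<Sum>j\<in>A. u i \<bullet> u j) = (\<Sum>j\<in>A. if j = i then u i \<bullet> u i else 0)"
      using assms(2) that by (intro sum.cong) auto
    then show ?thesis using that assms(1) by simp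
  qed
  then have "(\<Sum>i\<in>A. \<Sum>j\<in>A. u i \<bullet> u j) = (\<Sum>i\<in>A. u i \<bullet> u i)" by simp
  then show ?thesis by (simp only: inner_sum_left inner_sum_right) (subst sum.swap, simp)
qed

text \<open>The hypothesis \<open>f \<bullet> u i = u i \<bullet> u i\<close> says that \<open>u i\<close> is the orthogonal projection of \<open>f\<close> to
  the line of \<open>u i\<close>, so this is Bessel's inequality for vectors that are not normalised.\<close>

lemma bessel_orthogonal:
  fixes u :: "'i \<Rightarrow> 'a::real_inner"
  assumes "finite A" "\<And>i j. i \<in> A \<Longrightarrow> j \<in> A \<Longrightarrow> i \<noteq> j \<Longrightarrow> u i \<bullet> u j = 0"
    and "\<And>i. i \<in> A \<Longrightarrow> f \<bullet> u i = u i \<bullet> u i"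
  shows "(\<Sum>i\<in>A. u i \<bullet> u i) \<le> f \<bullet> f"
proof -
  let ?s = "\<Sum>i\<in>A. u i"
  have "0 \<le> (f - ?s) \<bullet> (f - ?s)" by simp
  also have "\<dots> = f \<bullet> f - 2 * (f \<bullet> ?s) + ?s \<bullet> ?s"
    by (simp add: inner_diff_left inner_diff_right inner_commute)
  also have "f \<bullet> ?s = (\<Sum>i\<in>A. u i \<bullet> u i)"
    using assms(3) by (simp add: inner_sum_right)
  also have "?s \<bullet> ?s = (\<Sum>i\<in>A. u i \<bullet> u i)"
    using assms(1,2) by (rule sum_inner_square)
  finally show ?thesis by simp
qed

text \<open>Partial sums of the squared norms are bounded by Bessel's inequality, and by Pythagoras their
  convergence makes the partial sums of the series itself a Cauchy sequence.\<close>

lemma orthogonal_series_convergent: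
  fixes u :: "nat \<Rightarrow> 'a::{real_inner, complete_space}"
  assumes orth: "\<And>i j. i \<noteq> j \<Longrightarrow> u i \<bullet> u j = 0" and f: "\<And>i. f \<bullet> u i = u i \<bullet> u i"
  shows "summable (\<lambda>i. u i \<bullet> u i)" "convergent (\<lambda>n. \<Sum>i<n. u i)"
proof -
  show summ: "summable (\<lambda>i. u i \<bullet> u i)"
    using bessel_orthogonal[of "{..<n}" u f for n] orth f
    by (intro summableI_nonneg_bounded[where x = "f \<bullet> f"]) auto
  have "Cauchy (\<lambda>n. \<Sum>i<n. u i)"
  proof (rule CauchyI')
    fix e :: real assume "e > 0"
    then obtain N where N: "\<And>m n. m \<ge> N \<Longrightarrow> \<bar>\<Sum>i=m..<n. u i \<bullet> u i\<bar> < e\<^sup>2"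
      using summ[unfolded summable_Cauchy, rule_format, of "e\<^sup>2"] by auto
    have "norm ((\<Sum>i<m. u i) - (\<Sum>i<n. u i)) < e" if "m \<ge> N" "m < n" for m n
    proof -
      have "(\<Sum>i<m. u i) - (\<Sum>i<n. u i) = - (\<Sum>i=m..<n. u i)"
        using sum_diff_nat_ivl[of 0 m n u] that by (simp add: atLeast0LessThan algebra_simps)
      then have "(norm ((\<Sum>i<m. u i) - (\<Sum>i<n. u i)))\<^sup>2 = (\<Sum>i=m..<n. u i \<bullet> u i)"
        using sum_inner_square[of "{m..<n}" u] orth by (simp add: power2_norm_eq_inner)
      also have "\<dots> < e\<^sup>2" using N[OF that(1), of n] by simp
      finally show ?thesis
        using \<open>e > 0\<close> by (intro power_less_imp_less_base[of _ 2 e]) simp_all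
    qed
    then show "\<exists>M. \<forall>m\<ge>M. \<forall>n>m. dist (\<Sum>i<m. u i) (\<Sum>i<n. u i) < e"
      unfolding dist_norm by blast
  qed
  then show "convergent (\<lambda>n. \<Sum>i<n. u i)" by (rule Cauchy_convergent)
qed

section \<open>Eigenvectors of compact symmetric operators\<close>

text \<open>The norm attains its maximum \<open>N\<close>, the operator norm of \<open>G\<close>, on the compact closure of the image
  of the ball, say at \<open>y = lim G (X n)\<close>. Since \<open>G\<^sup>2\<close> is symmetric with norm at most \<open>N\<^sup>2\<close>, the
  maximising sequence satisfies \<open>G\<^sup>2 (X n) - N\<^sup>2 X n \<longlonglongrightarrow> 0\<close>; as \<open>G\<^sup>2 (X n)\<close> converges to \<open>G y\<close>, so
  does \<open>N\<^sup>2 X n\<close>, and the limit \<open>z\<close> of \<open>X n\<close> satisfies \<open>G\<^sup>2 z = N\<^sup>2 z\<close>. The factorisation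
  \<open>(G - N) (G + N) z = 0\<close> then yields an eigenvector for \<open>N\<close> or \<open>-N\<close>.\<close>

lemma compact_symmetric_eigenvector:
  fixes G :: "'h::{real_inner, complete_space} \<Rightarrow> 'h"
  assumes G: "bounded_linear G" and sym: "\<And>x y. G x \<bullet> y = G y \<bullet> x"
    and compact: "compact (closure (G ` cball 0 1))" and "G x0 \<noteq> 0"
  obtains \<mu> x where "\<mu> \<noteq> 0" "x \<noteq> 0" "G x = \<mu> *\<^sub>R x"
proof -
  interpret G: bounded_linear G by (rule G)
  have ne: "closure (G ` cball 0 1) \<noteq> {}" by (simp add: closure_eq_empty)
  obtain y where y: "y \<in> closure (G ` cball 0 1)" "\<And>z. z \<in> closure (G ` cball 0 1) \<Longrightarrow> norm z \<le> norm y"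
    using continuous_attains_sup[OF compact ne, of norm] continuous_on_norm_id by blast
  define N where "N = norm y"
  have bound: "norm (G x) \<le> N * norm x" for x
  proof (cases "x = 0")
    case False
    have "norm (G ((1 / norm x) *\<^sub>R x)) \<le> N"
      unfolding N_def using False by (intro y(2) closure_subset[THEN subsetD] imageI) simp
    then show ?thesis using False by (simp add: G.scaleR field_simps)
  qed simp
  have "N > 0"
    using bound[of x0] assms(4) by (metis norm_ge_zero norm_le_zero_iff linorder_not_less mult_nonpos_nonneg order_trans)
  obtain \<xi> where "\<forall>n. \<xi> n \<in> G ` cball 0 1" "\<xi> \<longlonglongrightarrow> y"
    using y(1) unfolding closure_sequential by blast
  then have "\<exists>x. norm x \<le> 1 \<and> G x = \<xi> n" for n
    by (metis imageE mem_cball_0)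
  then obtain X where X: "\<And>n. norm (X n) \<le> 1" "\<And>n. G (X n) = \<xi> n" by metis
  have X_lim: "(\<lambda>n. G (X n)) \<longlonglongrightarrow> y" using \<open>\<xi> \<longlonglongrightarrow> y\<close> by (simp add: X(2))
  have "(\<lambda>n. (norm (G (G (X n)) - N\<^sup>2 *\<^sub>R X n))\<^sup>2) \<longlonglongrightarrow> 0"
  proof (rule tendsto_sandwich[OF _ _ tendsto_const])
    have "(norm (G (G (X n)) - N\<^sup>2 *\<^sub>R X n))\<^sup>2 \<le> 2 * N^4 - 2 * N\<^sup>2 * (norm (G (X n)))\<^sup>2" for n
    proof -
      have "(norm (G (G (X n)) - N\<^sup>2 *\<^sub>R X n))\<^sup>2 =
          (norm (G (G (X n))))\<^sup>2 - 2 * N\<^sup>2 * (G (G (X n)) \<bullet> X n) + N^4 * (norm (X n))\<^sup>2"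
        by (simp add: power2_norm_eq_inner inner_diff_left inner_diff_right inner_commute)
      also have "G (G (X n)) \<bullet> X n = (norm (G (X n)))\<^sup>2"
        by (simp add: power2_norm_eq_inner sym)
      also have "(norm (G (G (X n))))\<^sup>2 \<le> (N * (N * 1))\<^sup>2"
        using bound[of "G (X n)"] bound[of "X n"] X(1)[of n] \<open>N > 0\<close>
        by (intro power_mono order.trans[OF bound] mult_left_mono) auto
      also have "N^4 * (norm (X n))\<^sup>2 \<le> N^4 * 1"
        using X(1)[of n] by (intro mult_left_mono) (auto simp: power_le_one)
      finally show ?thesis by (simp add: power4_eq_xxxx power2_eq_square)
    qed
    then show "\<forall>\<^sub>F n in sequentially. (norm (G (G (X n)) - N\<^sup>2 *\<^sub>R X n))\<^sup>2 \<le>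
        2 * N^4 - 2 * N\<^sup>2 * (norm (G (X n)))\<^sup>2" by simp
    have "(\<lambda>n. 2 * N^4 - 2 * N\<^sup>2 * (norm (G (X n)))\<^sup>2) \<longlonglongrightarrow> 2 * N^4 - 2 * N\<^sup>2 * (norm y)\<^sup>2"
      by (intro tendsto_intros X_lim)
    then show "(\<lambda>n. 2 * N^4 - 2 * N\<^sup>2 * (norm (G (X n)))\<^sup>2) \<longlonglongrightarrow> 0"
      by (simp add: N_def power4_eq_xxxx power2_eq_square)
  qed auto
  then have "(\<lambda>n. sqrt ((norm (G (G (X n)) - N\<^sup>2 *\<^sub>R X n))\<^sup>2)) \<longlonglongrightarrow> sqrt 0"
    by (intro tendsto_intros)
  then have "(\<lambda>n. G (G (X n)) - N\<^sup>2 *\<^sub>R X n) \<longlonglongrightarrow> 0"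
    by (simp add: tendsto_norm_zero_iff)
  moreover have "(\<lambda>n. G (G (X n))) \<longlonglongrightarrow> G y"
    using X_lim by (rule G.tendsto)
  ultimately have "(\<lambda>n. (1 / N\<^sup>2) *\<^sub>R (G (G (X n)) - (G (G (X n)) - N\<^sup>2 *\<^sub>R X n))) \<longlonglongrightarrow> (1 / N\<^sup>2) *\<^sub>R (G y - 0)"
    by (intro tendsto_intros)
  then have lim: "X \<longlonglongrightarrow> (1 / N\<^sup>2) *\<^sub>R G y"
    using \<open>N > 0\<close> by simp
  define z where "z = (1 / N\<^sup>2) *\<^sub>R G y"
  have "G z = y"
    using G.tendsto[OF lim] X_lim LIMSEQ_unique unfolding z_def by blast
  then have GG: "G (G z) = N\<^sup>2 *\<^sub>R z"
    using \<open>N > 0\<close> by (simp add: z_def)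
  have "z \<noteq> 0"
    using \<open>G z = y\<close> \<open>N > 0\<close> by (auto simp: N_def)
  show thesis
  proof (cases "G z + N *\<^sub>R z = 0")
    case True
    then have "G z = (- N) *\<^sub>R z" by (simp add: add_eq_0_iff2)
    then show ?thesis using that[of "- N" z] \<open>N > 0\<close> \<open>z \<noteq> 0\<close> by simp
  next
    case False
    have "G (G z + N *\<^sub>R z) = N *\<^sub>R (G z + N *\<^sub>R z)"
      by (simp add: G.add G.scaleR GG power2_eq_square algebra_simps)
    then show ?thesis using that[of N "G z + N *\<^sub>R z"] \<open>N > 0\<close> False by simp
  qed
qed

section \<open>Hilbert-Schmidt operators of elements of the tensor square\<close>

context
  fixes T :: "'h::{real_inner, complete_space} \<Rightarrow> 'h \<Rightarrow> 't::{real_inner, complete_space}"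
  assumes T: "is_hilbert_tensor T"
begin

lemma tensor_inner: "T a b \<bullet> T c d = (a \<bullet> c) * (b \<bullet> d)"
  using T unfolding is_hilbert_tensor_def by blast

lemma tensor_norm: "norm (T a b) = norm a * norm b"
  by (simp add: norm_eq_sqrt_inner tensor_inner real_sqrt_mult)

lemma tensor_bilinear: "bounded_bilinear T"
  using T unfolding is_hilbert_tensor_def by blast

lemma tensor_eqI:
  assumes "\<And>x y. r \<bullet> T x y = s \<bullet> T x y"
  shows "r = s"
proof -
  let ?S = "{z. r \<bullet> z = s \<bullet> z}"
  have "subspace ?S" by (auto simp: subspace_def inner_add_right)
  moreover have "{T a b |a b. True} \<subseteq> ?S" using assms by auto
  ultimately have "span {T a b |a b. True} \<subseteq> ?S" by (rule span_minimal[rotated])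
  moreover have "closed ?S" by (intro closed_Collect_eq continuous_intros)
  ultimately have "closure (span {T a b |a b. True}) \<subseteq> ?S" by (rule closure_minimal)
  then have "r \<bullet> z = s \<bullet> z" for z
    using T unfolding is_hilbert_tensor_def by auto
  then show ?thesis by (rule inner_eqI)
qed

lemma hs_operator_bound:
  assumes "hs_operator T f F"
  shows "norm (F x) \<le> norm f * norm x"
proof (cases "F x = 0")
  case False
  have "norm (F x) * norm (F x) = F x \<bullet> F x"
    by (simp add: power2_norm_eq_inner flip: power2_eq_square)
  also have "\<dots> = f \<bullet> T x (F x)"
    using assms by (simp add: hs_operator_def)
  also have "\<dots> \<le> norm f * norm (T x (F x))" by (rule norm_cauchy_schwarz)
  finally show ?thesis using False by (simp add: tensor_norm)
qed simp

lemma hs_operator_bounded_linear: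
  assumes "hs_operator T f F"
  shows "bounded_linear F"
proof (rule bounded_linear_intro)
  interpret T: bounded_bilinear T by (rule tensor_bilinear)
  have F: "F x \<bullet> h = f \<bullet> T x h" for x h using assms unfolding hs_operator_def by blast
  have "F (x + y) \<bullet> h = (F x + F y) \<bullet> h" "F (c *\<^sub>R x) \<bullet> h = (c *\<^sub>R F x) \<bullet> h" for x y h c
    by (simp_all add: F inner_add_left T.add_left inner_add_right T.scaleR_left)
  then show "F (x + y) = F x + F y" "F (c *\<^sub>R x) = c *\<^sub>R F x" for x y c
    by (auto intro: inner_eqI)
  show "norm (F x) \<le> norm x * norm f" for x
    using hs_operator_bound[OF assms] by (simp add: mult.commute)
qed

lemma hs_operator_add:
  "hs_operator T f F \<Longrightarrow> hs_operator T g G \<Longrightarrow> hs_operator T (f + g) (\<lambda>x. F x + G x)"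
  by (simp add: hs_operator_def inner_add_left)

lemma hs_operator_diff:
  "hs_operator T f F \<Longrightarrow> hs_operator T g G \<Longrightarrow> hs_operator T (f - g) (\<lambda>x. F x - G x)"
  by (simp add: hs_operator_def inner_diff_left)

lemma hs_operator_scaleR: "hs_operator T f F \<Longrightarrow> hs_operator T (c *\<^sub>R f) (\<lambda>x. c *\<^sub>R F x)"
  by (simp add: hs_operator_def)

text \<open>The operator of \<open>T a b\<close> is \<open>x \<mapsto> (a \<bullet> x) b\<close>, which maps the ball into a compact segment; sums of
  such operators map it into sums of compact sets.\<close>

lemma hs_operator_of_span:
  assumes "f \<in> span {T a b |a b. True}"
  shows "\<exists>F K. hs_operator T f F \<and> compact K \<and> F ` cball 0 1 \<subseteq> K"
  using assms
proof (induction rule: span_induct_alt)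
  case base
  show ?case by (rule exI[of _ "\<lambda>_. 0"], rule exI[of _ "{0}"]) (auto simp: hs_operator_def)
next
  case (step c z g)
  then obtain a b where z: "z = T a b" by blast
  obtain G K where G: "hs_operator T g G" "compact K" "G ` cball 0 1 \<subseteq> K" using step.IH by blast
  let ?L = "(\<lambda>r. r *\<^sub>R b) ` {- norm a .. norm a}"
  have op: "hs_operator T z (\<lambda>x. (a \<bullet> x) *\<^sub>R b)"
    by (simp add: hs_operator_def z tensor_inner)
  have L: "compact ?L" "(\<lambda>x. (a \<bullet> x) *\<^sub>R b) ` cball 0 1 \<subseteq> ?L"
  proof -
    show "compact ?L" by (intro compact_continuous_image continuous_intros) auto
    have "\<bar>a \<bullet> x\<bar> \<le> norm a" if "norm x \<le> 1" for x
      using Cauchy_Schwarz_ineq2[of a x] mult_left_mono[OF that, of "norm a"] by simp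
    then show "(\<lambda>x. (a \<bullet> x) *\<^sub>R b) ` cball 0 1 \<subseteq> ?L" by (force simp: abs_le_iff)
  qed
  let ?K = "{x + y |x y. x \<in> (\<lambda>x. c *\<^sub>R x) ` ?L \<and> y \<in> K}"
  have "compact ?K" using L(1) G(2) by (intro compact_sums compact_scaling)
  moreover have "(\<lambda>x. c *\<^sub>R ((a \<bullet> x) *\<^sub>R b) + G x) ` cball 0 1 \<subseteq> ?K"
  proof (rule image_subsetI)
    fix x :: 'h assume "x \<in> cball 0 1"
    then have "(a \<bullet> x) *\<^sub>R b \<in> ?L" "G x \<in> K"
      using L(2) G(3) by blast+
    then show "c *\<^sub>R ((a \<bullet> x) *\<^sub>R b) + G x \<in> ?K" by blast
  qed
  moreover have "hs_operator T (c *\<^sub>R z + g) (\<lambda>x. c *\<^sub>R ((a \<bullet> x) *\<^sub>R b) + G x)"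
    by (intro hs_operator_add hs_operator_scaleR op G(1))
  ultimately show ?case by blast
qed

lemma hs_operator_approx:
  assumes "e > 0"
  obtains g G K where "norm (f - g) < e" "hs_operator T g G" "compact K" "G ` cball 0 1 \<subseteq> K"
proof -
  have "f \<in> closure (span {T a b |a b. True})"
    using T unfolding is_hilbert_tensor_def by simp
  then obtain g where "g \<in> span {T a b |a b. True}" "dist g f < e"
    using assms unfolding closure_approachable by blast
  then show thesis using hs_operator_of_span[of g] that by (metis dist_norm dist_commute)
qed

text \<open>The operator norm is at most the norm of the tensor, so the operators of a sequence in the
  algebraic tensor square that converges to \<open>f\<close> converge pointwise.\<close>

lemma hs_operator_exists: "\<exists>F. hs_operator T f F"
proof -
  have "\<exists>g G. norm (f - g) < inverse (real (Suc n)) \<and> hs_operator T g G" for n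
    by (rule hs_operator_approx[of "inverse (real (Suc n))" f]) auto
  then obtain g G where g: "\<And>n. norm (f - g n) < inverse (real (Suc n))"
    and G: "\<And>n. hs_operator T (g n) (G n)" by metis
  have "norm (g n - f) \<le> inverse (real (Suc n))" for n
    using g[of n] by (simp add: norm_minus_commute del: of_nat_Suc)
  then have "(\<lambda>n. g n - f) \<longlonglongrightarrow> 0"
    by (intro Lim_null_comparison[OF _ LIMSEQ_inverse_real_of_nat]) simp
  then have g_lim: "g \<longlonglongrightarrow> f" by (rule LIM_zero_cancel)
  have "convergent (\<lambda>n. G n x)" for x
  proof (rule Cauchy_convergent, rule metric_CauchyI)
    fix e :: real assume "e > 0"
    then have "e / (1 + norm x) > 0" by (simp add: add_pos_nonneg)
    from metric_CauchyD[OF LIMSEQ_imp_Cauchy[OF g_lim] this]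
    obtain M where M: "\<And>m n. m \<ge> M \<Longrightarrow> n \<ge> M \<Longrightarrow> dist (g m) (g n) < e / (1 + norm x)" by blast
    have "dist (G m x) (G n x) < e" if "m \<ge> M" "n \<ge> M" for m n
    proof -
      have "dist (G m x) (G n x) \<le> norm (g m - g n) * norm x"
        using hs_operator_bound[OF hs_operator_diff[OF G G]] by (simp add: dist_norm)
      also have "\<dots> \<le> e / (1 + norm x) * norm x"
        using M[OF that] by (intro mult_right_mono) (auto simp: dist_norm)
      also have "\<dots> < e" using \<open>e > 0\<close> by (simp add: field_simps add_pos_nonneg)
      finally show ?thesis .
    qed
    then show "\<exists>M. \<forall>m\<ge>M. \<forall>n\<ge>M. dist (G m x) (G n x) < e" by blast
  qed
  then obtain F where F: "\<And>x. (\<lambda>n. G n x) \<longlonglongrightarrow> F x"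
    unfolding convergent_def by metis
  have "F x \<bullet> h = f \<bullet> T x h" for x h
  proof (rule LIMSEQ_unique)
    show "(\<lambda>n. G n x \<bullet> h) \<longlonglongrightarrow> F x \<bullet> h" by (intro tendsto_intros F)
    show "(\<lambda>n. G n x \<bullet> h) \<longlonglongrightarrow> f \<bullet> T x h"
      using G unfolding hs_operator_def by (auto intro!: tendsto_intros g_lim)
  qed
  then show ?thesis unfolding hs_operator_def by blast
qed

text \<open>Total boundedness of the image of the ball passes from tensors near \<open>f\<close> to \<open>f\<close>, because the
  operators of near tensors are uniformly near on the ball.\<close>

lemma hs_operator_compact:
  assumes "hs_operator T f F"
  shows "compact (closure (F ` cball 0 1))"
  unfolding compact_eq_totally_bounded
proof (intro conjI allI impI)
  show "uniform_space_class.complete (closure (F ` cball 0 1))" by (simp add: complete_eq_closed)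
  fix e :: real assume "e > 0"
  then obtain g G K where g: "norm (f - g) < e / 3" "hs_operator T g G" "compact K" "G ` cball 0 1 \<subseteq> K"
    using hs_operator_approx[of "e / 3" f] by auto
  obtain k where k: "finite k" "K \<subseteq> (\<Union>x\<in>k. ball x (e / 3))"
    using g(3) \<open>e > 0\<close> unfolding compact_eq_totally_bounded by (metis divide_pos_pos zero_less_numeral)
  have "F ` cball 0 1 \<subseteq> (\<Union>x\<in>k. cball x (2 * e / 3))"
  proof (rule image_subsetI)
    fix x :: 'h assume x: "x \<in> cball 0 1"
    then obtain y where y: "y \<in> k" "dist y (G x) < e / 3" using g(4) k(2) by fastforce
    have "dist (G x) (F x) \<le> norm (f - g) * norm x"
      using hs_operator_bound[OF hs_operator_diff[OF assms g(2)]] by (simp add: dist_norm norm_minus_commute)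
    also have "\<dots> \<le> (e / 3) * 1"
      using x g(1) \<open>e > 0\<close> by (intro mult_mono) auto
    finally have "dist y (F x) \<le> 2 * e / 3"
      using y(2) dist_triangle[of y "F x" "G x"] by simp
    then show "F x \<in> (\<Union>x\<in>k. cball x (2 * e / 3))" using y(1) by auto
  qed
  then have "closure (F ` cball 0 1) \<subseteq> (\<Union>x\<in>k. cball x (2 * e / 3))"
    using k(1) by (intro closure_minimal) auto
  also have "\<dots> \<subseteq> (\<Union>x\<in>k. ball x e)" using \<open>e > 0\<close> by force
  finally show "\<exists>k. finite k \<and> closure (F ` cball 0 1) \<subseteq> (\<Union>x\<in>k. ball x e)"
    using k(1) by blast
qed

text \<open>The identity is linear and closed in \<open>f\<close>, and holds for \<open>(T a b + T b a) / 2\<close>.\<close>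

lemma sym_square_symmetric:
  assumes "f \<in> sym_square T"
  shows "f \<bullet> T x y = f \<bullet> T y x"
proof -
  let ?S = "{z. z \<bullet> T x y = z \<bullet> T y x}"
  have "subspace ?S" by (auto simp: subspace_def inner_add_left)
  moreover have "{(1/2) *\<^sub>R (T a b + T b a) |a b. True} \<subseteq> ?S"
    by (auto simp: inner_add_left tensor_inner)
  ultimately have "span {(1/2) *\<^sub>R (T a b + T b a) |a b. True} \<subseteq> ?S" by (rule span_minimal[rotated])
  moreover have "closed ?S" by (intro closed_Collect_eq continuous_intros)
  ultimately have "sym_square T \<subseteq> ?S" unfolding sym_square_def by (rule closure_minimal)
  then show ?thesis using assms by blast
qed

text \<open>Bessel's inequality in the tensor square: the vectors \<open>T e e\<close> are orthonormal and \<open>l e\<close> is the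
  coefficient of \<open>f\<close> at \<open>T e e\<close>. It bounds the multiplicities and the number of eigenvalues
  away from \<open>0\<close>.\<close>

lemma hs_eigenvalues_square_sum:
  assumes F: "hs_operator T f F" and B: "finite B" "orthonormal B"
    and eig: "\<And>e. e \<in> B \<Longrightarrow> F e = l e *\<^sub>R e"
  shows "(\<Sum>e\<in>B. (l e)\<^sup>2) \<le> (norm f)\<^sup>2"
proof -
  let ?u = "\<lambda>e. l e *\<^sub>R T e e"
  have "(\<Sum>e\<in>B. ?u e \<bullet> ?u e) \<le> f \<bullet> f"
  proof (rule bessel_orthogonal[OF B(1)])
    show "?u e \<bullet> ?u d = 0" if "e \<in> B" "d \<in> B" "e \<noteq> d" for e d
      using that orthonormalD(2)[OF B(2)] by (simp add: tensor_inner)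
    show "f \<bullet> ?u e = ?u e \<bullet> ?u e" if "e \<in> B" for e
    proof -
      have "f \<bullet> T e e = l e * (e \<bullet> e)" using F eig[OF that] by (metis hs_operator_def inner_scaleR_left)
      then show ?thesis using that orthonormalD(1)[OF B(2)] by (simp add: tensor_inner)
    qed
  qed
  moreover have "?u e \<bullet> ?u e = (l e)\<^sup>2" if "e \<in> B" for e
    using that orthonormalD(1)[OF B(2)] by (simp add: tensor_inner power2_eq_square)
  ultimately show ?thesis by (simp add: power2_norm_eq_inner)
qed

text \<open>The spectral theorem, as a uniqueness statement: a symmetric tensor \<open>g\<close> that acts like \<open>f\<close> on
  the eigenvectors of \<open>F\<close> with nonzero eigenvalue, and like \<open>0\<close> on their orthogonal complement, is
  equal to \<open>f\<close>. Otherwise the operator \<open>G\<close> of \<open>f - g\<close> has an eigenvector \<open>x\<close> with nonzero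
  eigenvalue. As \<open>G\<close> kills the eigenvectors of \<open>F\<close>, \<open>x\<close> is orthogonal to them, so \<open>F x = G x\<close>;
  thus \<open>x\<close> is itself one of these eigenvectors and orthogonal to itself.\<close>

lemma tensor_eq_if_eigenvectors_agree:
  assumes F: "hs_operator T f F"
    and sym: "\<And>x y. f \<bullet> T x y = f \<bullet> T y x" "\<And>x y. g \<bullet> T x y = g \<bullet> T y x"
    and eig: "\<And>l x y. l \<noteq> 0 \<Longrightarrow> x \<in> eigenspace F l \<Longrightarrow> g \<bullet> T x y = f \<bullet> T x y"
    and perp: "\<And>x y. (\<And>l e. l \<noteq> 0 \<Longrightarrow> e \<in> eigenspace F l \<Longrightarrow> x \<bullet> e = 0) \<Longrightarrow> g \<bullet> T x y = 0"
  shows "g = f"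
proof (rule ccontr)
  assume "g \<noteq> f"
  obtain G where G: "hs_operator T (f - g) G" using hs_operator_exists by blast
  have Gx: "G x \<bullet> y = f \<bullet> T x y - g \<bullet> T x y" for x y
    using G by (simp add: hs_operator_def inner_diff_left)
  have Fx: "F x \<bullet> y = f \<bullet> T x y" for x y
    using F by (simp add: hs_operator_def)
  obtain x0 where "G x0 \<noteq> 0"
    using tensor_eqI[of g f] \<open>g \<noteq> f\<close> Gx by (metis diff_eq_diff_eq inner_zero_left cancel_comm_monoid_add_class.diff_cancel)
  obtain \<mu> x where \<mu>: "\<mu> \<noteq> 0" "x \<noteq> 0" "G x = \<mu> *\<^sub>R x"
  proof (rule compact_symmetric_eigenvector[OF hs_operator_bounded_linear[OF G] _
        hs_operator_compact[OF G] \<open>G x0 \<noteq> 0\<close>])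
    show "G x \<bullet> y = G y \<bullet> x" for x y by (simp add: Gx sym[of x y])
  qed
  have perp_x: "x \<bullet> e = 0" if "l \<noteq> 0" "e \<in> eigenspace F l" for l e
  proof -
    have "\<mu> * (x \<bullet> e) = f \<bullet> T e x - g \<bullet> T e x"
      using Gx[of x e] by (simp add: \<mu>(3) sym[of x e])
    then show ?thesis using eig[OF that] \<mu>(1) by simp
  qed
  then have "F x \<bullet> y = (\<mu> *\<^sub>R x) \<bullet> y" for y
    using Gx[of x y] by (simp add: \<mu>(3) Fx perp)
  then have "F x = \<mu> *\<^sub>R x" by (rule inner_eqI)
  then have "x \<bullet> x = 0" using perp_x[OF \<mu>(1)] by (simp add: eigenspace_def)
  then show False using \<mu>(2) by simp
qed

end

lemma closure_of_subspace:
  fixes V :: "'a::real_normed_vector set"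
  assumes "subspace V"
  shows "subspace (closure V)"
proof (rule subspaceI)
  show "0 \<in> closure V" using subspace_0[OF assms] closure_subset by blast
  fix x y :: 'a assume "x \<in> closure V" "y \<in> closure V"
  then obtain X Y where "\<forall>n::nat. X n \<in> V" "X \<longlonglongrightarrow> x" "\<forall>n::nat. Y n \<in> V" "Y \<longlonglongrightarrow> y"
    unfolding closure_sequential by blast
  then show "x + y \<in> closure V"
    unfolding closure_sequential
    by (intro exI[of _ "\<lambda>n. X n + Y n"]) (auto intro: subspace_add[OF assms] tendsto_add)
next
  fix c :: real and x :: 'a assume "x \<in> closure V"
  then obtain X where "\<forall>n::nat. X n \<in> V" "X \<longlonglongrightarrow> x"
    unfolding closure_sequential by blast
  then show "c *\<^sub>R x \<in> closure V"
    unfolding closure_sequential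
    by (intro exI[of _ "\<lambda>n. c *\<^sub>R X n"]) (auto intro: subspace_scale[OF assms] tendsto_scaleR)
qed

lemma sym_square_subspace: "subspace (sym_square T)"
  unfolding sym_square_def by (rule closure_of_subspace) (rule subspace_span)

lemma tensor_diag_in_sym_square: "T h h \<in> sym_square T"
proof -
  have "(1/2) *\<^sub>R (T h h + T h h) \<in> sym_square T"
    unfolding sym_square_def by (intro closure_subset[THEN subsetD] span_base) blast
  then show ?thesis by (simp flip: scaleR_2)
qed

section \<open>Eigenspaces under a complex structure and an anticommuting reflection\<close>

text \<open>Take a set \<open>B\<close> of maximal cardinality such that \<open>B\<close> and \<open>J B\<close> are disjoint and together
  orthonormal. If their union \<open>C\<close> does not span \<open>E\<close>, then subtracting from a vector its projection
  to \<open>C\<close> and normalising gives a unit vector \<open>z\<close> orthogonal to \<open>C\<close>. As \<open>J\<close> is skew and maps \<open>C\<close>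
  to \<open>C\<close> up to sign, \<open>J z\<close> is orthogonal to \<open>C\<close> and to \<open>z\<close>, and \<open>B\<close> could be enlarged by \<open>z\<close>.
  The assumption \<open>bound\<close> expresses that \<open>E\<close> has finite dimension.\<close>

lemma complex_structure_orthonormal_basis:
  fixes J :: "'h::real_inner \<Rightarrow> 'h"
  assumes J: "\<And>x y. J x \<bullet> J y = x \<bullet> y" "\<And>x. J (J x) = - x"
    and E: "subspace E" "\<And>x. x \<in> E \<Longrightarrow> J x \<in> E"
    and bound: "\<And>B. finite B \<Longrightarrow> orthonormal B \<Longrightarrow> B \<subseteq> E \<Longrightarrow> card B \<le> N"
  obtains C where "finite C" "orthonormal C" "span C = E" "even (card C)"
proof -
  have skew: "J x \<bullet> y = - (x \<bullet> J y)" for x y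
    using J(1)[of x "J y"] by (simp add: J(2))
  have perp: "J x \<bullet> x = 0" for x
    using skew[of x x] by (simp add: inner_commute)
  have "inj J" by (rule injI) (metis J(2) minus_equation_iff)
  define Q where "Q B \<longleftrightarrow> finite B \<and> B \<subseteq> E \<and> orthonormal (B \<union> J ` B) \<and> B \<inter> J ` B = {}" for B
  have "Q {}" by (simp add: Q_def orthonormal_def)
  moreover have "card B \<le> N" if "Q B" for B
    using that bound[of B] by (auto simp: Q_def orthonormal_def)
  ultimately obtain B where B: "Q B" "\<And>B'. Q B' \<Longrightarrow> card B' \<le> card B"
    using ex_has_greatest_nat[of Q "{}" card "Suc N"] by (metis less_Suc_eq_le)
  define C where "C = B \<union> J ` B"
  have C: "finite C" "orthonormal C" "C \<subseteq> E" and B': "finite B" "B \<inter> J ` B = {}" "B \<subseteq> E"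
    using B(1) E(2) by (auto simp: Q_def C_def)
  have J_C: "J c \<in> C \<or> - J c \<in> C" if "c \<in> C" for c
    using that by (auto simp: C_def J(2))
  have "x \<in> span C" if "x \<in> E" for x
  proof (rule ccontr)
    assume "x \<notin> span C"
    define y where "y = x - (\<Sum>c\<in>C. (c \<bullet> x) *\<^sub>R c)"
    have "y \<noteq> 0"
    proof
      assume "y = 0"
      then have "x = (\<Sum>c\<in>C. (c \<bullet> x) *\<^sub>R c)" by (simp add: y_def)
      also have "\<dots> \<in> span C" by (intro span_sum span_scale span_base)
      finally show False using \<open>x \<notin> span C\<close> by simp
    qed
    define z where "z = (1 / norm y) *\<^sub>R y"
    have "y \<in> E"
      unfolding y_def using that C(3) E(1) by (intro subspace_diff subspace_sum subspace_scale) auto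
    then have z: "z \<in> E" "z \<bullet> z = 1"
      using E(1) \<open>y \<noteq> 0\<close> by (auto simp: z_def subspace_scale simp flip: power2_norm_eq_inner power2_eq_square)
    have zc: "c \<bullet> z = 0" if "c \<in> C" for c
      using orthonormal_inner_sum[OF C(2,1) that, of "\<lambda>c. c \<bullet> x"] by (simp add: z_def y_def inner_diff_right)
    have Jzc: "c \<bullet> J z = 0" if "c \<in> C" for c
    proof -
      have "c \<bullet> J z = - (J c \<bullet> z)" using skew[of c z] by simp
      then show ?thesis using J_C[OF that] zc[of "J c"] zc[of "- J c"] by auto
    qed
    have z_notin: "z \<notin> C" "J z \<notin> C" "z \<noteq> J z"
      using zc[of z] Jzc[of "J z"] perp[of z] z(2) J(1)[of z z] by auto
    have "insert z B \<union> J ` insert z B = insert z (insert (J z) C)" by (auto simp: C_def)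
    moreover have "orthonormal (insert z (insert (J z) C))"
    proof (intro orthonormal_insert C(2))
      show "b \<bullet> z = 0" if "b \<in> insert (J z) C" for b
        using that zc perp by blast
    qed (simp_all add: Jzc J(1) z(2))
    moreover have "insert z B \<inter> J ` insert z B = {}"
      using z_notin B'(2) \<open>inj J\<close> by (auto simp: C_def inj_eq)
    ultimately have "Q (insert z B)"
      using B' z(1) by (simp add: Q_def)
    from B(2)[OF this] show False
      using z_notin B'(1) by (simp add: C_def)
  qed
  moreover have "span C \<subseteq> E" using C(3) E(1) by (rule span_minimal)
  ultimately have "span C = E" by blast
  moreover have "even (card C)"
    using B' \<open>inj J\<close> by (simp add: C_def card_Un_disjoint card_image inj_on_subset[of J UNIV])
  ultimately show thesis using that C by blast
qed

text \<open>What the Levy kernel and its operator satisfy, apart from the probability: a complex structure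
  that preserves \<open>f\<close> and an involution that changes its sign.\<close>

locale symmetric_hs_operator =
  fixes T :: "'h::{real_inner, complete_space} \<Rightarrow> 'h \<Rightarrow> 't::{real_inner, complete_space}"
    and f :: 't and F J S :: "'h \<Rightarrow> 'h"
  assumes T: "is_hilbert_tensor T" and F: "hs_operator T f F"
    and f_sym: "\<And>x y. f \<bullet> T x y = f \<bullet> T y x"
    and J: "\<And>x y. J x \<bullet> J y = x \<bullet> y" "\<And>x. J (J x) = - x" "\<And>x y. f \<bullet> T (J x) (J y) = f \<bullet> T x y"
    and S: "\<And>x y. S x \<bullet> S y = x \<bullet> y" "\<And>x. S (S x) = x" "\<And>x y. f \<bullet> T (S x) (S y) = - (f \<bullet> T x y)"
begin

sublocale T: bounded_bilinear T by (rule tensor_bilinear[OF T])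
sublocale F: bounded_linear F by (rule hs_operator_bounded_linear[OF T F])
sublocale J: linear J by (rule inner_preserving_imp_linear) (rule J(1))
sublocale S: linear S by (rule inner_preserving_imp_linear) (rule S(1))

lemma F_inner: "F x \<bullet> y = f \<bullet> T x y"
  using F by (simp add: hs_operator_def)

lemma F_sym: "F x \<bullet> y = x \<bullet> F y"
  using f_sym[of x y] by (simp add: F_inner inner_commute[of x])

lemma F_commutes_J: "F (J x) = J (F x)"
proof (rule inner_eqI)
  fix z
  have "F (J x) \<bullet> J (- J z) = J (F x) \<bullet> J (- J z)"
    by (simp only: F_inner J(3)) (simp add: J(1) F_inner T.minus_right)
  then show "F (J x) \<bullet> z = J (F x) \<bullet> z" by (simp add: J.neg J(2))
qed

lemma F_anticommutes_S: "F (S x) = - S (F x)"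
proof (rule inner_eqI)
  fix z
  have "F (S x) \<bullet> S (S z) = - (F x \<bullet> S z)"
    by (simp only: F_inner S(3))
  also have "\<dots> = (- S (F x)) \<bullet> S (S z)"
    by (simp only: S(1) inner_minus_left)
  finally show "F (S x) \<bullet> z = (- S (F x)) \<bullet> z" by (simp only: S(2))
qed

lemma eigenspace_subspace: "subspace (eigenspace F l)"
  by (auto simp: subspace_def eigenspace_def F.add F.scaleR F.zero algebra_simps)

lemma eigenspace_J: "x \<in> eigenspace F l \<Longrightarrow> J x \<in> eigenspace F l"
  by (simp add: eigenspace_def F_commutes_J J.scale)

lemma eigenspace_S: "x \<in> eigenspace F l \<Longrightarrow> S x \<in> eigenspace F (- l)"
  by (simp add: eigenspace_def F_anticommutes_S S.scale)

lemma eigenspaces_orthogonal: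
  assumes "x \<in> eigenspace F l" "y \<in> eigenspace F l'" "l \<noteq> l'"
  shows "x \<bullet> y = 0"
  using F_sym[of x y] assms by (simp add: eigenspace_def)

lemma orthonormal_in_eigenspace_bound:
  assumes "l \<noteq> 0" "finite B" "orthonormal B" "B \<subseteq> eigenspace F l"
  shows "card B \<le> nat \<lceil>(norm f)\<^sup>2 / l\<^sup>2\<rceil>"
proof -
  have "real (card B) * l\<^sup>2 \<le> (norm f)\<^sup>2"
    using hs_eigenvalues_square_sum[OF T F assms(2,3), of "\<lambda>_. l"] assms(4) by (auto simp: eigenspace_def)
  then have "real (card B) \<le> (norm f)\<^sup>2 / l\<^sup>2" using assms(1) by (simp add: field_simps)
  then show ?thesis by linarith
qed

definition eigenbasis :: "real \<Rightarrow> 'h set" where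
  "eigenbasis l = (SOME C. finite C \<and> orthonormal C \<and> span C = eigenspace F l \<and> even (card C))"

lemma eigenbasis:
  assumes "l \<noteq> 0"
  shows "finite (eigenbasis l)" "orthonormal (eigenbasis l)" "span (eigenbasis l) = eigenspace F l"
    "even (card (eigenbasis l))"
proof -
  have "\<exists>C. finite C \<and> orthonormal C \<and> span C = eigenspace F l \<and> even (card C)"
    by (rule complex_structure_orthonormal_basis[OF J(1,2) eigenspace_subspace eigenspace_J
          orthonormal_in_eigenspace_bound[OF assms]]) blast+
  from someI_ex[OF this] show "finite (eigenbasis l)" "orthonormal (eigenbasis l)"
    "span (eigenbasis l) = eigenspace F l" "even (card (eigenbasis l))"
    unfolding eigenbasis_def by blast+
qed

lemma eigenbasis_subset: "l \<noteq> 0 \<Longrightarrow> e \<in> eigenbasis l \<Longrightarrow> e \<in> eigenspace F l"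
  using eigenbasis(3) span_superset by blast

lemma inj_S: "inj S"
  by (rule injI) (metis S(2))

lemma orthonormal_S: "orthonormal B \<Longrightarrow> orthonormal (S ` B)"
  using inj_S by (auto simp: orthonormal_def S(1) inj_eq)

lemma span_S_eigenbasis:
  assumes "l \<noteq> 0"
  shows "span (S ` eigenbasis l) = eigenspace F (- l)"
proof -
  have "span (S ` eigenbasis l) = S ` eigenspace F l"
    by (simp add: linear_span_image[OF S.linear_axioms] eigenbasis(3)[OF assms])
  also have "\<dots> = eigenspace F (- l)"
  proof (intro equalityI subsetI)
    fix x assume "x \<in> eigenspace F (- l)"
    then have "S x \<in> eigenspace F l" using eigenspace_S[of x "- l"] by simp
    then show "x \<in> S ` eigenspace F l" by (metis S(2) imageI)
  qed (auto intro: eigenspace_S)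
  finally show ?thesis .
qed

lemma dim_eigenspace:
  assumes "l \<noteq> 0"
  shows "dim (eigenspace F l) = card (eigenbasis l)" "dim (eigenspace F (- l)) = card (eigenbasis l)"
proof -
  show "dim (eigenspace F l) = card (eigenbasis l)"
    using dim_span_eq_card_independent[OF orthonormal_independent[OF eigenbasis(2)[OF assms]]]
    by (simp add: eigenbasis(3)[OF assms])
  show "dim (eigenspace F (- l)) = card (eigenbasis l)"
    using dim_span_eq_card_independent[OF orthonormal_independent[OF orthonormal_S[OF eigenbasis(2)[OF assms]]]]
    by (simp add: span_S_eigenbasis[OF assms] card_image inj_on_subset[OF inj_S])
qed

lemma eigenval_iff_eigenbasis:
  assumes "l \<noteq> 0"
  shows "eigenval F l \<longleftrightarrow> eigenbasis l \<noteq> {}"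
proof
  assume "eigenval F l"
  then obtain x where "x \<noteq> 0" "x \<in> span (eigenbasis l)"
    unfolding eigenbasis(3)[OF assms] by (auto simp: eigenval_def eigenspace_def)
  then show "eigenbasis l \<noteq> {}" by auto
next
  assume "eigenbasis l \<noteq> {}"
  then obtain e where "e \<in> eigenbasis l" by blast
  then have "e \<in> eigenspace F l" "e \<bullet> e = 1"
    using eigenbasis_subset[OF assms] orthonormalD(1)[OF eigenbasis(2)[OF assms]] by auto
  then show "eigenval F l" by (force simp: eigenval_def eigenspace_def)
qed

lemma eigenval_uminus: "eigenval F l \<Longrightarrow> eigenval F (- l)"
proof -
  assume "eigenval F l"
  then obtain x where x: "x \<noteq> 0" "x \<in> eigenspace F l" by (auto simp: eigenval_def eigenspace_def)
  have "S x \<noteq> 0" using S(2)[of x] x(1) by (metis S.zero)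
  then show ?thesis using eigenspace_S[OF x(2)] by (auto simp: eigenval_def eigenspace_def)
qed

text \<open>Unit eigenvectors of distinct eigenvalues are orthonormal, so by
  \<open>hs_eigenvalues_square_sum\<close> only finitely many eigenvalues are at least \<open>1/(n+1)\<close>.\<close>

lemma countable_positive_eigenvalues: "countable {a. a > 0 \<and> eigenval F a}"
proof -
  have fin: "finite {a. a \<ge> inverse (real (Suc n)) \<and> eigenval F a}" (is "finite ?P") for n
  proof (rule finite_if_finite_subsets_card_bdd[THEN conjunct1])
    let ?d = "inverse (real (Suc n))"
    fix A assume A: "A \<subseteq> ?P" "finite A"
    have pos: "?d > 0" by simp
    have "\<exists>x. x \<bullet> x = 1 \<and> x \<in> eigenspace F a" if "a \<in> A" for a
    proof -
      have "a \<ge> ?d" "eigenval F a" using that A(1) by auto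
      then have "a \<noteq> 0" using pos by linarith
      then obtain e where "e \<in> eigenbasis a" using eigenval_iff_eigenbasis[of a] \<open>eigenval F a\<close> by blast
      then show ?thesis
        using eigenbasis_subset[OF \<open>a \<noteq> 0\<close>] orthonormalD(1)[OF eigenbasis(2)[OF \<open>a \<noteq> 0\<close>]]
        by (intro exI[of _ e]) simp
    qed
    then obtain v where v: "\<And>a. a \<in> A \<Longrightarrow> v a \<bullet> v a = 1" "\<And>a. a \<in> A \<Longrightarrow> v a \<in> eigenspace F a"
      by metis
    have v_perp: "v a \<bullet> v b = 0" if "a \<in> A" "b \<in> A" "a \<noteq> b" for a b
      using eigenspaces_orthogonal[OF v(2) v(2)] that by blast
    have inj: "inj_on v A"
      using v(1) v_perp by (intro inj_onI) (metis zero_neq_one)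
    have on: "orthonormal (v ` A)"
      using v(1) v_perp inj by (auto simp: orthonormal_def inj_on_eq_iff)
    have "(\<Sum>x\<in>v ` A. (inv_into A v x)\<^sup>2) \<le> (norm f)\<^sup>2"
      using A(2) on v(2) inj
      by (intro hs_eigenvalues_square_sum[OF T F]) (auto simp: eigenspace_def)
    then have "(\<Sum>a\<in>A. a\<^sup>2) \<le> (norm f)\<^sup>2"
      by (simp add: sum.reindex[OF inj] inj)
    moreover have "real (card A) * ?d\<^sup>2 \<le> (\<Sum>a\<in>A. a\<^sup>2)"
      using A pos by (intro sum_bounded_below power_mono) auto
    ultimately have "real (card A) \<le> (norm f)\<^sup>2 / ?d\<^sup>2"
      using pos by (subst pos_le_divide_eq) (auto simp del: of_nat_Suc)
    then show "card A \<le> nat \<lceil>(norm f)\<^sup>2 / ?d\<^sup>2\<rceil>" by linarith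
  qed
  have "countable (\<Union>n. {a. a \<ge> inverse (real (Suc n)) \<and> eigenval F a})"
    by (rule countable_UN) (use fin in \<open>auto intro: countable_finite\<close>)
  moreover have "{a. a > 0 \<and> eigenval F a} \<subseteq> (\<Union>n. {a. a \<ge> inverse (real (Suc n)) \<and> eigenval F a})"
  proof
    fix a assume a: "a \<in> {a. a > 0 \<and> eigenval F a}"
    then obtain n where "inverse (real (Suc n)) < a" using reals_Archimedean by blast
    then show "a \<in> (\<Union>n. {a. a \<ge> inverse (real (Suc n)) \<and> eigenval F a})"
      using a by (intro UN_I[of n]) auto
  qed
  ultimately show ?thesis by (rule countable_subset[rotated])
qed

text \<open>The part of \<open>f\<close> carried by the eigenvalues \<open>a\<close> and \<open>-a\<close> together, for \<open>a > 0\<close>. The vectors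
  \<open>S e\<close> form an orthonormal basis of the eigenspace of \<open>-a\<close>, so one basis serves for both.\<close>

definition block :: "real \<Rightarrow> 't" where
  "block a = (\<Sum>e\<in>eigenbasis a. a *\<^sub>R (T e e - T (S e) (S e)))"

text \<open>Paired with \<open>T x y\<close>, a block is \<open>a\<close> times the difference of the projections of \<open>x\<close> to the
  eigenspaces of \<open>a\<close> and \<open>-a\<close>, paired with \<open>y\<close>.\<close>

lemma block_inner:
  "block a \<bullet> T x y = a * ((\<Sum>e\<in>eigenbasis a. (e \<bullet> x) *\<^sub>R e) \<bullet> y - (\<Sum>e\<in>eigenbasis a. (S e \<bullet> x) *\<^sub>R S e) \<bullet> y)"
  by (simp add: block_def inner_sum_left inner_diff_left tensor_inner[OF T] sum_subtractf
      sum_distrib_left algebra_simps)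

lemma block_sym: "block a \<bullet> T x y = block a \<bullet> T y x"
  by (simp add: block_inner inner_sum_left mult.commute)

lemma block_perp:
  assumes "a > 0" "\<And>e. e \<in> eigenspace F a \<Longrightarrow> e \<bullet> x = 0" "\<And>e. e \<in> eigenspace F (- a) \<Longrightarrow> e \<bullet> x = 0"
  shows "block a \<bullet> T x y = 0"
  using assms eigenbasis_subset[of a] eigenspace_S[of _ a] by (simp add: block_inner)

lemma block_other_eigenspace:
  assumes "a > 0" "x \<in> eigenspace F l" "\<bar>l\<bar> \<noteq> a"
  shows "block a \<bullet> T x y = 0"
proof (rule block_perp[OF assms(1)])
  show "e \<bullet> x = 0" if "e \<in> eigenspace F a" for e
    using eigenspaces_orthogonal[OF that assms(2)] assms(1,3) by auto
  show "e \<bullet> x = 0" if "e \<in> eigenspace F (- a)" for e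
    using eigenspaces_orthogonal[OF that assms(2)] assms(1,3) by auto
qed

lemma block_own_eigenspace:
  assumes "l \<noteq> 0" "x \<in> eigenspace F l"
  shows "block \<bar>l\<bar> \<bullet> T x y = l * (x \<bullet> y)"
proof (cases "l > 0")
  case True
  have "S e \<bullet> x = 0" if "e \<in> eigenbasis l" for e
    using eigenspaces_orthogonal[OF eigenspace_S[OF eigenbasis_subset[OF assms(1) that]] assms(2)] True by simp
  moreover have "(\<Sum>e\<in>eigenbasis l. (e \<bullet> x) *\<^sub>R e) = x"
    using orthonormal_expansion[OF eigenbasis(2,1)[OF assms(1)], of x] assms by (simp add: eigenbasis(3))
  ultimately show ?thesis using True by (simp add: block_inner)
next
  case False
  define a where "a = - l"
  have a: "a > 0" "a \<noteq> 0" "l = - a" using False assms(1) by (auto simp: a_def)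
  have "e \<bullet> x = 0" if "e \<in> eigenbasis a" for e
    using eigenspaces_orthogonal[OF eigenbasis_subset[OF a(2) that] assms(2)] a by simp
  moreover have "(\<Sum>e\<in>eigenbasis a. (S e \<bullet> x) *\<^sub>R S e) = (\<Sum>e\<in>S ` eigenbasis a. (e \<bullet> x) *\<^sub>R e)"
    by (simp add: sum.reindex[OF inj_on_subset[OF inj_S]])
  moreover have "\<dots> = x"
    using orthonormal_expansion[OF orthonormal_S[OF eigenbasis(2)[OF a(2)]], of x] assms(2) a
    by (simp add: eigenbasis(1) span_S_eigenbasis)
  ultimately show ?thesis using a by (simp add: block_inner)
qed

text \<open>The two formulas together say that the blocks are the orthogonal projections of \<open>f\<close> to mutually
  orthogonal lines, as required by \<open>orthogonal_series_convergent\<close>.\<close>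

lemma inner_block:
  assumes "a > 0"
  shows "f \<bullet> block a = 2 * a\<^sup>2 * card (eigenbasis a)"
    and "b > 0 \<Longrightarrow> block b \<bullet> block a = (if b = a then 2 * a\<^sup>2 * card (eigenbasis a) else 0)"
proof -
  have eig: "e \<in> eigenspace F a" "S e \<in> eigenspace F (- a)" "e \<bullet> e = 1" "S e \<bullet> S e = 1"
    if "e \<in> eigenbasis a" for e
    using that assms eigenbasis_subset[of a] eigenspace_S[of e a] orthonormalD(1)[OF eigenbasis(2), of a e]
    by (auto simp: S(1))
  have "f \<bullet> (T e e - T (S e) (S e)) = 2 * a" if "e \<in> eigenbasis a" for e
    using eig[OF that] by (simp add: inner_diff_right eigenspace_def flip: F_inner)
  then show "f \<bullet> block a = 2 * a\<^sup>2 * card (eigenbasis a)"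
    by (simp add: block_def inner_sum_right power2_eq_square)
  assume "b > 0"
  have "block b \<bullet> (T e e - T (S e) (S e)) = (if b = a then 2 * a else 0)" if "e \<in> eigenbasis a" for e
  proof (cases "b = a")
    case True
    then show ?thesis
      using block_own_eigenspace[of a e] block_own_eigenspace[of "- a" "S e"] eig[OF that] assms
      by (simp add: inner_diff_right)
  next
    case False
    then show ?thesis
      using block_other_eigenspace[OF \<open>b > 0\<close> eig(1)[OF that]] block_other_eigenspace[OF \<open>b > 0\<close> eig(2)[OF that]] assms
      by (simp add: inner_diff_right)
  qed
  then show "block b \<bullet> block a = (if b = a then 2 * a\<^sup>2 * card (eigenbasis a) else 0)"
    by (simp add: block_def[of a] inner_sum_right power2_eq_square)
qed

text \<open>The sum of the blocks converges by Bessel's inequality. Paired with \<open>T x y\<close> for an eigenvector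
  \<open>x\<close>, only the block of its own eigenvalue contributes and gives \<open>F x \<bullet> y\<close>; for \<open>x\<close> orthogonal to
  all eigenvectors every block gives \<open>0\<close>. By \<open>tensor_eq_if_eigenvectors_agree\<close> the sum is \<open>f\<close>.
  Half of the squared norm of the block of \<open>a\<close> is \<open>a\<^sup>2\<close> times the multiplicity, which explains the
  summability.\<close>

lemma block_series:
  fixes \<alpha> :: "nat \<Rightarrow> real"
  assumes \<alpha>: "bij_betw \<alpha> N {a. a > 0 \<and> eigenval F a}"
  shows "(\<lambda>k. \<Sum>n<k. if n \<in> N then block (\<alpha> n) else 0) \<longlonglongrightarrow> f"
    and "summable (\<lambda>n. if n \<in> N then (\<alpha> n)\<^sup>2 * card (eigenbasis (\<alpha> n)) else 0)"
proof -
  let ?u = "\<lambda>n. if n \<in> N then block (\<alpha> n) else 0"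
  have pos: "\<alpha> n > 0" if "n \<in> N" for n
    using \<alpha> that by (auto simp: bij_betw_def)
  have inj: "\<alpha> i = \<alpha> j \<longleftrightarrow> i = j" if "i \<in> N" "j \<in> N" for i j
    using \<alpha> that by (auto simp: bij_betw_def inj_on_eq_iff)
  have orth: "?u i \<bullet> ?u j = 0" if "i \<noteq> j" for i j
    using that inj[of i j] by (auto simp: inner_block(2) pos)
  have proj: "f \<bullet> ?u i = ?u i \<bullet> ?u i" for i
    by (simp add: inner_block pos)
  note conv = orthogonal_series_convergent[of ?u f, OF orth proj]
  have sq: "?u n \<bullet> ?u n / 2 = (if n \<in> N then (\<alpha> n)\<^sup>2 * card (eigenbasis (\<alpha> n)) else 0)" for n
    by (simp add: inner_block pos)
  show "summable (\<lambda>n. if n \<in> N then (\<alpha> n)\<^sup>2 * card (eigenbasis (\<alpha> n)) else 0)"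
    using summable_divide[OF conv(1), of 2] unfolding sq .
  obtain g where g: "(\<lambda>k. \<Sum>n<k. ?u n) \<longlonglongrightarrow> g"
    using conv(2) by (auto simp: convergent_def)
  have g_inner: "(\<lambda>k. \<Sum>n<k. ?u n \<bullet> T x y) \<longlonglongrightarrow> g \<bullet> T x y" for x y
    using tendsto_inner[OF g tendsto_const] by (simp add: inner_sum_left)
  have "g = f"
  proof (rule tensor_eq_if_eigenvectors_agree[OF T F f_sym])
    fix x y
    have "(\<Sum>n<k. ?u n \<bullet> T x y) = (\<Sum>n<k. ?u n \<bullet> T y x)" for k
      by (intro sum.cong) (simp_all add: block_sym[of _ x y])
    then show "g \<bullet> T x y = g \<bullet> T y x"
      using LIMSEQ_unique[OF g_inner[of x y]] g_inner[of y x] by simp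
  next
    fix l :: real and x y assume l: "l \<noteq> 0" and x: "x \<in> eigenspace F l"
    show "g \<bullet> T x y = f \<bullet> T x y"
    proof (cases "x = 0")
      case False
      then have "eigenval F l" using x by (auto simp: eigenval_def eigenspace_def)
      then have "eigenval F \<bar>l\<bar>" using eigenval_uminus[of l] by (auto simp: abs_if)
      then have "\<bar>l\<bar> \<in> \<alpha> ` N" using \<alpha> l by (simp add: bij_betw_def)
      then obtain m where m: "m \<in> N" "\<alpha> m = \<bar>l\<bar>" by auto
      have "?u n \<bullet> T x y = (if n = m then f \<bullet> T x y else 0)" for n
        using block_own_eigenspace[OF l x] block_other_eigenspace[OF pos x] m inj[of n m] x
        by (auto simp: eigenspace_def simp flip: F_inner)
      then have "\<forall>\<^sub>F k in sequentially. (\<Sum>n<k. ?u n \<bullet> T x y) = f \<bullet> T x y"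
        by (intro eventually_sequentiallyI[of "Suc m"]) simp
      from tendsto_eventually[OF this] show ?thesis using g_inner[of x y] LIMSEQ_unique by blast
    qed (simp add: T.zero_left)
  next
    fix x y assume perp: "\<And>l e. l \<noteq> 0 \<Longrightarrow> e \<in> eigenspace F l \<Longrightarrow> x \<bullet> e = 0"
    have "?u n \<bullet> T x y = 0" for n
    proof (cases "n \<in> N")
      case True
      have "block (\<alpha> n) \<bullet> T x y = 0"
      proof (rule block_perp[OF pos[OF True]])
        show "e \<bullet> x = 0" if "e \<in> eigenspace F (\<alpha> n)" for e
          using perp[OF _ that] pos[OF True] by (simp add: inner_commute)
        show "e \<bullet> x = 0" if "e \<in> eigenspace F (- \<alpha> n)" for e
          using perp[OF _ that] pos[OF True] by (simp add: inner_commute)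
      qed
      then show ?thesis using True by simp
    qed simp
    then show "g \<bullet> T x y = 0"
      using g_inner[of x y] LIMSEQ_unique[OF tendsto_const[of 0]] by simp
  qed
  then show "(\<lambda>k. \<Sum>n<k. ?u n) \<longlonglongrightarrow> f" using g by simp
qed

end

section \<open>Independence from the joint characteristic function\<close>

context prob_space
begin

lemma char_distr:
  assumes "X \<in> borel_measurable M"
  shows "char (distr M borel X) t = (\<integral>\<omega>. iexp (t * X \<omega>) \<partial>M)"
  unfolding char_def using assms by (subst integral_distr) auto

lemma char_distr_AE_cong:
  assumes "X \<in> borel_measurable M" "Y \<in> borel_measurable M" "AE \<omega> in M. X \<omega> = Y \<omega>"
  shows "char (distr M borel X) t = char (distr M borel Y) t"
  using assms by (simp add: char_distr) (intro integral_cong_AE; force)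

lemma integrable_bounded_mult_iexp:
  assumes [measurable]: "X \<in> borel_measurable M" "Z \<in> borel_measurable M"
    and "\<And>\<omega>. norm (Z \<omega> :: complex) \<le> K"
  shows "integrable M (\<lambda>\<omega>. Z \<omega> * iexp (t * X \<omega>))"
  using assms(3) by (intro integrable_const_bound[of _ K]) (auto simp: norm_mult norm_exp_i_times[of "t * X _", simplified])

text \<open>After adding a constant, \<open>Z\<close> is a positive density \<open>D\<close>, up to normalisation. The hypothesis
  then says that \<open>U\<close> has the same characteristic function under the measure with density \<open>D\<close> as
  under \<open>M\<close>, hence the same law.\<close>

lemma factorize_real_indicator:
  fixes Z :: "'a \<Rightarrow> real"
  assumes U[measurable]: "U \<in> borel_measurable M" and Z[measurable]: "Z \<in> borel_measurable M"
    and bound: "\<And>\<omega>. \<bar>Z \<omega>\<bar> \<le> K"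
    and fact: "\<And>t. (\<integral>\<omega>. of_real (Z \<omega>) * iexp (t * U \<omega>) \<partial>M) =
      of_real (\<integral>\<omega>. Z \<omega> \<partial>M) * (\<integral>\<omega>. iexp (t * U \<omega>) \<partial>M)"
    and A[measurable]: "A \<in> sets borel"
  shows "(\<integral>\<omega>. Z \<omega> * indicator A (U \<omega>) \<partial>M) = (\<integral>\<omega>. Z \<omega> \<partial>M) * (\<integral>\<omega>. indicator A (U \<omega>) \<partial>M)"
proof -
  have int_Z: "integrable M Z"
    using bound by (intro integrable_const_bound[of _ K]) auto
  have int_Z_ind: "integrable M (\<lambda>\<omega>. Z \<omega> * indicator A (U \<omega>))"
    by (intro integrable_const_bound[of _ "\<bar>K\<bar>"] AE_I2)
      (use bound in \<open>auto simp: indicator_def intro: order_trans[OF _ abs_ge_self]\<close>)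
  have int_ind: "integrable M (\<lambda>\<omega>. indicator A (U \<omega>) :: real)"
    by (intro integrable_const_bound[of _ 1]) (auto simp: indicator_def)
  \<comment> \<open>\<open>Z + K\<close> is nonnegative, and the extra 1 makes the normalising constant positive\<close>
  define d where "d = (\<integral>\<omega>. Z \<omega> \<partial>M) + K + 1"
  define D where "D \<omega> = (Z \<omega> + K + 1) / d" for \<omega>
  have "0 \<le> (\<integral>\<omega>. Z \<omega> + K \<partial>M)"
  proof (rule Bochner_Integration.integral_nonneg)
    show "0 \<le> Z \<omega> + K" for \<omega> using bound[of \<omega>] by linarith
  qed
  then have d: "d > 0" using int_Z by (simp add: d_def prob_space)
  have D_nonneg: "D \<omega> \<ge> 0" for \<omega>
    using bound[of \<omega>] d by (auto simp: D_def abs_le_iff)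
  have D_meas[measurable]: "D \<in> borel_measurable M" unfolding D_def by measurable
  have int_D: "integrable M D"
    unfolding D_def using int_Z by auto
  have "(\<integral>\<omega>. D \<omega> \<partial>M) = 1"
    unfolding D_def using int_Z d by (simp add: prob_space d_def)
  then have "emeasure (density M D) (space (density M D)) = 1"
    using int_D D_nonneg by (simp add: emeasure_density nn_integral_eq_integral cong: nn_integral_cong)
  then interpret D: prob_space "density M D" by (rule prob_spaceI)
  have "char (distr (density M D) borel U) t = char (distr M borel U) t" for t
  proof -
    have "char (distr (density M D) borel U) t = (\<integral>\<omega>. iexp (t * U \<omega>) \<partial>density M D)"
      using D.char_distr[of U t] by simp
    also have "\<dots> = (\<integral>\<omega>. D \<omega> *\<^sub>R iexp (t * U \<omega>) \<partial>M)"
      using D_nonneg by (subst integral_density) auto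
    also have "\<dots> = (\<integral>\<omega>. (of_real (Z \<omega>) * iexp (t * U \<omega>) + of_real (K + 1) * iexp (t * U \<omega>)) / of_real d \<partial>M)"
      by (intro Bochner_Integration.integral_cong) (auto simp: D_def scaleR_conv_of_real algebra_simps add_divide_distrib)
    also have "\<dots> = ((\<integral>\<omega>. of_real (Z \<omega>) * iexp (t * U \<omega>) \<partial>M) + of_real (K + 1) * (\<integral>\<omega>. iexp (t * U \<omega>) \<partial>M)) / of_real d"
      using integrable_bounded_mult_iexp[of U "\<lambda>\<omega>. of_real (Z \<omega>)" K t]
        integrable_bounded_mult_iexp[of U "\<lambda>\<omega>. of_real (K + 1)" "\<bar>K + 1\<bar>" t] bound
      by (simp del: of_real_add)
    also have "\<dots> = (\<integral>\<omega>. iexp (t * U \<omega>) \<partial>M)"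
      proof -
      have "of_real (\<integral>\<omega>. Z \<omega> \<partial>M) * c + of_real (K + 1) * c = of_real d * c" for c :: complex
        by (simp add: d_def algebra_simps)
      then show ?thesis unfolding fact using d by simp
    qed
    also have "\<dots> = char (distr M borel U) t" by (simp add: char_distr)
    finally show ?thesis .
  qed
  then have eq: "distr (density M D) borel U = distr M borel U"
    using D.prob_space_distr[of U borel] prob_space_distr[of U borel]
    by (intro Levy_uniqueness) (auto simp: real_distribution_def real_distribution_axioms_def)
  have "(\<integral>\<omega>. D \<omega> * indicator A (U \<omega>) \<partial>M) = (\<integral>\<omega>. indicator A (U \<omega>) \<partial>density M D)"
    using D_nonneg by (subst integral_density) auto
  also have "\<dots> = (\<integral>x. indicator A x \<partial>distr (density M D) borel U)"
    by (subst integral_distr) auto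
  also have "\<dots> = (\<integral>\<omega>. indicator A (U \<omega>) \<partial>M)"
    unfolding eq by (subst integral_distr) auto
  also have "(\<integral>\<omega>. D \<omega> * indicator A (U \<omega>) \<partial>M) =
      (\<integral>\<omega>. (Z \<omega> * indicator A (U \<omega>) + (K + 1) * indicator A (U \<omega>)) / d \<partial>M)"
    by (intro Bochner_Integration.integral_cong) (auto simp: D_def algebra_simps)
  also have "\<dots> = ((\<integral>\<omega>. Z \<omega> * indicator A (U \<omega>) \<partial>M) + (K + 1) * (\<integral>\<omega>. indicator A (U \<omega>) \<partial>M)) / d"
    using int_Z_ind int_ind by simp
  finally show ?thesis using d by (simp add: d_def field_simps)
qed

text \<open>Conjugating the hypothesis at \<open>-t\<close> gives it for the conjugate of \<open>Z\<close>, hence for the real and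
  imaginary parts of \<open>Z\<close>.\<close>

lemma factorize_complex_indicator:
  fixes Z :: "'a \<Rightarrow> complex"
  assumes U[measurable]: "U \<in> borel_measurable M" and Z[measurable]: "Z \<in> borel_measurable M"
    and bound: "\<And>\<omega>. norm (Z \<omega>) \<le> K"
    and fact: "\<And>t. (\<integral>\<omega>. Z \<omega> * iexp (t * U \<omega>) \<partial>M) = (\<integral>\<omega>. Z \<omega> \<partial>M) * (\<integral>\<omega>. iexp (t * U \<omega>) \<partial>M)"
    and A[measurable]: "A \<in> sets borel"
  shows "(\<integral>\<omega>. Z \<omega> * indicator A (U \<omega>) \<partial>M) = (\<integral>\<omega>. Z \<omega> \<partial>M) * (\<integral>\<omega>. indicator A (U \<omega>) \<partial>M)"
proof -
  have int: "integrable M (\<lambda>\<omega>. Z \<omega> * iexp (t * U \<omega>))" for t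
    using bound by (intro integrable_bounded_mult_iexp) auto
  have int_Z: "integrable M Z" using int[of 0] by simp
  have cnj_iexp: "cnj (z * iexp (- t * u)) = cnj z * iexp (t * u)" for z t u
    by (simp add: exp_cnj)
  have int_cnj: "integrable M (\<lambda>\<omega>. cnj (Z \<omega>) * iexp (t * U \<omega>))" for t
    using complex_integrable_cnj[of M "\<lambda>\<omega>. Z \<omega> * iexp (- t * U \<omega>)"] int[of "- t"]
    unfolding cnj_iexp by blast
  have cnj_Z: "(\<integral>\<omega>. cnj (Z \<omega>) * iexp (t * U \<omega>) \<partial>M) = cnj (\<integral>\<omega>. Z \<omega> \<partial>M) * (\<integral>\<omega>. iexp (t * U \<omega>) \<partial>M)" for t
  proof -
    have "(\<integral>\<omega>. cnj (Z \<omega>) * iexp (t * U \<omega>) \<partial>M) = cnj (\<integral>\<omega>. Z \<omega> * iexp (- t * U \<omega>) \<partial>M)"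
      unfolding cnj_iexp[symmetric] by (rule Bochner_Integration.integral_cnj)
    also have "\<dots> = cnj (\<integral>\<omega>. Z \<omega> \<partial>M) * cnj (\<integral>\<omega>. 1 * iexp (- t * U \<omega>) \<partial>M)"
      unfolding fact by simp
    also have "cnj (\<integral>\<omega>. 1 * iexp (- t * U \<omega>) \<partial>M) = (\<integral>\<omega>. cnj 1 * iexp (t * U \<omega>) \<partial>M)"
      unfolding cnj_iexp[symmetric] by (rule Bochner_Integration.integral_cnj[symmetric])
    finally show ?thesis by simp
  qed
  have Re_eq: "of_real (Re z) * w = (z * w + cnj z * w) / 2"
    and Im_eq: "of_real (Im z) * w = - (\<i> / 2) * (z * w - cnj z * w)" for z w
    by (simp_all add: complex_eq_iff)
  have re: "(\<integral>\<omega>. Re (Z \<omega>) * indicator A (U \<omega>) \<partial>M) = (\<integral>\<omega>. Re (Z \<omega>) \<partial>M) * (\<integral>\<omega>. indicator A (U \<omega>) \<partial>M)"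
  proof (rule factorize_real_indicator[where K = K, OF U _ _ _ A])
    show "\<bar>Re (Z \<omega>)\<bar> \<le> K" for \<omega> using bound[of \<omega>] abs_Re_le_cmod order_trans by blast
    fix t
    have "(\<integral>\<omega>. of_real (Re (Z \<omega>)) * iexp (t * U \<omega>) \<partial>M) =
        ((\<integral>\<omega>. Z \<omega> * iexp (t * U \<omega>) \<partial>M) + (\<integral>\<omega>. cnj (Z \<omega>) * iexp (t * U \<omega>) \<partial>M)) / 2"
      unfolding Re_eq using int int_cnj by simp
    then show "(\<integral>\<omega>. of_real (Re (Z \<omega>)) * iexp (t * U \<omega>) \<partial>M) =
        of_real (\<integral>\<omega>. Re (Z \<omega>) \<partial>M) * (\<integral>\<omega>. iexp (t * U \<omega>) \<partial>M)"
      unfolding fact cnj_Z integral_Re[OF int_Z] Re_eq .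
  qed auto
  have im: "(\<integral>\<omega>. Im (Z \<omega>) * indicator A (U \<omega>) \<partial>M) = (\<integral>\<omega>. Im (Z \<omega>) \<partial>M) * (\<integral>\<omega>. indicator A (U \<omega>) \<partial>M)"
  proof (rule factorize_real_indicator[where K = K, OF U _ _ _ A])
    show "\<bar>Im (Z \<omega>)\<bar> \<le> K" for \<omega> using bound[of \<omega>] abs_Im_le_cmod order_trans by blast
    fix t
    have "(\<integral>\<omega>. of_real (Im (Z \<omega>)) * iexp (t * U \<omega>) \<partial>M) =
        - (\<i> / 2) * ((\<integral>\<omega>. Z \<omega> * iexp (t * U \<omega>) \<partial>M) - (\<integral>\<omega>. cnj (Z \<omega>) * iexp (t * U \<omega>) \<partial>M))"
      unfolding Im_eq using int int_cnj by simp
    then show "(\<integral>\<omega>. of_real (Im (Z \<omega>)) * iexp (t * U \<omega>) \<partial>M) =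
        of_real (\<integral>\<omega>. Im (Z \<omega>) \<partial>M) * (\<integral>\<omega>. iexp (t * U \<omega>) \<partial>M)"
      unfolding fact cnj_Z integral_Im[OF int_Z] Im_eq .
  qed auto
  have int_ind: "integrable M (\<lambda>\<omega>. Z \<omega> * indicator A (U \<omega>))"
    by (intro Bochner_Integration.integrable_bound[OF int_Z]) (auto simp: indicator_def)
  have of_real_ind: "(\<integral>\<omega>. indicator A (U \<omega>) \<partial>M) = (of_real (\<integral>\<omega>. indicator A (U \<omega>) \<partial>M) :: complex)"
    using integral_complex_of_real[of M "\<lambda>\<omega>. indicator A (U \<omega>)"] by (simp add: of_real_indicator)
  have "Re (z * indicator A u) = Re z * indicator A u" "Im (z * indicator A u) = Im z * indicator A u"
    for z and u :: real by (auto simp: indicator_def)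
  then show ?thesis
    using re im int_Z int_ind unfolding of_real_ind
    by (auto simp: complex_eq_iff simp flip: integral_Re integral_Im)
qed

text \<open>Kac's theorem. The factors \<open>iexp (c j * X j)\<close> of the joint characteristic function are replaced,
  one index at a time, by indicators of events of \<open>X j\<close>: when the indices in \<open>J\<close> have been treated,
  the product \<open>Z\<close> of all factors except that of the next index \<open>j\<close> satisfies the hypothesis of
  \<open>factorize_complex_indicator\<close> for \<open>U = X j\<close>. At the end all factors are indicators.\<close>

lemma indep_vars_if_char_factorizes:
  fixes X :: "'i \<Rightarrow> 'a \<Rightarrow> real"
  assumes I: "finite I" and X[measurable]: "\<And>i. i \<in> I \<Longrightarrow> X i \<in> borel_measurable M"
    and char: "\<And>c. (\<integral>\<omega>. iexp (\<Sum>i\<in>I. c i * X i \<omega>) \<partial>M) = (\<Prod>i\<in>I. char (distr M borel (X i)) (c i))"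
  shows "indep_vars (\<lambda>_. borel) X I"
proof (cases "I = {}")
  case True
  then show ?thesis by (simp add: indep_vars_def2 indep_sets_def)
next
  case False
  have key: "(\<integral>\<omega>. (\<Prod>j\<in>J. indicator (A j) (X j \<omega>)) * iexp (\<Sum>k\<in>I - J. c k * X k \<omega>) \<partial>M) =
      (\<Prod>j\<in>J. \<integral>\<omega>. indicator (A j) (X j \<omega>) \<partial>M) * (\<Prod>k\<in>I - J. char (distr M borel (X k)) (c k))"
    if "finite J" "J \<subseteq> I" "\<And>j. j \<in> J \<Longrightarrow> A j \<in> sets borel" for J A c
    using that
  proof (induction J arbitrary: c rule: finite_induct)
    case empty
    then show ?case using char[of c] by simp
  next
    case (insert j J)
    have J[measurable]: "\<And>i. i \<in> J \<Longrightarrow> A i \<in> sets borel" "A j \<in> sets borel" using insert.prems by auto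
    have sub: "J \<subseteq> I" "j \<in> I" "j \<notin> J" "finite J" using insert by auto
    note [measurable] = X[OF subsetD[OF sub(1)]] X[OF sub(2)]
    define K where "K = I - insert j J"
    have K: "finite K" "j \<notin> K" "I - J = insert j K" "K \<subseteq> I" using sub I by (auto simp: K_def)
    have [measurable]: "\<And>k. k \<in> K \<Longrightarrow> X k \<in> borel_measurable M" using X K(4) by blast
    define Z where "Z \<omega> = (\<Prod>j\<in>J. indicator (A j) (X j \<omega>)) * iexp (\<Sum>k\<in>K. c k * X k \<omega>)" for \<omega>
    have Z_meas[measurable]: "Z \<in> borel_measurable M" unfolding Z_def by measurable
    have Z_bound: "norm (Z \<omega>) \<le> 1" for \<omega>
    proof -
      have "norm (\<Prod>j\<in>J. indicator (A j) (X j \<omega>) :: complex) \<le> 1"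
        unfolding prod_norm[symmetric] by (intro prod_le_1) (auto simp: indicator_def)
      then show ?thesis by (simp add: Z_def norm_mult)
    qed
    have Z_iexp: "(\<integral>\<omega>. Z \<omega> * iexp (t * X j \<omega>) \<partial>M) =
        (\<Prod>j\<in>J. \<integral>\<omega>. indicator (A j) (X j \<omega>) \<partial>M) * (\<Prod>k\<in>K. char (distr M borel (X k)) (c k)) *
          (\<integral>\<omega>. iexp (t * X j \<omega>) \<partial>M)" for t
    proof -
      let ?c = "c(j := t)"
      have cK: "(\<Sum>k\<in>K. ?c k * X k \<omega>) = (\<Sum>k\<in>K. c k * X k \<omega>)"
          "(\<Prod>k\<in>K. char (distr M borel (X k)) (?c k)) = (\<Prod>k\<in>K. char (distr M borel (X k)) (c k))" for \<omega>
        using K(2) by (auto intro!: sum.cong prod.cong)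
      have "Z \<omega> * iexp (t * X j \<omega>) =
          (\<Prod>j\<in>J. indicator (A j) (X j \<omega>)) * iexp (\<Sum>k\<in>I - J. ?c k * X k \<omega>)" for \<omega>
        unfolding K(3) sum.insert[OF K(1,2)] cK
        by (simp add: Z_def distrib_left exp_add mult_ac)
      then have "(\<integral>\<omega>. Z \<omega> * iexp (t * X j \<omega>) \<partial>M) =
          (\<integral>\<omega>. (\<Prod>j\<in>J. indicator (A j) (X j \<omega>)) * iexp (\<Sum>k\<in>I - J. ?c k * X k \<omega>) \<partial>M)" by simp
      also have "\<dots> = (\<Prod>j\<in>J. \<integral>\<omega>. indicator (A j) (X j \<omega>) \<partial>M) *
          (\<Prod>k\<in>I - J. char (distr M borel (X k)) (?c k))"
        using insert.IH[of ?c] sub J by blast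
      finally show ?thesis
        unfolding K(3) prod.insert[OF K(1,2)] cK by (simp add: char_distr mult_ac)
    qed
    have Z_int: "(\<integral>\<omega>. Z \<omega> \<partial>M) =
        (\<Prod>j\<in>J. \<integral>\<omega>. indicator (A j) (X j \<omega>) \<partial>M) * (\<Prod>k\<in>K. char (distr M borel (X k)) (c k))"
      using Z_iexp[of 0] by (simp add: prob_space)
    have "(\<integral>\<omega>. (\<Prod>j\<in>insert j J. indicator (A j) (X j \<omega>)) * iexp (\<Sum>k\<in>I - insert j J. c k * X k \<omega>) \<partial>M) =
        (\<integral>\<omega>. Z \<omega> * indicator (A j) (X j \<omega>) \<partial>M)"
      using sub by (simp add: Z_def K_def mult_ac)
    also have "\<dots> = (\<integral>\<omega>. Z \<omega> \<partial>M) * (\<integral>\<omega>. indicator (A j) (X j \<omega>) \<partial>M)"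
      by (rule factorize_complex_indicator[of "X j" Z 1])
        (simp_all only: Z_bound Z_iexp Z_int Z_meas J(2) X[OF sub(2)])
    finally show ?case using sub by (simp add: Z_int K_def[symmetric] mult_ac)
  qed
  show ?thesis
  proof (subst indep_vars_finite[where E = "\<lambda>_. sets borel"])
    show "\<forall>A\<in>(\<Pi> i\<in>I. sets borel). prob (\<Inter>j\<in>I. X j -` A j \<inter> space M) = (\<Prod>j\<in>I. prob (X j -` A j \<inter> space M))"
    proof
      fix A :: "'i \<Rightarrow> real set" assume A: "A \<in> (\<Pi> i\<in>I. sets borel)"
      have ind: "(\<integral>\<omega>. indicator (A j) (X j \<omega>) \<partial>M) = (of_real (prob (X j -` A j \<inter> space M)) :: complex)"
        if "j \<in> I" for j
      proof -
        have [measurable]: "A j \<in> sets borel" "X j \<in> borel_measurable M" using A that X by auto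
        have "(\<integral>\<omega>. indicator (A j) (X j \<omega>) \<partial>M) = (\<integral>\<omega>. of_real (indicator (X j -` A j \<inter> space M) \<omega>) \<partial>M :: complex)"
          by (intro Bochner_Integration.integral_cong) (auto simp: indicator_def)
        then show ?thesis by simp
      qed
      have [measurable]: "(\<Inter>j\<in>I. X j -` A j \<inter> space M) \<in> events"
        using A X I False by (intro sets.finite_INT measurable_sets[of _ M borel]) auto
      have "(\<integral>\<omega>. (\<Prod>j\<in>I. indicator (A j) (X j \<omega>)) \<partial>M :: complex) =
          (\<integral>\<omega>. of_real (indicator (\<Inter>j\<in>I. X j -` A j \<inter> space M) \<omega>) \<partial>M)"
        using I by (intro Bochner_Integration.integral_cong) (auto simp: indicator_def intro!: prod.neutral)
      then have "of_real (prob (\<Inter>j\<in>I. X j -` A j \<inter> space M)) =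
          (\<integral>\<omega>. (\<Prod>j\<in>I. indicator (A j) (X j \<omega>)) \<partial>M :: complex)"
        by (simp del: INT_simps)
      also have "\<dots> = (\<Prod>j\<in>I. of_real (prob (X j -` A j \<inter> space M)))"
        using key[of I A] I A ind by (simp add: Pi_iff)
      finally show "prob (\<Inter>j\<in>I. X j -` A j \<inter> space M) = (\<Prod>j\<in>I. prob (X j -` A j \<inter> space M))"
        by (simp flip: of_real_prod)
    qed
  qed (use I False X in \<open>auto simp: Int_stable_def sets.sigma_sets_eq[of borel, simplified] Pow_def\<close>)
qed

section \<open>Characteristic functions of Gaussian variables and of their products\<close>

lemma iexp_diff_bound: "norm (iexp a - iexp b) \<le> \<bar>a - b\<bar>"
proof -
  have "iexp a - iexp b = iexp b * (iexp (a - b) - 1)"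
    by (simp add: right_diff_distrib exp_diff)
  then have "norm (iexp a - iexp b) = norm (iexp (a - b) - 1)"
    by (simp add: norm_mult)
  also have "\<dots> \<le> \<bar>a - b\<bar>" using iexp_approx1[of "a - b" 0] by simp
  finally show ?thesis .
qed

text \<open>Since \<open>iexp\<close> is 1-Lipschitz, the difference of the characteristic functions at \<open>t\<close> is at most
  \<open>\<bar>t\<bar>\<close> times the \<open>L\<^sup>1\<close> distance, which the \<open>L\<^sup>2\<close> distance dominates.\<close>

lemma char_tendsto_if_L2:
  assumes [measurable]: "\<And>n. X n \<in> borel_measurable M" "Y \<in> borel_measurable M"
    and int: "\<And>n. integrable M (\<lambda>\<omega>. (X n \<omega> - Y \<omega>)\<^sup>2)"
    and lim: "(\<lambda>n. \<integral>\<omega>. (X n \<omega> - Y \<omega>)\<^sup>2 \<partial>M) \<longlonglongrightarrow> 0"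
  shows "(\<lambda>n. char (distr M borel (X n)) t) \<longlonglongrightarrow> char (distr M borel Y) t"
proof -
  have bound: "norm (char (distr M borel (X n)) t - char (distr M borel Y) t) \<le>
      \<bar>t\<bar> * sqrt (\<integral>\<omega>. (X n \<omega> - Y \<omega>)\<^sup>2 \<partial>M)" for n
  proof -
    have int1: "integrable M (\<lambda>\<omega>. \<bar>X n \<omega> - Y \<omega>\<bar>)"
      using square_integrable_imp_integrable[of "\<lambda>\<omega>. X n \<omega> - Y \<omega>"] int[of n] by simp
    have "char (distr M borel (X n)) t - char (distr M borel Y) t =
        (\<integral>\<omega>. iexp (t * X n \<omega>) - iexp (t * Y \<omega>) \<partial>M)"
      using integrable_bounded_mult_iexp[of "X n" "\<lambda>_. 1" 1 t] integrable_bounded_mult_iexp[of Y "\<lambda>_. 1" 1 t]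
      by (simp add: char_distr)
    also have "norm \<dots> \<le> (\<integral>\<omega>. norm (iexp (t * X n \<omega>) - iexp (t * Y \<omega>)) \<partial>M)"
      by (rule integral_norm_bound)
    also have "\<dots> \<le> (\<integral>\<omega>. \<bar>t\<bar> * \<bar>X n \<omega> - Y \<omega>\<bar> \<partial>M)"
    proof (rule integral_mono)
      show "norm (iexp (t * X n \<omega>) - iexp (t * Y \<omega>)) \<le> \<bar>t\<bar> * \<bar>X n \<omega> - Y \<omega>\<bar>" for \<omega>
        using iexp_diff_bound[of "t * X n \<omega>" "t * Y \<omega>"] by (simp add: abs_mult flip: right_diff_distrib)
      show "integrable M (\<lambda>\<omega>. norm (iexp (t * X n \<omega>) - iexp (t * Y \<omega>)))"
        using integrable_bounded_mult_iexp[of "X n" "\<lambda>_. 1" 1 t] integrable_bounded_mult_iexp[of Y "\<lambda>_. 1" 1 t]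
        by simp
    qed (use int1 in simp)
    also have "\<dots> = \<bar>t\<bar> * (\<integral>\<omega>. \<bar>X n \<omega> - Y \<omega>\<bar> \<partial>M)" by simp
    also have "(\<integral>\<omega>. \<bar>X n \<omega> - Y \<omega>\<bar> \<partial>M) \<le> sqrt (\<integral>\<omega>. (X n \<omega> - Y \<omega>)\<^sup>2 \<partial>M)"
      \<comment> \<open>the variance of \<open>\<bar>X n - Y\<bar>\<close> is nonnegative\<close>
      using variance_eq[OF int1] variance_positive[of "\<lambda>\<omega>. \<bar>X n \<omega> - Y \<omega>\<bar>"] int[of n]
      by (intro real_le_rsqrt) simp
    finally show ?thesis by (simp add: mult_left_mono)
  qed
  have "(\<lambda>n. \<bar>t\<bar> * sqrt (\<integral>\<omega>. (X n \<omega> - Y \<omega>)\<^sup>2 \<partial>M)) \<longlonglongrightarrow> \<bar>t\<bar> * sqrt 0"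
    by (intro tendsto_intros lim)
  then have "(\<lambda>n. \<bar>t\<bar> * sqrt (\<integral>\<omega>. (X n \<omega> - Y \<omega>)\<^sup>2 \<partial>M)) \<longlonglongrightarrow> 0" by simp
  from Lim_null_comparison[OF always_eventually[OF allI[OF bound]] this]
  have "(\<lambda>n. char (distr M borel (X n)) t - char (distr M borel Y) t) \<longlonglongrightarrow> 0" .
  then show ?thesis by (rule LIM_zero_cancel)
qed

text \<open>One formula covers the degenerate case, where both sides are \<open>1\<close>.\<close>

lemma centered_gaussian_var_law:
  assumes "centered_gaussian_var M Y"
  shows "integrable M (\<lambda>\<omega>. (Y \<omega>)\<^sup>2)"
    and "char (distr M borel Y) t = of_real (exp (- t\<^sup>2 * (\<integral>\<omega>. (Y \<omega>)\<^sup>2 \<partial>M) / 2))"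
proof -
  have Y[measurable]: "Y \<in> borel_measurable M"
    using assms by (simp add: centered_gaussian_var_def)
  consider "AE \<omega> in M. Y \<omega> = 0" | \<sigma> where "\<sigma> > 0" "distributed M lborel Y (normal_density 0 \<sigma>)"
    using assms by (auto simp: centered_gaussian_var_def)
  then have "integrable M (\<lambda>\<omega>. (Y \<omega>)\<^sup>2) \<and>
      char (distr M borel Y) t = of_real (exp (- t\<^sup>2 * (\<integral>\<omega>. (Y \<omega>)\<^sup>2 \<partial>M) / 2))"
  proof cases
    case 1
    then have "AE \<omega> in M. (Y \<omega>)\<^sup>2 = 0" by eventually_elim simp
    then have "integrable M (\<lambda>\<omega>. (Y \<omega>)\<^sup>2) \<longleftrightarrow> integrable M (\<lambda>_. 0 :: real)"
        "(\<integral>\<omega>. (Y \<omega>)\<^sup>2 \<partial>M) = (\<integral>\<omega>. 0 \<partial>M)"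
      by (intro integrable_cong_AE integral_cong_AE; simp)+
    moreover have "char (distr M borel Y) t = char (distr M borel (\<lambda>_. 0)) t"
      using 1 by (intro char_distr_AE_cong) auto
    ultimately show ?thesis by (simp add: char_distr prob_space del: distr_const)
  next
    case 2
    have var: "(\<integral>\<omega>. (Y \<omega>)\<^sup>2 \<partial>M) = \<sigma>\<^sup>2"
      using normal_distributed_variance[OF 2] by (simp add: normal_distributed_expectation[OF 2])
    then have int: "integrable M (\<lambda>\<omega>. (Y \<omega>)\<^sup>2)"
      using 2(1) not_integrable_integral_eq[of M "\<lambda>\<omega>. (Y \<omega>)\<^sup>2"] by fastforce
    have "distributed M lborel (\<lambda>x. (Y x - 0) / \<sigma>) std_normal_density"
      using normal_standard_normal_convert[OF 2(1), of Y 0] 2(2) by blast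
    then have "distr M borel (\<lambda>x. Y x / \<sigma>) = std_normal_distribution"
      by (simp add: distributed_def cong: distr_cong)
    then have "char (distr M borel (\<lambda>x. Y x / \<sigma>)) (\<sigma> * t) = of_real (exp (- (\<sigma> * t)\<^sup>2 / 2))"
      by (simp add: char_std_normal_distribution)
    then show ?thesis
      using 2(1) var int by (simp add: char_distr power_mult_distrib mult.commute)
  qed
  then show "integrable M (\<lambda>\<omega>. (Y \<omega>)\<^sup>2)"
    "char (distr M borel Y) t = of_real (exp (- t\<^sup>2 * (\<integral>\<omega>. (Y \<omega>)\<^sup>2 \<partial>M) / 2))" by blast+
qed

end

text \<open>The integrand times the standard normal density is \<open>\<sigma>\<close> times the normal density of variance
  \<open>\<sigma>\<^sup>2 = 1 / (1 + s\<^sup>2)\<close>.\<close>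

lemma integral_std_normal_exp_square:
  "(\<integral>x. exp (- s\<^sup>2 * x\<^sup>2 / 2) \<partial>std_normal_distribution) = 1 / sqrt (1 + s\<^sup>2)"
proof -
  define \<sigma> where "\<sigma> = 1 / sqrt (1 + s\<^sup>2)"
  have pos: "1 + s\<^sup>2 > 0" by (simp add: add_pos_nonneg)
  then have \<sigma>: "\<sigma> > 0" "\<sigma>\<^sup>2 = 1 / (1 + s\<^sup>2)" by (auto simp: \<sigma>_def power_divide)
  have "std_normal_density x * exp (- s\<^sup>2 * x\<^sup>2 / 2) = \<sigma> * normal_density 0 \<sigma> x" for x
  proof -
    have "exp (- x\<^sup>2 / 2) * exp (- s\<^sup>2 * x\<^sup>2 / 2) = exp (- (x - 0)\<^sup>2 / (2 * \<sigma>\<^sup>2))"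
      using pos by (simp add: \<sigma>(2) algebra_simps add_divide_distrib flip: exp_add)
    moreover have "\<sigma> * (1 / sqrt (2 * pi * \<sigma>\<^sup>2)) = 1 / sqrt (2 * pi)"
      using \<sigma>(1) by (simp add: real_sqrt_mult)
    ultimately show ?thesis
      unfolding std_normal_density_def normal_density_def[of 0 \<sigma>] by (metis mult.assoc)
  qed
  then have "(\<integral>x. exp (- s\<^sup>2 * x\<^sup>2 / 2) \<partial>std_normal_distribution) = (\<integral>x. \<sigma> * normal_density 0 \<sigma> x \<partial>lborel)"
    by (subst integral_density) auto
  then show ?thesis using \<sigma>(1) by (simp add: \<sigma>_def)
qed

text \<open>Integrating first over the value of \<open>U\<close> gives the standard normal characteristic function at
  \<open>s t y\<close>, a Gaussian in the value \<open>y\<close> of \<open>V\<close>.\<close>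

lemma (in prob_space) char_product_indep_std_normal:
  assumes UV: "indep_var borel U borel V"
    and "distr M borel U = std_normal_distribution" "distr M borel V = std_normal_distribution"
  shows "char (distr M borel (\<lambda>\<omega>. s * (U \<omega> * V \<omega>))) t = of_real (1 / sqrt (1 + (s * t)\<^sup>2))"
proof -
  let ?N = "std_normal_distribution"
  interpret N: real_distribution ?N by (rule real_dist_normal_dist)
  interpret NN: pair_prob_space ?N ?N ..
  have [measurable]: "U \<in> borel_measurable M" "V \<in> borel_measurable M"
    using UV by (auto dest: indep_var_rv1 indep_var_rv2)
  have joint: "distr M (borel \<Otimes>\<^sub>M borel) (\<lambda>\<omega>. (U \<omega>, V \<omega>)) = ?N \<Otimes>\<^sub>M ?N"
    using UV assms(2,3) unfolding indep_var_distribution_eq by simp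
  have meas: "(\<lambda>p. iexp (t * (s * (fst p * snd p)))) \<in> borel_measurable (borel \<Otimes>\<^sub>M borel)"
    by measurable
  have int: "integrable (?N \<Otimes>\<^sub>M ?N) (\<lambda>p. iexp (t * (s * (fst p * snd p))))"
    by (intro NN.integrable_const_bound[of _ 1]) (auto simp: norm_exp_i_times[of "t * (s * (fst _ * snd _))", simplified])
  have "char (distr M borel (\<lambda>\<omega>. s * (U \<omega> * V \<omega>))) t = (\<integral>\<omega>. iexp (t * (s * (U \<omega> * V \<omega>))) \<partial>M)"
    by (subst char_distr) auto
  also have "\<dots> = (\<integral>p. iexp (t * (s * (fst p * snd p))) \<partial>(?N \<Otimes>\<^sub>M ?N))"
    unfolding joint[symmetric] by (subst integral_distr[OF _ meas]) auto
  also have "\<dots> = (\<integral>y. \<integral>x. iexp (t * (s * (x * y))) \<partial>?N \<partial>?N)"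
    using NN.integral_snd[of "\<lambda>x y. iexp (t * (s * (x * y)))"] int by (simp add: case_prod_unfold)
  also have "\<dots> = (\<integral>y. char ?N (t * s * y) \<partial>?N)"
    by (simp add: char_def mult_ac)
  also have "\<dots> = (\<integral>y. of_real (exp (- (s * t)\<^sup>2 * y\<^sup>2 / 2)) \<partial>?N)"
    by (simp add: char_std_normal_distribution power_mult_distrib mult_ac)
  also have "\<dots> = of_real (1 / sqrt (1 + (s * t)\<^sup>2))"
    unfolding integral_complex_of_real integral_std_normal_exp_square ..
  finally show ?thesis .
qed

section \<open>Gaussian processes indexed by a Hilbert space\<close>

locale gaussian_hilbert_process = prob_space M for M :: "'w measure" +
  fixes W :: "'h::{real_inner, complete_space} \<Rightarrow> 'w \<Rightarrow> real"
  assumes gaussian: "centered_gaussian_process M UNIV W"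
    and covariance: "\<And>x y. (\<integral>\<omega>. W x \<omega> * W y \<omega> \<partial>M) = x \<bullet> y"
begin

lemma W_gaussian: "centered_gaussian_var M (W x)"
  using gaussian[unfolded centered_gaussian_process_def, rule_format, of "{x}" "\<lambda>_. 1"] by simp

lemma W_measurable [measurable]: "W x \<in> borel_measurable M"
  using W_gaussian by (simp add: centered_gaussian_var_def)

lemma W_mult_integrable: "integrable M (\<lambda>\<omega>. W x \<omega> * W y \<omega>)"
proof (rule Bochner_Integration.integrable_bound)
  show "integrable M (\<lambda>\<omega>. (W x \<omega>)\<^sup>2 + (W y \<omega>)\<^sup>2)"
    using centered_gaussian_var_law(1)[OF W_gaussian] by simp
  have "\<bar>W x \<omega> * W y \<omega>\<bar> \<le> (W x \<omega>)\<^sup>2 + (W y \<omega>)\<^sup>2" for \<omega>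
  proof -
    have "2 * (\<bar>W x \<omega>\<bar> * \<bar>W y \<omega>\<bar>) \<le> (W x \<omega>)\<^sup>2 + (W y \<omega>)\<^sup>2"
      using sum_squares_bound[of "\<bar>W x \<omega>\<bar>" "\<bar>W y \<omega>\<bar>"] by simp
    moreover have "0 \<le> \<bar>W x \<omega>\<bar> * \<bar>W y \<omega>\<bar>" by simp
    ultimately show ?thesis unfolding abs_mult by linarith
  qed
  then show "AE \<omega> in M. norm (W x \<omega> * W y \<omega>) \<le> norm ((W x \<omega>)\<^sup>2 + (W y \<omega>)\<^sup>2)" by simp
qed measurable

text \<open>The second moment of the difference of the two sides is computed from the covariances and
  vanishes.\<close>

lemma W_linear: "AE \<omega> in M. W (a *\<^sub>R x + b *\<^sub>R y) \<omega> = a * W x \<omega> + b * W y \<omega>"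
proof -
  let ?z = "a *\<^sub>R x + b *\<^sub>R y"
  let ?D = "\<lambda>\<omega>. W ?z \<omega> - (a * W x \<omega> + b * W y \<omega>)"
  have expand: "(?D \<omega>)\<^sup>2 = W ?z \<omega> * W ?z \<omega> + a\<^sup>2 * (W x \<omega> * W x \<omega>) + b\<^sup>2 * (W y \<omega> * W y \<omega>)
      - 2 * a * (W ?z \<omega> * W x \<omega>) - 2 * b * (W ?z \<omega> * W y \<omega>) + 2 * a * b * (W x \<omega> * W y \<omega>)" for \<omega>
    by (simp add: power2_eq_square algebra_simps)
  have int: "integrable M (\<lambda>\<omega>. (?D \<omega>)\<^sup>2)"
    unfolding expand using W_mult_integrable by simp
  have "(\<integral>\<omega>. (?D \<omega>)\<^sup>2 \<partial>M) = ?z \<bullet> ?z + a\<^sup>2 * (x \<bullet> x) + b\<^sup>2 * (y \<bullet> y)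
      - 2 * a * (?z \<bullet> x) - 2 * b * (?z \<bullet> y) + 2 * a * b * (x \<bullet> y)"
    unfolding expand using W_mult_integrable by (simp add: covariance)
  also have "\<dots> = 0"
    by (simp add: inner_add_left inner_add_right inner_commute[of y x] power2_eq_square algebra_simps)
  finally have "AE \<omega> in M. (?D \<omega>)\<^sup>2 = 0"
    using integral_nonneg_eq_0_iff_AE[OF int] by simp
  then show ?thesis by eventually_elim simp
qed

lemma char_W: "char (distr M borel (W x)) t = of_real (exp (- t\<^sup>2 * (x \<bullet> x) / 2))"
  using centered_gaussian_var_law(2)[OF W_gaussian] covariance[of x x] by (simp add: power2_eq_square)

lemma distr_W_unit:
  assumes "x \<bullet> x = 1"
  shows "distr M borel (W x) = std_normal_distribution"
proof (rule Levy_uniqueness)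
  show "real_distribution (distr M borel (W x))"
    using prob_space_distr[of "W x" borel] by (simp add: real_distribution_def real_distribution_axioms_def)
  show "char (distr M borel (W x)) = char std_normal_distribution"
    by (rule ext) (simp add: char_W assms char_std_normal_distribution)
qed (rule real_dist_normal_dist)

text \<open>A linear combination with coefficients \<open>c\<close> is centered Gaussian of variance \<open>\<Sum> (c i)\<^sup>2\<close>, so the
  joint characteristic function is the product of the marginal ones.\<close>

lemma indep_orthonormal_family:
  assumes I: "finite I" and e: "\<And>i j. i \<in> I \<Longrightarrow> j \<in> I \<Longrightarrow> e i \<bullet> e j = of_bool (i = j)"
  shows "indep_vars (\<lambda>_. borel) (\<lambda>i. W (e i)) I"
proof (rule indep_vars_if_char_factorizes[OF I])
  fix c
  let ?Y = "\<lambda>\<omega>. \<Sum>i\<in>I. c i * W (e i) \<omega>"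
  have inj: "inj_on e I"
  proof (rule inj_onI)
    fix i j assume "i \<in> I" "j \<in> I" "e i = e j"
    then show "i = j" using e[of i i] e[of i j] by (cases "i = j") simp_all
  qed
  have "centered_gaussian_var M (\<lambda>\<omega>. \<Sum>x\<in>e ` I. c (inv_into I e x) * W x \<omega>)"
    using gaussian[unfolded centered_gaussian_process_def, rule_format, of "e ` I"] I by simp
  then have Y: "centered_gaussian_var M ?Y"
    by (simp add: sum.reindex[OF inj] inj)
  have "(\<integral>\<omega>. (?Y \<omega>)\<^sup>2 \<partial>M) = (\<Sum>i\<in>I. \<Sum>j\<in>I. c i * c j * (e i \<bullet> e j))"
  proof -
    have "(?Y \<omega>)\<^sup>2 = (\<Sum>i\<in>I. \<Sum>j\<in>I. c i * c j * (W (e i) \<omega> * W (e j) \<omega>))" for \<omega>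
      unfolding power2_eq_square sum_product by (intro sum.cong) (auto simp: mult_ac)
    then show ?thesis by (simp add: W_mult_integrable covariance)
  qed
  also have "\<dots> = (\<Sum>i\<in>I. (c i)\<^sup>2)"
  proof (rule sum.cong)
    fix i assume i: "i \<in> I"
    have "(\<Sum>j\<in>I. c i * c j * (e i \<bullet> e j)) = (\<Sum>j\<in>I. if j = i then (c i)\<^sup>2 else 0)"
      using i by (intro sum.cong) (auto simp: e power2_eq_square)
    then show "(\<Sum>j\<in>I. c i * c j * (e i \<bullet> e j)) = (c i)\<^sup>2" using i I by simp
  qed simp
  finally have var: "(\<integral>\<omega>. (?Y \<omega>)\<^sup>2 \<partial>M) = (\<Sum>i\<in>I. (c i)\<^sup>2)" .
  have "(\<integral>\<omega>. iexp (?Y \<omega>) \<partial>M) = char (distr M borel ?Y) 1"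
    by (subst char_distr) auto
  also have "\<dots> = of_real (exp (\<Sum>i\<in>I. - (c i)\<^sup>2 / 2))"
    using centered_gaussian_var_law(2)[OF Y, of 1] by (simp add: var sum_negf sum_divide_distrib)
  also have "\<dots> = (\<Prod>i\<in>I. char (distr M borel (W (e i))) (c i))"
    unfolding exp_sum[OF I] of_real_prod by (intro prod.cong) (simp_all add: char_W e)
  finally show "(\<integral>\<omega>. iexp (?Y \<omega>) \<partial>M) = (\<Prod>i\<in>I. char (distr M borel (W (e i))) (c i))" .
qed simp

text \<open>The rotated pair \<open>u = (x + y)/sqrt 2\<close>, \<open>v = (x - y)/sqrt 2\<close> is again orthonormal, and
  \<open>W(x)\<^sup>2 - W(y)\<^sup>2 = 2 W(u) W(v)\<close>. This avoids the complex square roots in the characteristic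
  functions of the separate squares.\<close>

lemma char_square_difference:
  assumes x: "x \<bullet> x = 1" and y: "y \<bullet> y = 1" and xy: "x \<bullet> y = 0"
  shows "char (distr M borel (\<lambda>\<omega>. l * ((W x \<omega>)\<^sup>2 - (W y \<omega>)\<^sup>2))) t = of_real (1 / sqrt (1 + 4 * l\<^sup>2 * t\<^sup>2))"
proof -
  define c :: real where "c = 1 / sqrt 2"
  have c: "c * c = 1 / 2" by (simp add: c_def)
  define u v where "u = c *\<^sub>R x + c *\<^sub>R y" and "v = c *\<^sub>R x + (- c) *\<^sub>R y"
  have uv: "u \<bullet> u = 1" "v \<bullet> v = 1" "u \<bullet> v = 0" "v \<bullet> u = 0"
    unfolding u_def v_def inner_add_left inner_add_right inner_scaleR_left inner_scaleR_right
    using c by (simp_all add: x y xy inner_commute[of y x])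
  have "indep_vars (\<lambda>_. borel) (\<lambda>b. W (if b then u else v)) UNIV"
    by (rule indep_orthonormal_family) (auto simp: uv)
  moreover have "(\<lambda>b. W (if b then u else v)) = case_bool (W u) (W v)"
    "(\<lambda>_. borel :: real measure) = case_bool borel borel"
    by (auto split: bool.split)
  ultimately have indep: "indep_var borel (W u) borel (W v)"
    unfolding indep_var_def by metis
  have "AE \<omega> in M. l * ((W x \<omega>)\<^sup>2 - (W y \<omega>)\<^sup>2) = 2 * l * (W u \<omega> * W v \<omega>)"
    using W_linear[of c x c y] W_linear[of c x "- c" y]
  proof eventually_elim
    case (elim \<omega>)
    have "W u \<omega> * W v \<omega> = c * c * ((W x \<omega>)\<^sup>2 - (W y \<omega>)\<^sup>2)"
      unfolding u_def v_def elim by (simp add: power2_eq_square algebra_simps)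
    then have "W u \<omega> * W v \<omega> = ((W x \<omega>)\<^sup>2 - (W y \<omega>)\<^sup>2) / 2" by (simp add: c)
    then show ?case by simp
  qed
  then have "char (distr M borel (\<lambda>\<omega>. l * ((W x \<omega>)\<^sup>2 - (W y \<omega>)\<^sup>2))) t =
      char (distr M borel (\<lambda>\<omega>. 2 * l * (W u \<omega> * W v \<omega>))) t"
    by (intro char_distr_AE_cong) auto
  also have "\<dots> = of_real (1 / sqrt (1 + (2 * l * t)\<^sup>2))"
    by (rule char_product_indep_std_normal[OF indep]) (simp_all add: distr_W_unit uv)
  finally show ?thesis by (simp add: power_mult_distrib)
qed

text \<open>The squares are independent over the index set \<open>A \<times> bool\<close>, where \<open>bool\<close> distinguishes \<open>e i\<close>
  from \<open>d i\<close>. Applied to \<open>A\<close> and to each single index, the product formula for sums of independent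
  variables groups the factors into pairs, and \<open>char_square_difference\<close> evaluates each pair.\<close>

lemma char_sum_square_differences:
  assumes A: "finite A" and e: "\<And>i j. i \<in> A \<Longrightarrow> j \<in> A \<Longrightarrow> e i \<bullet> e j = of_bool (i = j)"
    and d: "\<And>i j. i \<in> A \<Longrightarrow> j \<in> A \<Longrightarrow> d i \<bullet> d j = of_bool (i = j)"
    and ed: "\<And>i j. i \<in> A \<Longrightarrow> j \<in> A \<Longrightarrow> e i \<bullet> d j = 0"
  shows "char (distr M borel (\<lambda>\<omega>. \<Sum>i\<in>A. l i * ((W (e i) \<omega>)\<^sup>2 - (W (d i) \<omega>)\<^sup>2))) t =
    (\<Prod>i\<in>A. of_real (1 / sqrt (1 + 4 * (l i)\<^sup>2 * t\<^sup>2)))"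
proof -
  define X where "X p = W (if snd p then e (fst p) else d (fst p))" for p
  define Y where "Y p \<omega> = (if snd p then l (fst p) else - l (fst p)) * (X p \<omega>)\<^sup>2" for p \<omega>
  have "indep_vars (\<lambda>_. borel) X (A \<times> UNIV)"
    unfolding X_def using e d ed A
    by (intro indep_orthonormal_family) (auto simp: inner_commute[of "d _" "e _"])
  then have indep: "indep_vars (\<lambda>_. borel) Y (A \<times> UNIV)"
    unfolding Y_def by (rule indep_vars_compose2) simp
  have pair: "(\<Sum>b\<in>UNIV. Y (i, b) \<omega>) = l i * ((W (e i) \<omega>)\<^sup>2 - (W (d i) \<omega>)\<^sup>2)" for i \<omega>
    by (simp add: UNIV_bool Y_def X_def algebra_simps)
  have "(\<lambda>\<omega>. \<Sum>i\<in>A. l i * ((W (e i) \<omega>)\<^sup>2 - (W (d i) \<omega>)\<^sup>2)) = (\<lambda>\<omega>. \<Sum>p\<in>A \<times> UNIV. Y p \<omega>)"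
    by (simp flip: pair add: sum.cartesian_product)
  then have "char (distr M borel (\<lambda>\<omega>. \<Sum>i\<in>A. l i * ((W (e i) \<omega>)\<^sup>2 - (W (d i) \<omega>)\<^sup>2))) t =
      (\<Prod>p\<in>A \<times> UNIV. char (distr M borel (Y p)) t)"
    using char_distr_sum[OF indep] by simp
  also have "\<dots> = (\<Prod>i\<in>A. \<Prod>b\<in>UNIV. char (distr M borel (Y (i, b))) t)"
    by (simp add: prod.cartesian_product)
  also have "\<dots> = (\<Prod>i\<in>A. of_real (1 / sqrt (1 + 4 * (l i)\<^sup>2 * t\<^sup>2)))"
  proof (rule prod.cong)
    fix i assume i: "i \<in> A"
    have "indep_vars (\<lambda>_. borel) Y ({i} \<times> UNIV)"
      using i by (intro indep_vars_subset[OF indep]) auto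
    then have "(\<Prod>p\<in>{i} \<times> UNIV. char (distr M borel (Y p)) t) = char (distr M borel (\<lambda>\<omega>. \<Sum>p\<in>{i} \<times> UNIV. Y p \<omega>)) t"
      by (rule char_distr_sum[symmetric])
    then have "(\<Prod>b\<in>UNIV. char (distr M borel (Y (i, b))) t) = char (distr M borel (\<lambda>\<omega>. \<Sum>b\<in>UNIV. Y (i, b) \<omega>)) t"
      by (simp add: prod.cartesian_product' sum.cartesian_product')
    then show "(\<Prod>b\<in>UNIV. char (distr M borel (Y (i, b))) t) = of_real (1 / sqrt (1 + 4 * (l i)\<^sup>2 * t\<^sup>2))"
      using i by (simp add: pair char_square_difference e d ed)
  qed simp
  finally show ?thesis .
qed

section \<open>The double Wiener integral of diagonal tensors\<close>

context
  fixes T :: "'h \<Rightarrow> 'h \<Rightarrow> 't::{real_inner, complete_space}" and I\<^sub>2 :: "'t \<Rightarrow> 'w \<Rightarrow> real"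
  assumes I2: "double_wiener_int M W T I\<^sub>2"
begin

lemma I2_measurable: "f \<in> sym_square T \<Longrightarrow> I\<^sub>2 f \<in> borel_measurable M"
  and I2_square_integrable: "f \<in> sym_square T \<Longrightarrow> integrable M (\<lambda>\<omega>. (I\<^sub>2 f \<omega>)\<^sup>2)"
  and I2_linear: "f \<in> sym_square T \<Longrightarrow> g \<in> sym_square T \<Longrightarrow>
      AE \<omega> in M. I\<^sub>2 (a *\<^sub>R f + b *\<^sub>R g) \<omega> = a * I\<^sub>2 f \<omega> + b * I\<^sub>2 g \<omega>"
  and I2_unit: "norm h = 1 \<Longrightarrow> AE \<omega> in M. I\<^sub>2 (T h h) \<omega> = (W h \<omega>)\<^sup>2 - 1"
  using I2 unfolding double_wiener_int_def by blast+

text \<open>The constants in \<open>I\<^sub>2 (T h h) = W(h)\<^sup>2 - 1\<close> cancel in differences, so that no centering remains.\<close>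

lemma I2_diagonal_sum:
  assumes "finite A" "\<And>i. i \<in> A \<Longrightarrow> norm (e i) = 1" "\<And>i. i \<in> A \<Longrightarrow> norm (d i) = 1"
  shows "(\<Sum>i\<in>A. l i *\<^sub>R (T (e i) (e i) - T (d i) (d i))) \<in> sym_square T \<and>
    (AE \<omega> in M. I\<^sub>2 (\<Sum>i\<in>A. l i *\<^sub>R (T (e i) (e i) - T (d i) (d i))) \<omega> =
      (\<Sum>i\<in>A. l i * ((W (e i) \<omega>)\<^sup>2 - (W (d i) \<omega>)\<^sup>2)))"
  using assms
proof (induction A rule: finite_induct)
  case empty
  have "0 \<in> sym_square T" by (rule subspace_0[OF sym_square_subspace])
  then show ?case using I2_linear[of 0 0 0 0] by simp
next
  case (insert j A)
  let ?f = "\<Sum>i\<in>A. l i *\<^sub>R (T (e i) (e i) - T (d i) (d i))"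
  let ?g = "T (e j) (e j) - T (d j) (d j)"
  note sub = sym_square_subspace[of T]
  have f: "?f \<in> sym_square T" and f_AE: "AE \<omega> in M. I\<^sub>2 ?f \<omega> = (\<Sum>i\<in>A. l i * ((W (e i) \<omega>)\<^sup>2 - (W (d i) \<omega>)\<^sup>2))"
    using insert by auto
  have g: "?g \<in> sym_square T"
    by (intro subspace_diff[OF sub] tensor_diag_in_sym_square)
  have unit: "norm (e j) = 1" "norm (d j) = 1" using insert.prems by auto
  have g_AE: "AE \<omega> in M. I\<^sub>2 ?g \<omega> = (W (e j) \<omega>)\<^sup>2 - (W (d j) \<omega>)\<^sup>2"
    using I2_linear[OF tensor_diag_in_sym_square tensor_diag_in_sym_square, of 1 "e j" "- 1" "d j"]
      I2_unit[OF unit(1)] I2_unit[OF unit(2)]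
    by eventually_elim simp
  have "AE \<omega> in M. I\<^sub>2 (l j *\<^sub>R ?g + 1 *\<^sub>R ?f) \<omega> = l j * I\<^sub>2 ?g \<omega> + 1 * I\<^sub>2 ?f \<omega>"
    by (rule I2_linear[OF g f])
  then have "AE \<omega> in M. I\<^sub>2 (l j *\<^sub>R ?g + ?f) \<omega> =
      l j * ((W (e j) \<omega>)\<^sup>2 - (W (d j) \<omega>)\<^sup>2) + (\<Sum>i\<in>A. l i * ((W (e i) \<omega>)\<^sup>2 - (W (d i) \<omega>)\<^sup>2))"
    using g_AE f_AE by eventually_elim simp
  moreover have "l j *\<^sub>R ?g + ?f \<in> sym_square T"
    by (intro subspace_add[OF sub] subspace_scale[OF sub] f g)
  ultimately show ?case using insert.hyps by simp
qed

lemma char_I2_diagonal_sum: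
  assumes A: "finite A" and e: "\<And>i j. i \<in> A \<Longrightarrow> j \<in> A \<Longrightarrow> e i \<bullet> e j = of_bool (i = j)"
    and d: "\<And>i j. i \<in> A \<Longrightarrow> j \<in> A \<Longrightarrow> d i \<bullet> d j = of_bool (i = j)"
    and ed: "\<And>i j. i \<in> A \<Longrightarrow> j \<in> A \<Longrightarrow> e i \<bullet> d j = 0"
  shows "char (distr M borel (I\<^sub>2 (\<Sum>i\<in>A. l i *\<^sub>R (T (e i) (e i) - T (d i) (d i))))) t =
    (\<Prod>i\<in>A. of_real (1 / sqrt (1 + 4 * (l i)\<^sup>2 * t\<^sup>2)))"
proof -
  have "norm (e i) = 1" "norm (d i) = 1" if "i \<in> A" for i
    using e[OF that that] d[OF that that] by (simp_all add: norm_eq_sqrt_inner)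
  then have sum: "(\<Sum>i\<in>A. l i *\<^sub>R (T (e i) (e i) - T (d i) (d i))) \<in> sym_square T"
      "AE \<omega> in M. I\<^sub>2 (\<Sum>i\<in>A. l i *\<^sub>R (T (e i) (e i) - T (d i) (d i))) \<omega> =
        (\<Sum>i\<in>A. l i * ((W (e i) \<omega>)\<^sup>2 - (W (d i) \<omega>)\<^sup>2))"
    using I2_diagonal_sum[of A e d l] A by blast+
  have "char (distr M borel (I\<^sub>2 (\<Sum>i\<in>A. l i *\<^sub>R (T (e i) (e i) - T (d i) (d i))))) t =
      char (distr M borel (\<lambda>\<omega>. \<Sum>i\<in>A. l i * ((W (e i) \<omega>)\<^sup>2 - (W (d i) \<omega>)\<^sup>2))) t"
    by (rule char_distr_AE_cong[OF I2_measurable[OF sum(1)] _ sum(2)]) measurable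
  then show ?thesis
    using char_sum_square_differences[OF A e d ed] by simp
qed

text \<open>The bound of the double integral makes convergence of tensors into \<open>L\<^sup>2\<close> convergence of the
  integrals.\<close>

lemma char_I2_continuous:
  assumes f: "\<And>n. f n \<in> sym_square T" "f \<longlonglongrightarrow> g"
  shows "(\<lambda>n. char (distr M borel (I\<^sub>2 (f n))) t) \<longlonglongrightarrow> char (distr M borel (I\<^sub>2 g)) t"
proof (rule char_tendsto_if_L2)
  note sub = sym_square_subspace[of T]
  have g: "g \<in> sym_square T"
    using f closed_sequentially[of "sym_square T" f g] by (simp add: sym_square_def)
  have diff: "f n - g \<in> sym_square T" for n
    by (intro subspace_diff[OF sub] f g)
  have meas[measurable]: "I\<^sub>2 (f n) \<in> borel_measurable M" "I\<^sub>2 g \<in> borel_measurable M"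
      "I\<^sub>2 (f n - g) \<in> borel_measurable M" for n
    by (intro I2_measurable f g diff)+
  then show "I\<^sub>2 (f n) \<in> borel_measurable M" "I\<^sub>2 g \<in> borel_measurable M" for n by auto
  have AE: "AE \<omega> in M. (I\<^sub>2 (f n - g) \<omega>)\<^sup>2 = (I\<^sub>2 (f n) \<omega> - I\<^sub>2 g \<omega>)\<^sup>2" for n
    using I2_linear[OF f(1)[of n] g, of 1 "-1"] by eventually_elim simp
  show "integrable M (\<lambda>\<omega>. (I\<^sub>2 (f n) \<omega> - I\<^sub>2 g \<omega>)\<^sup>2)" for n
    by (rule integrable_cong_AE_imp[OF I2_square_integrable[OF diff[of n]] _ AE[of n]]) measurable
  have int: "(\<integral>\<omega>. (I\<^sub>2 (f n) \<omega> - I\<^sub>2 g \<omega>)\<^sup>2 \<partial>M) = (\<integral>\<omega>. (I\<^sub>2 (f n - g) \<omega>)\<^sup>2 \<partial>M)" for n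
    using AE[of n] by (intro integral_cong_AE) auto
  obtain C where C: "\<And>f. f \<in> sym_square T \<Longrightarrow> (\<integral>\<omega>. (I\<^sub>2 f \<omega>)\<^sup>2 \<partial>M) \<le> C * (norm f)\<^sup>2"
    using I2 unfolding double_wiener_int_def by blast
  have "(\<lambda>n. C * (norm (f n - g))\<^sup>2) \<longlonglongrightarrow> C * 0\<^sup>2"
    using f(2) by (intro tendsto_intros tendsto_norm_zero LIM_zero)
  then have lim: "(\<lambda>n. C * (norm (f n - g))\<^sup>2) \<longlonglongrightarrow> 0" by simp
  show "(\<lambda>n. \<integral>\<omega>. (I\<^sub>2 (f n) \<omega> - I\<^sub>2 g \<omega>)\<^sup>2 \<partial>M) \<longlonglongrightarrow> 0"
  proof (rule tendsto_sandwich[OF _ _ tendsto_const lim])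
    show "\<forall>\<^sub>F n in sequentially. 0 \<le> (\<integral>\<omega>. (I\<^sub>2 (f n) \<omega> - I\<^sub>2 g \<omega>)\<^sup>2 \<partial>M)" by simp
    show "\<forall>\<^sub>F n in sequentially. (\<integral>\<omega>. (I\<^sub>2 (f n) \<omega> - I\<^sub>2 g \<omega>)\<^sup>2 \<partial>M) \<le> C * (norm (f n - g))\<^sup>2"
      unfolding int by (intro always_eventually allI C diff)
  qed
qed

end

end

section \<open>The infinite product\<close>

text \<open>A convergent infinite product must have a nonzero limit, which the convergence of the partial
  products alone does not give. The reciprocals \<open>(1 + x n) ^ m n\<close> have partial products between
  \<open>1\<close> and \<open>exp (\<Sum> m n * x n)\<close>.\<close>

lemma has_prod_inverse_powers:
  fixes x :: "nat \<Rightarrow> real" and m :: "nat \<Rightarrow> nat"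
  assumes x: "\<And>n. x n \<ge> 0" and summ: "summable (\<lambda>n. real (m n) * x n)"
    and lim: "(\<lambda>k. \<Prod>n<k. complex_of_real (1 / (1 + x n) ^ m n)) \<longlonglongrightarrow> p"
  shows "(\<lambda>n. complex_of_real (1 / (1 + x n) ^ m n)) has_prod p"
proof -
  have "convergent_prod (\<lambda>n. (1 + x n) ^ m n)"
  proof (rule bounded_imp_convergent_prod)
    show "(1 + x n) ^ m n \<ge> 1" for n using x[of n] by (simp add: one_le_power)
    show "(\<Prod>i\<le>n. (1 + x i) ^ m i) \<le> exp (\<Sum>n. real (m n) * x n)" for n
    proof -
      have "(1 + x i) ^ m i \<le> exp (real (m i) * x i)" for i
        using power_mono[OF exp_ge_add_one_self, of "x i" "m i"] x[of i] by (simp add: exp_of_nat_mult)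
      then have "(\<Prod>i\<le>n. (1 + x i) ^ m i) \<le> (\<Prod>i\<le>n. exp (real (m i) * x i))"
        using x by (intro prod_mono) simp
      also have "\<dots> = exp (\<Sum>i\<le>n. real (m i) * x i)" by (rule exp_sum[symmetric]) simp
      also have "\<dots> \<le> exp (\<Sum>n. real (m n) * x n)"
        using x summ by (simp add: sum_le_suminf)
      finally show ?thesis .
    qed
  qed
  then have "convergent_prod (\<lambda>n. inverse ((1 + x n) ^ m n))" by (rule convergent_prod_inverse)
  then have "convergent_prod (complex_of_real \<circ> (\<lambda>n. 1 / (1 + x n) ^ m n))"
    by (simp only: convergent_prod_of_real_iff inverse_eq_divide)
  then have "(\<lambda>n. complex_of_real (1 / (1 + x n) ^ m n)) has_prod prodinf (\<lambda>n. complex_of_real (1 / (1 + x n) ^ m n))"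
    by (simp only: comp_def convergent_prod_has_prod)
  then show ?thesis
    using has_prod_imp_tendsto' LIMSEQ_unique[OF lim] by metis
qed

theorem proposition4p1:
  fixes M :: "'w measure"
    and X :: "2 \<Rightarrow> real \<Rightarrow> 'w \<Rightarrow> real"
    and R :: "2 \<Rightarrow> real \<Rightarrow> real \<Rightarrow> real"
    and \<iota>\<^sub>1 :: "(real \<Rightarrow> real) \<Rightarrow> 'h1::{real_inner, complete_space}"
    and \<iota>\<^sub>2 :: "(real \<Rightarrow> real) \<Rightarrow> 'h2::{real_inner, complete_space}"
    and \<iota> :: "(real \<times> 2 \<Rightarrow> real) \<Rightarrow> 'h::{real_inner, complete_space}"
    and T :: "'h \<Rightarrow> 'h \<Rightarrow> 't::{real_inner, complete_space}"
    and W :: "'h \<Rightarrow> 'w \<Rightarrow> real"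
    and I\<^sub>2 :: "'t \<Rightarrow> 'w \<Rightarrow> real"
    and fL :: 't
    and F :: "'h \<Rightarrow> 'h"
  assumes "prob_space M"
    and "\<And>i. centered_gaussian_process M {0..1} (X i)"
    and "\<And>i. AE \<omega> in M. continuous_on {0..1} (\<lambda>t. X i t \<omega>)"
    and "\<And>i. AE \<omega> in M. X i 0 \<omega> = 0"
    and "prob_space.indep_var M
           (\<Pi>\<^sub>M t\<in>{0..1}. borel) (\<lambda>\<omega>. \<lambda>t\<in>{0..1}. X 1 t \<omega>)
           (\<Pi>\<^sub>M t\<in>{0..1}. borel) (\<lambda>\<omega>. \<lambda>t\<in>{0..1}. X 2 t \<omega>)"
    and "\<And>i s t. s \<in> {0..1} \<Longrightarrow> t \<in> {0..1} \<Longrightarrow> R i s t = (\<integral>\<omega>. X i s \<omega> * X i t \<omega> \<partial>M)"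
    and "is_completion steps (step_form (R 1)) \<iota>\<^sub>1"
    and "is_completion steps (step_form (R 2)) \<iota>\<^sub>2"
    and "same_completion \<iota>\<^sub>1 \<iota>\<^sub>2"
    and "is_completion steps2 (step_form2 R) \<iota>"
    and "is_hilbert_tensor T"
    and "isonormal M X \<iota> W"
    and "double_wiener_int M W T I\<^sub>2"
    and "represents_levy_kernel R \<iota> T fL"
    and "hs_operator T fL F"
  shows "(\<forall>l. l \<noteq> 0 \<longrightarrow> eigenval F l \<longrightarrow>
            (\<exists>B. finite B \<and> span B = eigenspace F l) \<and> even (dim (eigenspace F l)) \<and>
            eigenval F (- l) \<and> dim (eigenspace F (- l)) = dim (eigenspace F l)) \<and>
         countable {a. a > 0 \<and> eigenval F a} \<and>
         (\<exists>m :: real \<Rightarrow> nat. (\<forall>a. a > 0 \<longrightarrow> eigenval F a \<longrightarrow> m a \<ge> 1) \<and>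
            (\<forall>(N :: nat set) \<alpha>. bij_betw \<alpha> N {a. a > 0 \<and> eigenval F a} \<longrightarrow>
              (\<forall>t. (\<lambda>n. if n \<in> N then complex_of_real (1 / (1 + 4 * (\<alpha> n)\<^sup>2 * t\<^sup>2) ^ m (\<alpha> n)) else 1)
                     has_prod char (distr M borel (I\<^sub>2 fL)) t)))"
proof -
  interpret gaussian_hilbert_process M W
    using assms(1,12) unfolding isonormal_def gaussian_hilbert_process_def gaussian_hilbert_process_axioms_def
    by blast
  have eq: "step_form (R 1) \<phi> \<psi> = step_form (R 2) \<phi> \<psi>" if "\<phi> \<in> steps" "\<psi> \<in> steps" for \<phi> \<psi>
    using same_completion_imp_step_form_eq[OF assms(7,8,9) that] .
  have fL: "fL \<in> sym_square T" using assms(14) by (simp add: represents_levy_kernel_def)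
  obtain J S :: "'h \<Rightarrow> 'h" where
    JS: "\<And>x y. J x \<bullet> J y = x \<bullet> y" "\<And>x. J (J x) = - x" "\<And>x y. fL \<bullet> T (J x) (J y) = fL \<bullet> T x y"
      "\<And>x y. S x \<bullet> S y = x \<bullet> y" "\<And>x. S (S x) = x" "\<And>x y. fL \<bullet> T (S x) (S y) = - (fL \<bullet> T x y)"
    by (rule levy_kernel_symmetries[OF assms(10) _ assms(14) tensor_bilinear[OF assms(11)]], erule (1) eq) (rule that)
  interpret symmetric_hs_operator T fL F J S
    using assms(11,15) sym_square_symmetric[OF assms(11) fL] JS by unfold_locales
  note I2 = assms(13)
  have "(\<exists>B. finite B \<and> span B = eigenspace F l) \<and> even (dim (eigenspace F l)) \<and>
      eigenval F (- l) \<and> dim (eigenspace F (- l)) = dim (eigenspace F l)"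
    if "l \<noteq> 0" "eigenval F l" for l
    using eigenbasis[OF that(1)] dim_eigenspace[OF that(1)] eigenval_uminus[OF that(2)] by auto
  \<comment> \<open>multiplicities are even, so the division is exact\<close>
  moreover define m where "m a = card (eigenbasis a) div 2" for a
  have card: "card (eigenbasis a) = 2 * m a" if "a > 0" for a
    using eigenbasis(4)[of a] that by (simp add: m_def)
  have "m a \<ge> 1" if "a > 0" "eigenval F a" for a
    using card[OF that(1)] eigenval_iff_eigenbasis[of a] eigenbasis(1)[of a] that
    by (cases "m a = 0") auto
  moreover have "(\<lambda>n. if n \<in> N then complex_of_real (1 / (1 + 4 * (\<alpha> n)\<^sup>2 * t\<^sup>2) ^ m (\<alpha> n)) else 1)
      has_prod char (distr M borel (I\<^sub>2 fL)) t"
    if \<alpha>: "bij_betw \<alpha> N {a. a > 0 \<and> eigenval F a}" for N :: "nat set" and \<alpha> t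
  proof -
    have pos: "\<alpha> n > 0" if "n \<in> N" for n
      using \<alpha> that by (auto simp: bij_betw_def)
    have nz: "\<alpha> n \<noteq> 0" if "n \<in> N" for n
      using pos[OF that] by simp
    have fin_basis: "finite (eigenbasis (\<alpha> n))" if "n \<in> N" for n
      using nz[OF that] by (rule eigenbasis(1))
    \<comment> \<open>the value 0 outside \<open>N\<close> turns the missing factors into 1\<close>
    define q where "q n = (if n \<in> N then 4 * (\<alpha> n)\<^sup>2 * t\<^sup>2 else 0)" for n
    define factor where "factor n = complex_of_real (1 / (1 + q n) ^ m (\<alpha> n))" for n
    define partial where "partial k = (\<Sum>n<k. if n \<in> N then block (\<alpha> n) else 0)" for k
    \<comment> \<open>the index pairs \<open>(n, e)\<close> make the basis vectors of all blocks below \<open>k\<close> one orthonormal family\<close>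
    define A where "A k = (SIGMA n:{..<k} \<inter> N. eigenbasis (\<alpha> n))" for k
    have fin: "finite (A k)" for k
      unfolding A_def by (intro finite_SigmaI) (auto simp: fin_basis)
    have eig: "snd i \<in> eigenspace F (\<alpha> (fst i))" "S (snd i) \<in> eigenspace F (- \<alpha> (fst i))" "\<alpha> (fst i) > 0"
      if "i \<in> A k" for i k
      using that pos eigenbasis_subset[OF nz, of "fst i" "snd i"]
        eigenspace_S[of "snd i" "\<alpha> (fst i)"] by (auto simp: A_def)
    have orth: "snd i \<bullet> snd j = of_bool (i = j)" if "i \<in> A k" "j \<in> A k" for i j k
    proof (cases "fst i = fst j")
      case True
      then have "snd i \<in> eigenbasis (\<alpha> (fst i))" "snd j \<in> eigenbasis (\<alpha> (fst i))" using that by (auto simp: A_def)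
      then show ?thesis
        using eigenbasis(2)[of "\<alpha> (fst i)"] eig(3)[OF that(1)] True by (simp add: orthonormal_def prod_eq_iff)
    next
      case False
      then have "\<alpha> (fst i) \<noteq> \<alpha> (fst j)"
        using that \<alpha> by (auto simp: A_def bij_betw_def inj_on_eq_iff)
      then show ?thesis
        using eigenspaces_orthogonal[OF eig(1)[OF that(1)] eig(1)[OF that(2)]] False by auto
    qed
    have orth_S: "snd i \<bullet> S (snd j) = 0" if "i \<in> A k" "j \<in> A k" for i j k
      using eigenspaces_orthogonal[OF eig(1)[OF that(1)] eig(2)[OF that(2)]] eig(3)[OF that(1)] eig(3)[OF that(2)]
      by simp
    have partial: "partial k = (\<Sum>i\<in>A k. \<alpha> (fst i) *\<^sub>R (T (snd i) (snd i) - T (S (snd i)) (S (snd i))))" for k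
    proof -
      have "partial k = (\<Sum>n\<in>{..<k} \<inter> N. block (\<alpha> n))"
        by (simp add: partial_def sum.If_cases)
      also have "\<dots> = (\<Sum>i\<in>A k. \<alpha> (fst i) *\<^sub>R (T (snd i) (snd i) - T (S (snd i)) (S (snd i))))"
        unfolding A_def block_def
        by (subst sum.Sigma) (auto simp: case_prod_unfold fin_basis)
      finally show ?thesis .
    qed
    have "partial k \<in> sym_square T" for k
      unfolding partial
      by (intro subspace_sum[OF sym_square_subspace] subspace_scale[OF sym_square_subspace]
          subspace_diff[OF sym_square_subspace] tensor_diag_in_sym_square)
    then have lim: "(\<lambda>k. char (distr M borel (I\<^sub>2 (partial k))) t) \<longlonglongrightarrow> char (distr M borel (I\<^sub>2 fL)) t"
      using block_series(1)[OF \<alpha>] by (intro char_I2_continuous[OF I2]) (auto simp: partial_def)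
    have "char (distr M borel (I\<^sub>2 (partial k))) t = (\<Prod>n<k. factor n)" for k
    proof -
      have "char (distr M borel (I\<^sub>2 (partial k))) t =
          (\<Prod>i\<in>A k. complex_of_real (1 / sqrt (1 + 4 * (\<alpha> (fst i))\<^sup>2 * t\<^sup>2)))"
        unfolding partial by (intro char_I2_diagonal_sum[OF I2] fin) (auto simp: JS(4) orth orth_S)
      also have "\<dots> = (\<Prod>n\<in>{..<k} \<inter> N. \<Prod>e\<in>eigenbasis (\<alpha> n). complex_of_real (1 / sqrt (1 + 4 * (\<alpha> n)\<^sup>2 * t\<^sup>2)))"
        unfolding A_def
        by (subst prod.Sigma) (auto simp: case_prod_unfold fin_basis)
      also have "\<dots> = (\<Prod>n\<in>{..<k} \<inter> N. factor n)"
      proof (rule prod.cong)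
        fix n assume n: "n \<in> {..<k} \<inter> N"
        \<comment> \<open>a block has \<open>2 m\<close> basis vectors, each contributing a square root\<close>
        have "0 \<le> 1 + 4 * (\<alpha> n)\<^sup>2 * t\<^sup>2" by (simp add: add_nonneg_nonneg)
        then have "sqrt (1 + 4 * (\<alpha> n)\<^sup>2 * t\<^sup>2) ^ (2 * m (\<alpha> n)) = (1 + 4 * (\<alpha> n)\<^sup>2 * t\<^sup>2) ^ m (\<alpha> n)"
          by (simp add: power_mult)
        then show "(\<Prod>e\<in>eigenbasis (\<alpha> n). complex_of_real (1 / sqrt (1 + 4 * (\<alpha> n)\<^sup>2 * t\<^sup>2))) = factor n"
          using n pos[of n] by (simp add: card factor_def q_def power_divide flip: of_real_power)
      qed simp
      also have "\<dots> = (\<Prod>n<k. factor n)"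
        by (rule prod.mono_neutral_left) (auto simp: factor_def q_def)
      finally show ?thesis .
    qed
    with lim have lim': "(\<lambda>k. \<Prod>n<k. factor n) \<longlonglongrightarrow> char (distr M borel (I\<^sub>2 fL)) t" by simp
    have "real (m (\<alpha> n)) * q n = 2 * t\<^sup>2 * (if n \<in> N then (\<alpha> n)\<^sup>2 * card (eigenbasis (\<alpha> n)) else 0)" for n
      using card[OF pos[of n]] by (simp add: q_def)
    then have "summable (\<lambda>n. real (m (\<alpha> n)) * q n)"
      using summable_mult[OF block_series(2)[OF \<alpha>], of "2 * t\<^sup>2"] by simp
    then have "factor has_prod char (distr M borel (I\<^sub>2 fL)) t"
      using has_prod_inverse_powers[OF _ _ lim'[unfolded factor_def]] unfolding factor_def
      by (simp add: q_def)
    moreover have "factor = (\<lambda>n. if n \<in> N then complex_of_real (1 / (1 + 4 * (\<alpha> n)\<^sup>2 * t\<^sup>2) ^ m (\<alpha> n)) else 1)"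
      by (auto simp: factor_def q_def)
    ultimately show ?thesis by simp
  qed
  ultimately show ?thesis using countable_positive_eigenvalues by blast
qed

end
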